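(* Let $\mathbb{K}$ be a field with $\operatorname{char}(\mathbb{K})=p>0$, let $R=\mathbb{K}[X_1,\ldots,X_n]$ be the standard graded polynomial ring, $I\subset R$ a homogeneous ideal, and $e\ge 1$ an integer. Let $I^{[p^e]}$ be the $p^e$-th Frobenius power of $I$. Then $\beta_{i,j}(R/I^{[p^e]})\ne 0$ only if $j=p^e k$ for some $k$ with $\beta_{i,k}(R/I)\neq 0$. Moreover, $\beta_{i,p^e k}(R/I^{[p^e]})=\beta_{i,k}(R/I)$ for every $k$ and every $i\ge 0$.
   Context: The $p^e$-th Frobenius power $I^{[p^e]}$ of $I$ is the ideal of $R$ generated by $\{f^{p^e}: f\in I\}$. The graded Betti numbers are $\beta_{i,j}(R/I)=\dim_{\mathbb{K}}\operatorname{Tor}_i^R(\mathbb{K},R/I)_j$ for $i\ge 0$, $j\in\mathbb{Z}$. *)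

theory Defs
  imports
    "HOL-Library.Poly_Mapping"
    "HOL-Algebra.QuotRing"
    "HOL-Algebra.Generated_Groups"
    "Jordan_Normal_Form.VS_Connect"
begin

section \<open>Graded modules\<close>

text \<open>\<open>hcomp M j\<close> is the homogeneous component of degree \<open>j\<close>. A graded ring is represented as the
  graded module it forms over itself, so that it can be used both as a ring and as a module. For other
  modules the fields \<open>mult\<close> and \<open>one\<close> play no role.\<close>

record ('r, 'm) gmodule = "('r, 'm) module" +
  hcomp :: "int \<Rightarrow> 'm set"

definition graded_hom ::
  "('r, 'x) ring_scheme \<Rightarrow> ('r, 'm, 'y) gmodule_scheme \<Rightarrow> ('r, 'n, 'z) gmodule_scheme \<Rightarrow> ('m \<Rightarrow> 'n) set"
  where "graded_hom R M N = {f \<in> LinearCombinations.module_hom R M N. \<forall>j. f ` hcomp M j \<subseteq> hcomp N j}"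

definition quot_module :: "('r, 'm, 'x) module_scheme \<Rightarrow> 'm set \<Rightarrow> ('r, 'm set) module"
  where "quot_module M N =
    \<lparr>carrier = a_rcosets\<^bsub>M\<^esub> N, mult = undefined, one = undefined,
     zero = N, add = set_add M, smult = (\<lambda>r C. \<Union>x\<in>C. N +>\<^bsub>M\<^esub> (r \<odot>\<^bsub>M\<^esub> x))\<rparr>"

definition gquot :: "('r, 'm, 'x) gmodule_scheme \<Rightarrow> 'm set \<Rightarrow> ('r, 'm set) gmodule"
  where "gquot M N =
    module.extend (quot_module M N) (gmodule.fields (\<lambda>j. (\<lambda>x. N +>\<^bsub>M\<^esub> x) ` hcomp M j))"

definition free_module :: "('r, 'x) ring_scheme \<Rightarrow> 'b set \<Rightarrow> ('r, 'b \<Rightarrow> 'r) module"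
  where "free_module R B =
    \<lparr>carrier = {v. range v \<subseteq> carrier R \<and> (\<forall>b. b \<notin> B \<longrightarrow> v b = \<zero>\<^bsub>R\<^esub>) \<and> finite {b. v b \<noteq> \<zero>\<^bsub>R\<^esub>}},
     mult = undefined, one = undefined,
     zero = (\<lambda>b. \<zero>\<^bsub>R\<^esub>), add = (\<lambda>v w b. v b \<oplus>\<^bsub>R\<^esub> w b), smult = (\<lambda>r v b. r \<otimes>\<^bsub>R\<^esub> v b)\<rparr>"

definition basis_vec :: "('r, 'x) ring_scheme \<Rightarrow> 'b \<Rightarrow> 'b \<Rightarrow> 'r"
  where "basis_vec R b = (\<lambda>c. if c = b then \<one>\<^bsub>R\<^esub> else \<zero>\<^bsub>R\<^esub>)"

text \<open>The direct sum of the shifts \<open>R(- \<delta> b)\<close>: the basis vector \<open>b\<close> has degree \<open>\<delta> b\<close>.\<close>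

definition gfree :: "('r, 'r, 'x) gmodule_scheme \<Rightarrow> 'b set \<Rightarrow> ('b \<Rightarrow> int) \<Rightarrow> ('r, 'b \<Rightarrow> 'r) gmodule"
  where "gfree R B \<delta> =
    module.extend (free_module R B)
      (gmodule.fields (\<lambda>j. {v \<in> carrier (free_module R B). \<forall>b\<in>B. v b \<in> hcomp R (j - \<delta> b)}))"

section \<open>Tensor products\<close>

definition tensor_rels ::
  "('r, 'x) ring_scheme \<Rightarrow> ('r, 'm, 'y) module_scheme \<Rightarrow> ('r, 'n, 'z) module_scheme \<Rightarrow> ('m \<times> 'n \<Rightarrow> 'r) set"
  where "tensor_rels R M N =
    (let F = free_module R (carrier M \<times> carrier N); E = (\<lambda>x y. basis_vec R (x, y)) in
      {E (x \<oplus>\<^bsub>M\<^esub> x') y \<ominus>\<^bsub>F\<^esub> (E x y \<oplus>\<^bsub>F\<^esub> E x' y) | x x' y.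
         x \<in> carrier M \<and> x' \<in> carrier M \<and> y \<in> carrier N} \<union>
      {E x (y \<oplus>\<^bsub>N\<^esub> y') \<ominus>\<^bsub>F\<^esub> (E x y \<oplus>\<^bsub>F\<^esub> E x y') | x y y'.
         x \<in> carrier M \<and> y \<in> carrier N \<and> y' \<in> carrier N} \<union>
      {E (r \<odot>\<^bsub>M\<^esub> x) y \<ominus>\<^bsub>F\<^esub> (r \<odot>\<^bsub>F\<^esub> E x y) | r x y.
         r \<in> carrier R \<and> x \<in> carrier M \<and> y \<in> carrier N} \<union>
      {E x (r \<odot>\<^bsub>N\<^esub> y) \<ominus>\<^bsub>F\<^esub> (r \<odot>\<^bsub>F\<^esub> E x y) | r x y.
         r \<in> carrier R \<and> x \<in> carrier M \<and> y \<in> carrier N})"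

definition tensor_rel_span ::
  "('r, 'x) ring_scheme \<Rightarrow> ('r, 'm, 'y) module_scheme \<Rightarrow> ('r, 'n, 'z) module_scheme \<Rightarrow> ('m \<times> 'n \<Rightarrow> 'r) set"
  where "tensor_rel_span R M N =
    LinearCombinations.module.span R (free_module R (carrier M \<times> carrier N)) (tensor_rels R M N)"

definition tensor ::
  "('r, 'x) ring_scheme \<Rightarrow> ('r, 'm, 'y) module_scheme \<Rightarrow> ('r, 'n, 'z) module_scheme
    \<Rightarrow> ('r, ('m \<times> 'n \<Rightarrow> 'r) set) module"
  where "tensor R M N =
    quot_module (free_module R (carrier M \<times> carrier N)) (tensor_rel_span R M N)"

definition pure_tensor ::
  "('r, 'x) ring_scheme \<Rightarrow> ('r, 'm, 'y) module_scheme \<Rightarrow> ('r, 'n, 'z) module_scheme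
    \<Rightarrow> 'm \<Rightarrow> 'n \<Rightarrow> ('m \<times> 'n \<Rightarrow> 'r) set"
  where "pure_tensor R M N x y =
    tensor_rel_span R M N +>\<^bsub>free_module R (carrier M \<times> carrier N)\<^esub> basis_vec R (x, y)"

definition gtensor ::
  "('r, 'x) ring_scheme \<Rightarrow> ('r, 'm, 'y) gmodule_scheme \<Rightarrow> ('r, 'n, 'z) gmodule_scheme
    \<Rightarrow> ('r, ('m \<times> 'n \<Rightarrow> 'r) set) gmodule"
  where "gtensor R M N =
    module.extend (tensor R M N)
      (gmodule.fields (\<lambda>j. generate (add_monoid (tensor R M N))
         {pure_tensor R M N x y | x y a b. x \<in> hcomp M a \<and> y \<in> hcomp N b \<and> a + b = j}))"

text \<open>\<open>tensor_map R M N N' f\<close> is \<open>id\<^sub>M \<otimes> f\<close>; extensionality only fixes its values outside the carrier.\<close>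

definition tensor_map ::
  "('r, 'x) ring_scheme \<Rightarrow> ('r, 'm, 'y) module_scheme \<Rightarrow> ('r, 'n, 'z) module_scheme
    \<Rightarrow> ('r, 'l, 'w) module_scheme \<Rightarrow> ('n \<Rightarrow> 'l) \<Rightarrow> ('m \<times> 'n \<Rightarrow> 'r) set \<Rightarrow> ('m \<times> 'l \<Rightarrow> 'r) set"
  where "tensor_map R M N N' f =
    (THE h. h \<in> LinearCombinations.module_hom R (tensor R M N) (tensor R M N') \<and>
       h \<in> extensional (carrier (tensor R M N)) \<and>
       (\<forall>x\<in>carrier M. \<forall>y\<in>carrier N. h (pure_tensor R M N x y) = pure_tensor R M N' x (f y)))"

section \<open>Graded free resolutions and Tor\<close>

text \<open>The \<open>i\<close>-th module of a resolution has basis \<open>gens P i\<close>, with basis degrees \<open>gen_deg P i\<close>;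
  \<open>diff P i\<close> maps the module \<open>i + 1\<close> to the module \<open>i\<close>. Bases are indexed by natural numbers, so
  only resolutions with countable bases are covered; over a polynomial ring in finitely many
  variables every finitely generated graded module has one.\<close>

record ('r, 'm) resolution =
  gens :: "nat \<Rightarrow> nat set"
  gen_deg :: "nat \<Rightarrow> nat \<Rightarrow> int"
  diff :: "nat \<Rightarrow> (nat \<Rightarrow> 'r) \<Rightarrow> (nat \<Rightarrow> 'r)"
  aug :: "(nat \<Rightarrow> 'r) \<Rightarrow> 'm"

definition res_module ::
  "('r, 'r, 'x) gmodule_scheme \<Rightarrow> ('r, 'm) resolution \<Rightarrow> nat \<Rightarrow> ('r, nat \<Rightarrow> 'r) gmodule"
  where "res_module R P i = gfree R (gens P i) (gen_deg P i)"

definition graded_free_resolution ::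
  "('r, 'r, 'x) gmodule_scheme \<Rightarrow> ('r, 'm, 'y) gmodule_scheme \<Rightarrow> ('r, 'm) resolution \<Rightarrow> bool"
  where "graded_free_resolution R M P \<longleftrightarrow>
    (let F = res_module R P in
      aug P \<in> graded_hom R (F 0) M \<and>
      (\<forall>i. diff P i \<in> graded_hom R (F (Suc i)) (F i)) \<and>
      aug P ` carrier (F 0) = carrier M \<and>
      diff P 0 ` carrier (F 1) = a_kernel (F 0) M (aug P) \<and>
      (\<forall>i. diff P (Suc i) ` carrier (F (Suc (Suc i))) = a_kernel (F (Suc i)) (F i) (diff P i)))"

text \<open>\<open>Tor R N M i\<close> is the homology at position \<open>i\<close> of the complex \<open>N \<otimes>\<^sub>R P\<close> for an arbitrarily chosen
  graded free resolution \<open>P\<close> of \<open>M\<close>; the choice depends on \<open>R\<close> and \<open>M\<close> only.\<close>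

definition Tor ::
  "('r, 'r, 'x) gmodule_scheme \<Rightarrow> ('r, 'n, 'y) gmodule_scheme \<Rightarrow> ('r, 'm, 'z) gmodule_scheme
    \<Rightarrow> nat \<Rightarrow> ('r, ('n \<times> (nat \<Rightarrow> 'r) \<Rightarrow> 'r) set set) gmodule"
  where "Tor R N M i =
    (let P = (SOME P. graded_free_resolution R M P);
         F = res_module R P;
         T = (\<lambda>i. gtensor R N (F i));
         d = (\<lambda>i. tensor_map R N (F (Suc i)) (F i) (diff P i));
         Z = (case i of 0 \<Rightarrow> carrier (T 0) | Suc k \<Rightarrow> a_kernel (T (Suc k)) (T k) (d k))
     in gquot ((T i)\<lparr>carrier := Z, hcomp := \<lambda>j. hcomp (T i) j \<inter> Z\<rparr>) (d i ` carrier (T (Suc i))))"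

section \<open>The standard graded polynomial ring and graded Betti numbers\<close>

text \<open>The variables are \<open>X\<^sub>0, \<dots>, X\<^sub>n\<^sub>-\<^sub>1\<close>; a monomial is its exponent vector.\<close>

type_synonym 'k mpoly = "(nat \<Rightarrow>\<^sub>0 nat) \<Rightarrow>\<^sub>0 'k"

definition poly_ring :: "nat \<Rightarrow> ('k::field mpoly, 'k mpoly) gmodule"
  where "poly_ring n =
    \<lparr>carrier = {f. \<forall>m\<in>Poly_Mapping.keys f. Poly_Mapping.keys m \<subseteq> {..<n}}, mult = (*), one = 1, zero = 0, add = (+), smult = (*),
     hcomp = (\<lambda>j. {f. \<forall>m\<in>Poly_Mapping.keys f. Poly_Mapping.keys m \<subseteq> {..<n} \<and> int (\<Sum>v<n. Poly_Mapping.lookup m v) = j})\<rparr>"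

text \<open>\<open>K = R/(X\<^sub>0, \<dots>, X\<^sub>n\<^sub>-\<^sub>1)\<close>, concentrated in degree \<open>0\<close>: polynomials act through their constant
  coefficient.\<close>

definition residue_field :: "('k::field mpoly, 'k) gmodule"
  where "residue_field =
    \<lparr>carrier = UNIV, mult = (*), one = 1, zero = 0, add = (+), smult = (\<lambda>f c. Poly_Mapping.lookup f 0 * c),
     hcomp = (\<lambda>j. if j = 0 then UNIV else {0})\<rparr>"

definition homogeneous_ideal :: "('r, 'r, 'x) gmodule_scheme \<Rightarrow> 'r set \<Rightarrow> bool"
  where "homogeneous_ideal R I \<longleftrightarrow>
    ideal I R \<and> (\<exists>S. S \<subseteq> (\<Union>j. hcomp R j) \<and> I = Idl\<^bsub>R\<^esub> S)"

definition frobenius_power :: "('r, 'x) ring_scheme \<Rightarrow> 'r set \<Rightarrow> nat \<Rightarrow> 'r set"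
  where "frobenius_power R I q = Idl\<^bsub>R\<^esub> {f [^]\<^bsub>R\<^esub> q | f. f \<in> I}"

text \<open>The component of degree \<open>j\<close>, with scalars restricted to the constant polynomials.\<close>

definition comp_space :: "('k::field mpoly, 'm, 'x) gmodule_scheme \<Rightarrow> int \<Rightarrow> ('k, 'm) module"
  where "comp_space M j =
    \<lparr>carrier = hcomp M j, mult = undefined, one = undefined,
     zero = \<zero>\<^bsub>M\<^esub>, add = add M, smult = (\<lambda>c x. Poly_Mapping.single 0 c \<odot>\<^bsub>M\<^esub> x)\<rparr>"

text \<open>\<open>betti n I i j\<close> is \<open>\<beta>\<^sub>i\<^sub>,\<^sub>j(R/I)\<close> for \<open>R\<close> the polynomial ring in \<open>n\<close> variables.\<close>

definition betti :: "nat \<Rightarrow> 'k::field mpoly set \<Rightarrow> nat \<Rightarrow> int \<Rightarrow> nat"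
  where "betti n I i j =
    vectorspace.dim class_ring
      (comp_space (Tor (poly_ring n) residue_field (gquot (poly_ring n) I) i) j)"

end

theory Submission
  imports Defs "HOL-Library.Function_Algebras" "HOL-Library.Countable_Set"
    "HOL-Computational_Algebra.Primes"
begin

text \<open>Write \<open>q = p\<^sup>e\<close>. The Frobenius functor raises all entries of the matrices of a graded free
  resolution of \<open>R/I\<close> to the power \<open>q\<close> and multiplies the degrees of the basis vectors by \<open>q\<close>. It is
  exact: in terms of a basis of \<open>K\<close> over \<open>K\<^sup>q\<close>, every polynomial is a finite sum of terms
  \<open>\<kappa> X\<^sup>\<alpha> g\<^sup>q\<close> with all exponents in \<open>\<alpha>\<close> below \<open>q\<close>, and the coordinate \<open>g\<close> depends \<open>R\<close>-linearly on the
  polynomial when \<open>R\<close> acts through \<open>q\<close>-th powers. Hence it turns a minimal resolution of \<open>R/I\<close> into a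
  minimal resolution of \<open>R/I\<^sup>[\<^sup>q\<^sup>]\<close>. By the comparison theorem, the Betti numbers computed from any graded
  free resolution count the basis vectors of a minimal one.\<close>

section \<open>Homogeneous polynomials\<close>

text \<open>\<open>Tor\<close> uses a resolution picked by \<open>SOME\<close>: its bases may be
  infinite and its maps are arbitrary outside the carriers, so all information about it has to come
  from comparison with a minimal resolution. That comparison takes place on constant coefficients: K
  \<otimes> F is F modulo the variables, the class of 1 \<otimes> v is determined by
  \<open>ev v\<close>, and the quotients of formal sums that define tensor products enter only
  through this fact. The minimal resolution is built degree by degree; what makes this possible is
  that every module has finitely many basis vectors up to each degree, so that linear algebra over K
  applies in a single degree and induction on the degree has a starting point. The scalars \<kappa>
  appear because K may be imperfect; for perfect K, the element 1 alone is a basis over the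
  \<open>q\<close>-th powers. The twisted maps are R-linear, and on a vector of \<open>q\<close>-th
  powers they agree with the \<open>q\<close>-th power of the original map. Since each vector is a
  combination of the \<open>q\<close>-th powers of its coordinates, exactness and minimality of the
  twisted complex need to be tested only on such vectors.\<close>

abbreviation cf :: "('a \<Rightarrow>\<^sub>0 'b::zero) \<Rightarrow> 'a \<Rightarrow> 'b"
  where "cf \<equiv> Poly_Mapping.lookup"

abbreviation supp :: "('a \<Rightarrow>\<^sub>0 'b::zero) \<Rightarrow> 'a set"
  where "supp \<equiv> Poly_Mapping.keys"

abbreviation mon :: "'a \<Rightarrow> 'b \<Rightarrow> 'a \<Rightarrow>\<^sub>0 'b::zero"
  where "mon \<equiv> Poly_Mapping.single"

abbreviation pol :: "nat \<Rightarrow> 'k::field mpoly set"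
  where "pol n \<equiv> carrier (poly_ring n)"

abbreviation hpol :: "nat \<Rightarrow> int \<Rightarrow> 'k::field mpoly set"
  where "hpol n j \<equiv> hcomp (poly_ring n) j"

definition dg :: "nat \<Rightarrow> (nat \<Rightarrow>\<^sub>0 nat) \<Rightarrow> int"
  where "dg n m = int (\<Sum>v<n. cf m v)"

lemma dg_add: "dg n (a + b) = dg n a + dg n b"
  by (simp add: dg_def lookup_add sum.distrib)

lemma dg_zero [simp]: "dg n 0 = 0"
  by (simp add: dg_def)

lemma dg_nonneg: "0 \<le> dg n m"
  unfolding dg_def by (rule of_nat_0_le_iff)

lemma dg_eq_0: "supp m \<subseteq> {..<n} \<Longrightarrow> dg n m = 0 \<Longrightarrow> m = 0"
  unfolding dg_def
  by (rule poly_mapping_eqI) (metis finite_lessThan in_keys_iff lookup_zero of_nat_eq_0_iff subsetD sum_eq_0_iff)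

lemma pol_iff: "f \<in> pol n \<longleftrightarrow> (\<forall>m\<in>supp f. supp m \<subseteq> {..<n})"
  by (simp add: poly_ring_def)

lemma hpol_iff: "f \<in> hpol n j \<longleftrightarrow>
    (\<forall>m\<in>supp f. supp m \<subseteq> {..<n} \<and> dg n m = j)"
  by (simp add: poly_ring_def dg_def)

lemma poly_ring_simps [simp]:
  "mult (poly_ring n) = (*)" "one (poly_ring n) = 1" "zero (poly_ring n) = 0"
  "add (poly_ring n) = (+)" "smult (poly_ring n) = (*)"
  by (simp_all add: poly_ring_def)

text \<open>The case \<open>single\<close> is restricted to terms of \<open>f\<close> itself, so
  that whatever is known about its support (degree, variables) can be used there, while closure
  under sums is asked of arbitrary polynomials.\<close>

lemma mpoly_add_induct [consumes 0, case_names zero single add]: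
  fixes f :: "'a \<Rightarrow>\<^sub>0 'b::comm_monoid_add"
  assumes "P 0" and "\<And>m. m \<in> supp f \<Longrightarrow> P (mon m (cf f m))"
    and "\<And>g h. P g \<Longrightarrow> P h \<Longrightarrow> P (g + h)"
  shows "P f"
proof -
  have "f = (\<Sum>m\<in>supp f. mon m (cf f m))"
    by (rule poly_mapping_eqI)
      (auto simp: lookup_sum lookup_single when_def sum.delta in_keys_iff)
  moreover have "P (\<Sum>m\<in>X. mon m (cf f m))"
    if "finite X" "X \<subseteq> supp f" for X
    using that by (induction X) (auto intro: assms)
  ultimately show ?thesis by (metis finite_keys subset_refl)
qed

lemma pol_zero [simp]: "0 \<in> pol n"
  by (simp add: pol_iff)

lemma pol_one [simp]: "1 \<in> pol n"
  by (simp add: pol_iff)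

lemma pol_add: "f \<in> pol n \<Longrightarrow> g \<in> pol n \<Longrightarrow> f + g \<in> pol n"
  using keys_add[of f g] by (auto simp: pol_iff)

lemma pol_uminus: "f \<in> pol n \<Longrightarrow> - f \<in> pol n"
  by (auto simp: pol_iff in_keys_iff)

lemma keys_add_nat: "supp (a + b :: 'a \<Rightarrow>\<^sub>0 nat) = supp a \<union> supp b"
  by (auto simp: in_keys_iff lookup_add)

lemma pol_mult: "f \<in> pol n \<Longrightarrow> g \<in> pol n \<Longrightarrow> f * g \<in> pol n"
  using keys_mult[of f g] by (fastforce simp: pol_iff keys_add_nat)

lemma pol_power: "f \<in> pol n \<Longrightarrow> f ^ q \<in> pol n"
  by (induction q) (auto intro: pol_mult)

lemma pol_sum: "(\<And>x. x \<in> A \<Longrightarrow> f x \<in> pol n) \<Longrightarrow> sum f A \<in> pol n"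
  by (induction A rule: infinite_finite_induct) (auto intro: pol_add)

lemma pol_single: "supp m \<subseteq> {..<n} \<Longrightarrow> mon m c \<in> pol n"
  by (simp add: pol_iff)

lemma pol_const [simp]: "mon 0 c \<in> pol n"
  by (simp add: pol_single)

lemma hpol_pol: "f \<in> hpol n j \<Longrightarrow> f \<in> pol n"
  by (simp add: pol_iff hpol_iff)

lemma hpol_zero [simp]: "0 \<in> hpol n j"
  by (simp add: hpol_iff)

lemma hpol_add: "f \<in> hpol n j \<Longrightarrow> g \<in> hpol n j \<Longrightarrow> f + g \<in> hpol n j"
  using keys_add[of f g] by (auto simp: hpol_iff)

lemma hpol_uminus: "f \<in> hpol n j \<Longrightarrow> - f \<in> hpol n j"
  by (auto simp: hpol_iff in_keys_iff)

lemma hpol_mult: "f \<in> hpol n a \<Longrightarrow> g \<in> hpol n b \<Longrightarrow> f * g \<in> hpol n (a + b)"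
  using keys_mult[of f g] by (fastforce simp: hpol_iff keys_add_nat dg_add)

lemma hpol_power: "f \<in> hpol n a \<Longrightarrow> f ^ q \<in> hpol n (int q * a)"
proof (induction q)
  case 0
  then show ?case by (simp add: hpol_iff)
next
  case (Suc q)
  then show ?case using hpol_mult[of f n a "f ^ q" "int q * a"] by (simp add: algebra_simps)
qed

lemma hpol_single:
  "supp m \<subseteq> {..<n} \<Longrightarrow> dg n m = j \<Longrightarrow> mon m c \<in> hpol n j"
  by (simp add: hpol_iff)

lemma hpol_const [simp]: "mon 0 c \<in> hpol n 0"
  by (simp add: hpol_single)

lemma hpol_one [simp]: "1 \<in> hpol n 0"
  by (simp add: hpol_iff)

lemma hpol_negative: "f \<in> hpol n j \<Longrightarrow> j < 0 \<Longrightarrow> f = 0"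
  using dg_nonneg by (metis hpol_iff keys_eq_empty ex_in_conv not_less)

lemma hpol_coeff_0: "f \<in> hpol n j \<Longrightarrow> j \<noteq> 0 \<Longrightarrow> cf f 0 = 0"
  by (metis hpol_iff in_keys_iff dg_zero)

lemma hpol_0_eq_const: "f \<in> hpol n 0 \<Longrightarrow> f = mon 0 (cf f 0)"
  by (rule poly_mapping_eqI) (metis hpol_iff dg_eq_0 in_keys_iff lookup_single_eq lookup_single_not_eq)

text \<open>Exponents are natural numbers, so a sum of two exponent vectors vanishes only if both
  do. Hence the constant coefficient is multiplicative: it is the augmentation through which
  polynomials act on the residue field.\<close>

lemma coeff_0_mult:
  fixes f g :: "(nat \<Rightarrow>\<^sub>0 nat) \<Rightarrow>\<^sub>0 'k::comm_ring_1"
  shows "cf (f * g) 0 = cf f 0 * cf g 0"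
proof (induction f rule: mpoly_add_induct)
  case (single a)
  show ?case
  proof (induction g rule: mpoly_add_induct)
    case (single b)
    have "a + b = 0 \<longleftrightarrow> a = 0 \<and> b = 0"
      by (auto simp: poly_mapping_eq_iff fun_eq_iff lookup_add)
    then show ?case by (auto simp: mult_single lookup_single when_def)
  qed (auto simp: lookup_add algebra_simps)
qed (auto simp: lookup_add algebra_simps)

lemma coeff_0_power:
  fixes f :: "(nat \<Rightarrow>\<^sub>0 nat) \<Rightarrow>\<^sub>0 'k::comm_ring_1"
  shows "cf (f ^ q) 0 = cf f 0 ^ q"
  by (induction q) (auto simp: coeff_0_mult)

section \<open>Homogeneous components of a polynomial\<close>

definition hcp :: "nat \<Rightarrow> int \<Rightarrow> 'k::field mpoly \<Rightarrow> 'k mpoly"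
  where "hcp n k f = Poly_Mapping.mapp (\<lambda>m c. c when dg n m = k) f"

lemma lookup_hcp: "cf (hcp n k f) m = (cf f m when dg n m = k)"
  by (auto simp: hcp_def lookup_mapp when_def in_keys_iff)

lemma hcp_zero [simp]: "hcp n k 0 = 0"
  by (rule poly_mapping_eqI) (simp add: lookup_hcp)

lemma hcp_add: "hcp n k (f + g) = hcp n k f + hcp n k g"
  by (rule poly_mapping_eqI) (simp add: lookup_hcp lookup_add when_def)

lemma hcp_sum: "hcp n k (sum f A) = (\<Sum>x\<in>A. hcp n k (f x))"
  by (induction A rule: infinite_finite_induct) (auto simp: hcp_add)

lemma hcp_hpol: "f \<in> pol n \<Longrightarrow> hcp n k f \<in> hpol n k"
  by (auto simp: hpol_iff pol_iff in_keys_iff lookup_hcp)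

lemma hcp_of_hpol: "f \<in> hpol n j \<Longrightarrow> hcp n k f = (if j = k then f else 0)"
  by (rule poly_mapping_eqI) (auto simp: hpol_iff lookup_hcp in_keys_iff when_def)

text \<open>Both sides are additive in \<open>f\<close> and in \<open>g\<close>, which leaves
  monomials; those offered for \<open>f\<close> come from its support and therefore have degree
  \<open>d\<close>.\<close>

lemma hcp_mult:
  assumes "f \<in> hpol n d"
  shows "hcp n k (f * g) = f * hcp n (k - d) g"
proof (induction f rule: mpoly_add_induct)
  case (single a)
  have a: "dg n a = d" using single assms by (auto simp: hpol_iff)
  show ?case
  proof (induction g rule: mpoly_add_induct)
    case (single b)
    have *: "hcp n k (mon m (c::'a)) = (mon m c when dg n m = k)"
      for m c k
      by (rule poly_mapping_eqI) (auto simp: lookup_hcp lookup_single when_def)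
    show ?case
      unfolding mult_single * using a by (auto simp: mult_single when_def dg_add)
  qed (auto simp: hcp_add algebra_simps)
qed (auto simp: hcp_add algebra_simps)

lemma hcp_finite: "finite {k. hcp n k f \<noteq> 0}"
proof (rule finite_subset)
  show "{k. hcp n k f \<noteq> 0} \<subseteq> dg n ` supp f"
  proof
    fix k assume "k \<in> {k. hcp n k f \<noteq> 0}"
    then obtain m where "cf (hcp n k f) m \<noteq> 0"
      by (metis (mono_tags, lifting) lookup_zero mem_Collect_eq poly_mapping_eqI)
    then show "k \<in> dg n ` supp f"
      by (auto simp: lookup_hcp in_keys_iff when_def split: if_splits)
  qed
qed simp

lemma sum_hcp:
  assumes "finite S" "{k. hcp n k f \<noteq> 0} \<subseteq> S"
  shows "(\<Sum>k\<in>S. hcp n k f) = f"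
proof (rule poly_mapping_eqI)
  fix m
  have "dg n m \<in> S" if "cf f m \<noteq> 0"
  proof -
    have "cf (hcp n (dg n m) f) m \<noteq> 0" using that by (simp add: lookup_hcp)
    then show ?thesis using assms(2) by auto
  qed
  then show "cf (\<Sum>k\<in>S. hcp n k f) m = cf f m"
    using assms(1) by (auto simp: lookup_sum lookup_hcp when_def sum.delta')
qed

section \<open>Graded free modules and their maps\<close>

type_synonym 'k pvec = "nat \<Rightarrow> 'k mpoly"

definition vscale :: "'k::field mpoly \<Rightarrow> ('i \<Rightarrow> 'k mpoly) \<Rightarrow> ('i \<Rightarrow> 'k mpoly)"  (infixr \<open>\<star>\<close> 75)
  where "r \<star> v = (\<lambda>b. r * v b)"

text \<open>The carrier of \<open>free_module\<close> in type-class terms. The index type is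
  arbitrary because the formal sums behind a tensor product, indexed by pairs, are vectors of the
  same kind as those of a resolution.\<close>

definition FM :: "nat \<Rightarrow> 'i set \<Rightarrow> ('i \<Rightarrow> 'k::field mpoly) set"
  where "FM n B = {v. (\<forall>b. v b \<in> pol n) \<and> (\<forall>b. b \<notin> B \<longrightarrow> v b = 0) \<and> finite {b. v b \<noteq> 0}}"

definition FH :: "nat \<Rightarrow> nat set \<Rightarrow> (nat \<Rightarrow> int) \<Rightarrow> int \<Rightarrow> 'k::field pvec set"
  where "FH n B \<delta> j = {v \<in> FM n B. \<forall>b\<in>B. v b \<in> hpol n (j - \<delta> b)}"

definition bv :: "'i \<Rightarrow> 'i \<Rightarrow> 'k::field mpoly"
  where "bv b = (\<lambda>c. if c = b then 1 else 0)"

text \<open>Reduction modulo the ideal generated by the variables; these are the coordinates of 1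
  \<otimes> v over the residue field.\<close>

definition ev :: "'k::field pvec \<Rightarrow> nat \<Rightarrow> 'k"
  where "ev v = (\<lambda>b. cf (v b) 0)"

text \<open>Projection to degree \<open>j\<close>: the basis vector \<open>b\<close> contributes
  \<open>\<delta> b\<close> to the degree, which leaves \<open>j - \<delta> b\<close> for its
  coefficient.\<close>

definition pj :: "nat \<Rightarrow> (nat \<Rightarrow> int) \<Rightarrow> int \<Rightarrow> 'k::field pvec \<Rightarrow> 'k pvec"
  where "pj n \<delta> j v = (\<lambda>b. hcp n (j - \<delta> b) (v b))"

lemma sum_apply: "(\<Sum>a\<in>A. f a) x = (\<Sum>a\<in>A. f a x)"
  by (induction A rule: infinite_finite_induct) auto

lemma vscale_apply: "(r \<star> v) b = r * v b"
  by (simp add: vscale_def)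

lemmas pointwise = plus_fun_apply zero_fun_apply minus_apply uminus_apply vscale_apply

text \<open>As simplification rules these would expand vectors to \<open>\<lambda>\<close>-terms.\<close>

declare pointwise [simp del]

lemma vscale_add_right: "r \<star> (u + v) = r \<star> u + r \<star> v"
  and vscale_add_left: "(r + s) \<star> v = r \<star> v + s \<star> v"
  and vscale_diff: "r \<star> (u - v) = r \<star> u - r \<star> v"
  and vscale_assoc: "r \<star> s \<star> v = (r * s) \<star> v"
  and vscale_one [simp]: "1 \<star> v = v"
  and vscale_zero_left [simp]: "0 \<star> v = 0"
  and vscale_zero_right [simp]: "r \<star> 0 = 0"
  and vscale_uminus_one: "(- 1) \<star> v = - v"
  by (auto simp: fun_eq_iff pointwise algebra_simps)

lemma vscale_sum: "r \<star> (\<Sum>a\<in>A. f a) = (\<Sum>a\<in>A. r \<star> f a)"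
  by (rule HOL.ext) (simp add: sum_apply pointwise sum_distrib_left)

lemma bv_apply: "bv b c = (if c = b then 1 else 0)"
  by (simp add: bv_def)

lemma ev_add: "ev (u + v) = ev u + ev v"
  and ev_diff: "ev (u - v) = ev u - ev v"
  and ev_uminus: "ev (- v) = - ev v"
  and ev_zero [simp]: "ev 0 = 0"
  and ev_vscale: "ev (r \<star> v) = (\<lambda>b. cf r 0 * ev v b)"
  by (auto simp: ev_def fun_eq_iff pointwise lookup_add lookup_minus coeff_0_mult)

lemma ev_sum: "ev (\<Sum>a\<in>A. f a) = (\<Sum>a\<in>A. ev (f a))"
  by (rule HOL.ext) (simp add: ev_def sum_apply lookup_sum)

lemma FM_zero [simp]: "0 \<in> FM n B"
  by (simp add: FM_def pointwise)

lemma FM_add: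
  assumes "u \<in> FM n B" "v \<in> FM n B"
  shows "u + v \<in> FM n B"
proof -
  have "finite {b. (u + v) b \<noteq> 0}"
    by (rule finite_subset[of _ "{b. u b \<noteq> 0} \<union> {b. v b \<noteq> 0}"]) (use assms in \<open>auto simp: FM_def pointwise\<close>)
  then show ?thesis using assms by (auto simp: FM_def pointwise pol_add)
qed

lemma FM_vscale:
  assumes "r \<in> pol n" "v \<in> FM n B"
  shows "r \<star> v \<in> FM n B"
proof -
  have "finite {b. (r \<star> v) b \<noteq> 0}"
    by (rule finite_subset[of _ "{b. v b \<noteq> 0}"]) (use assms in \<open>auto simp: FM_def pointwise\<close>)
  then show ?thesis using assms by (auto simp: FM_def pointwise pol_mult)
qed

lemma FM_uminus: "v \<in> FM n B \<Longrightarrow> - v \<in> FM n B"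
  using FM_vscale[of "- 1" n v B] by (simp add: vscale_uminus_one pol_uminus)

lemma FM_diff: "u \<in> FM n B \<Longrightarrow> v \<in> FM n B \<Longrightarrow> u - v \<in> FM n B"
  using FM_add[OF _ FM_uminus] by (metis add_uminus_conv_diff)

lemma FM_sum: "(\<And>a. a \<in> A \<Longrightarrow> f a \<in> FM n B) \<Longrightarrow> (\<Sum>a\<in>A. f a) \<in> FM n B"
  by (induction A rule: infinite_finite_induct) (auto intro: FM_add)

lemma FM_bv: "b \<in> B \<Longrightarrow> bv b \<in> FM n B"
  by (auto simp: FM_def bv_def)

lemma FM_finite: "v \<in> FM n B \<Longrightarrow> finite {b. v b \<noteq> 0}"
  and FM_pol: "v \<in> FM n B \<Longrightarrow> v b \<in> pol n"
  and FM_supp: "v \<in> FM n B \<Longrightarrow> v b \<noteq> 0 \<Longrightarrow> b \<in> B"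
  by (auto simp: FM_def)

lemma FM_expand:
  assumes "finite S" "{b. v b \<noteq> 0} \<subseteq> S"
  shows "(\<Sum>b\<in>S. v b \<star> bv b) = v"
proof
  fix c
  have "v c = 0" if "c \<notin> S" using that assms(2) by blast
  then show "(\<Sum>b\<in>S. v b \<star> bv b) c = v c"
    using assms(1) by (auto simp: sum_apply pointwise bv_def if_distrib sum.delta' cong: if_cong)
qed

lemma FM_induct [consumes 1, case_names zero bv add]:
  assumes "v \<in> FM n B" and "P 0"
    and bv: "\<And>r b. r \<in> pol n \<Longrightarrow> b \<in> B \<Longrightarrow> P (r \<star> bv b)"
    and add: "\<And>u w. u \<in> FM n B \<Longrightarrow> w \<in> FM n B \<Longrightarrow> P u \<Longrightarrow> P w \<Longrightarrow> P (u + w)"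
  shows "P v"
proof -
  have *: "P (\<Sum>b\<in>S. v b \<star> bv b) \<and> (\<Sum>b\<in>S. v b \<star> bv b) \<in> FM n B"
    if "finite S" "S \<subseteq> {b. v b \<noteq> 0}" for S
    using that
  proof (induction S)
    case empty
    show ?case unfolding sum.empty using assms(2) FM_zero by (rule conjI)
  next
    case (insert b S)
    then have "b \<in> B" "v b \<in> pol n" using assms(1) FM_supp FM_pol by auto
    then show ?case using insert by (auto intro!: bv add FM_add FM_vscale FM_bv)
  qed
  then have "P (\<Sum>b | v b \<noteq> 0. v b \<star> bv b)" using FM_finite[OF assms(1)] by auto
  then show ?thesis using FM_expand[of "{b. v b \<noteq> 0}" v] FM_finite[OF assms(1)] by auto
qed

lemma FH_FM: "v \<in> FH n B \<delta> j \<Longrightarrow> v \<in> FM n B"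
  by (simp add: FH_def)

lemma FH_zero [simp]: "0 \<in> FH n B \<delta> j"
  by (simp add: FH_def pointwise)

lemma FH_add: "u \<in> FH n B \<delta> j \<Longrightarrow> v \<in> FH n B \<delta> j \<Longrightarrow> u + v \<in> FH n B \<delta> j"
  by (simp add: FH_def FM_add hpol_add pointwise)

lemma FH_vscale: "r \<in> hpol n d \<Longrightarrow> v \<in> FH n B \<delta> j \<Longrightarrow> r \<star> v \<in> FH n B \<delta> (d + j)"
  using hpol_mult[of r n d] by (auto simp: FH_def FM_vscale hpol_pol pointwise add_diff_eq[symmetric])

lemma FH_const: "v \<in> FH n B \<delta> j \<Longrightarrow> mon 0 c \<star> v \<in> FH n B \<delta> j"
  using FH_vscale[OF hpol_const] by fastforce

lemma FH_uminus: "v \<in> FH n B \<delta> j \<Longrightarrow> - v \<in> FH n B \<delta> j"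
  by (simp add: FH_def FM_uminus hpol_uminus pointwise)

lemma FH_diff: "u \<in> FH n B \<delta> j \<Longrightarrow> v \<in> FH n B \<delta> j \<Longrightarrow> u - v \<in> FH n B \<delta> j"
  using FH_add[OF _ FH_uminus] by (metis add_uminus_conv_diff)

lemma FH_sum: "(\<And>a. a \<in> A \<Longrightarrow> f a \<in> FH n B \<delta> j) \<Longrightarrow> (\<Sum>a\<in>A. f a) \<in> FH n B \<delta> j"
  by (induction A rule: infinite_finite_induct) (auto intro: FH_add)

lemma FH_bv: "b \<in> B \<Longrightarrow> bv b \<in> FH n B \<delta> (\<delta> b)"
  using FM_bv[of b B n] by (auto simp: FH_def bv_def)

lemma FH_hpol: "v \<in> FH n B \<delta> j \<Longrightarrow> v b \<in> hpol n (j - \<delta> b)"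
  by (cases "b \<in> B") (auto simp: FH_def FM_def)

lemma pj_add: "pj n \<delta> j (u + v) = pj n \<delta> j u + pj n \<delta> j v"
  and pj_zero [simp]: "pj n \<delta> j 0 = 0"
  by (auto simp: pj_def fun_eq_iff pointwise hcp_add)

lemma pj_FH:
  assumes "v \<in> FM n B"
  shows "pj n \<delta> j v \<in> FH n B \<delta> j"
proof -
  have "finite {b. pj n \<delta> j v b \<noteq> 0}"
    by (rule finite_subset[OF _ FM_finite[OF assms]]) (auto simp: pj_def)
  then show ?thesis using assms by (auto simp: FH_def FM_def pj_def intro: hcp_hpol hpol_pol)
qed

lemma pj_of_FH: "v \<in> FH n B \<delta> j \<Longrightarrow> pj n \<delta> k v = (if j = k then v else 0)"
  by (rule HOL.ext) (auto simp: pj_def pointwise hcp_of_hpol[OF FH_hpol])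

lemma pj_finite:
  assumes "v \<in> FM n B"
  shows "finite {j. pj n \<delta> j v \<noteq> 0}"
proof (rule finite_subset)
  show "{j. pj n \<delta> j v \<noteq> 0} \<subseteq> (\<Union>b\<in>{b. v b \<noteq> 0}. (\<lambda>k. k + \<delta> b) ` {k. hcp n k (v b) \<noteq> 0})"
  proof
    fix j assume "j \<in> {j. pj n \<delta> j v \<noteq> 0}"
    then obtain b where "hcp n (j - \<delta> b) (v b) \<noteq> 0"
      by (auto simp: pj_def fun_eq_iff pointwise)
    then show "j \<in> (\<Union>b\<in>{b. v b \<noteq> 0}. (\<lambda>k. k + \<delta> b) ` {k. hcp n k (v b) \<noteq> 0})"
      by (auto intro!: exI[of _ b] image_eqI[of _ _ "j - \<delta> b"])
  qed
qed (use FM_finite[OF assms] hcp_finite in auto)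

lemma sum_pj:
  assumes "finite S" "{j. pj n \<delta> j v \<noteq> 0} \<subseteq> S"
  shows "(\<Sum>j\<in>S. pj n \<delta> j v) = v"
proof
  fix b
  have "(\<Sum>j\<in>S. hcp n (j - \<delta> b) (v b)) = (\<Sum>k\<in>(\<lambda>j. j - \<delta> b) ` S. hcp n k (v b))"
    by (subst sum.reindex) (auto simp: inj_on_def)
  also have "\<dots> = v b"
  proof (rule sum_hcp)
    show "{k. hcp n k (v b) \<noteq> 0} \<subseteq> (\<lambda>j. j - \<delta> b) ` S"
    proof
      fix k assume "k \<in> {k. hcp n k (v b) \<noteq> 0}"
      then have "pj n \<delta> (k + \<delta> b) v b \<noteq> 0" by (simp add: pj_def)
      then have "k + \<delta> b \<in> S" using assms(2) by (metis (mono_tags) mem_Collect_eq subsetD zero_fun_apply)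
      then show "k \<in> (\<lambda>j. j - \<delta> b) ` S" by force
    qed
  qed (use assms in simp)
  finally show "(\<Sum>j\<in>S. pj n \<delta> j v) b = v b" by (simp add: sum_apply pj_def)
qed

section \<open>Graded linear maps between free modules\<close>

definition glin ::
  "nat \<Rightarrow> nat set \<Rightarrow> (nat \<Rightarrow> int) \<Rightarrow> nat set \<Rightarrow> (nat \<Rightarrow> int) \<Rightarrow> ('k::field pvec \<Rightarrow> 'k pvec) \<Rightarrow> bool"
  where "glin n B \<delta> B' \<delta>' \<phi> \<longleftrightarrow>
    (\<forall>v\<in>FM n B. \<phi> v \<in> FM n B') \<and>
    (\<forall>u\<in>FM n B. \<forall>v\<in>FM n B. \<phi> (u + v) = \<phi> u + \<phi> v) \<and>
    (\<forall>r\<in>pol n. \<forall>v\<in>FM n B. \<phi> (r \<star> v) = r \<star> \<phi> v) \<and>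
    (\<forall>j. \<forall>v\<in>FH n B \<delta> j. \<phi> v \<in> FH n B' \<delta>' j)"

lemma glin_FM: "glin n B \<delta> B' \<delta>' \<phi> \<Longrightarrow> v \<in> FM n B \<Longrightarrow> \<phi> v \<in> FM n B'"
  and glin_add: "glin n B \<delta> B' \<delta>' \<phi> \<Longrightarrow> u \<in> FM n B \<Longrightarrow> v \<in> FM n B \<Longrightarrow> \<phi> (u + v) = \<phi> u + \<phi> v"
  and glin_vscale: "glin n B \<delta> B' \<delta>' \<phi> \<Longrightarrow> r \<in> pol n \<Longrightarrow> v \<in> FM n B \<Longrightarrow> \<phi> (r \<star> v) = r \<star> \<phi> v"
  and glin_FH: "glin n B \<delta> B' \<delta>' \<phi> \<Longrightarrow> v \<in> FH n B \<delta> j \<Longrightarrow> \<phi> v \<in> FH n B' \<delta>' j"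
  by (auto simp: glin_def)

lemma glin_zero: "glin n B \<delta> B' \<delta>' \<phi> \<Longrightarrow> \<phi> 0 = 0"
  using glin_vscale[of n B \<delta> B' \<delta>' \<phi> 0 0] by simp

lemma glin_uminus: "glin n B \<delta> B' \<delta>' \<phi> \<Longrightarrow> v \<in> FM n B \<Longrightarrow> \<phi> (- v) = - \<phi> v"
  using glin_vscale[of n B \<delta> B' \<delta>' \<phi> "- 1" v] by (simp add: vscale_uminus_one pol_uminus)

lemma glin_diff:
  assumes "glin n B \<delta> B' \<delta>' \<phi>" "u \<in> FM n B" "v \<in> FM n B"
  shows "\<phi> (u - v) = \<phi> u - \<phi> v"
  using glin_add[OF assms(1,2) FM_uminus[OF assms(3)]] glin_uminus[OF assms(1,3)] by simp

lemma glin_sum: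
  assumes "glin n B \<delta> B' \<delta>' \<phi>" "\<And>a. a \<in> A \<Longrightarrow> f a \<in> FM n B"
  shows "\<phi> (\<Sum>a\<in>A. f a) = (\<Sum>a\<in>A. \<phi> (f a))"
  using assms(2)
  by (induction A rule: infinite_finite_induct)
    (auto simp: glin_zero[OF assms(1)] glin_add[OF assms(1)] FM_sum)

lemma glin_id: "glin n B \<delta> B \<delta> (\<lambda>v. v)"
  by (simp add: glin_def)

lemma glin_const_zero: "glin n B \<delta> B' \<delta>' (\<lambda>v. 0)"
  by (simp add: glin_def)

lemma glin_comp:
  "glin n B \<delta> B' \<delta>' \<phi> \<Longrightarrow> glin n B' \<delta>' B'' \<delta>'' \<psi> \<Longrightarrow> glin n B \<delta> B'' \<delta>'' (\<lambda>v. \<psi> (\<phi> v))"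
  by (simp add: glin_def)

lemma glin_minus:
  fixes \<phi> \<psi> :: "'k::field pvec \<Rightarrow> 'k pvec"
  assumes "glin n B \<delta> B' \<delta>' \<phi>" "glin n B \<delta> B' \<delta>' \<psi>"
  shows "glin n B \<delta> B' \<delta>' (\<lambda>v. \<phi> v - \<psi> v)"
  unfolding glin_def
proof (intro conjI ballI allI)
  fix u v :: "'k pvec" assume "u \<in> FM n B" "v \<in> FM n B"
  then show "\<phi> (u + v) - \<psi> (u + v) = \<phi> u - \<psi> u + (\<phi> v - \<psi> v)"
    by (simp only: glin_add[OF assms(1)] glin_add[OF assms(2)] add_diff_add)
next
  fix r :: "'k mpoly" and v :: "'k pvec" assume "r \<in> pol n" "v \<in> FM n B"
  then show "\<phi> (r \<star> v) - \<psi> (r \<star> v) = r \<star> (\<phi> v - \<psi> v)"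
    by (simp only: glin_vscale[OF assms(1)] glin_vscale[OF assms(2)] vscale_diff)
qed (auto intro: FM_diff FH_diff glin_FM[OF assms(1)] glin_FM[OF assms(2)]
    glin_FH[OF assms(1)] glin_FH[OF assms(2)])

lemma glin_eqI:
  assumes "glin n B \<delta> B' \<delta>' \<phi>" "glin n B \<epsilon> C \<epsilon>' \<psi>"
    and "\<And>b. b \<in> B \<Longrightarrow> \<phi> (bv b) = \<psi> (bv b)" and "v \<in> FM n B"
  shows "\<phi> v = \<psi> v"
  using assms(4)
proof (induction rule: FM_induct)
  case zero
  show ?case unfolding glin_zero[OF assms(1)] glin_zero[OF assms(2)] ..
next
  case (bv r b)
  show ?case
    unfolding glin_vscale[OF assms(1) bv(1) FM_bv[OF bv(2)]] assms(3)[OF bv(2)]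
      glin_vscale[OF assms(2) bv(1) FM_bv[OF bv(2)]] ..
next
  case (add u w)
  show ?case unfolding glin_add[OF assms(1) add(1,2)] glin_add[OF assms(2) add(1,2)] add(3,4) ..
qed

text \<open>The constant coefficients of \<open>\<phi> v\<close> are a combination of those of the
  vectors \<open>\<phi> (bv b)\<close>, with the entries of \<open>ev v\<close> as coefficients. So
  \<open>\<phi>\<close> induces a map on constant coefficients, namely K \<otimes> \<phi>.\<close>

lemma glin_ev:
  assumes "glin n B \<delta> B' \<delta>' \<phi>" "v \<in> FM n B" "ev v = 0"
  shows "ev (\<phi> v) = 0"
proof -
  let ?S = "{b. v b \<noteq> 0}"
  have S: "finite ?S" "?S \<subseteq> B" "\<And>b. v b \<in> pol n"
    using assms(2) by (auto simp: FM_def)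
  have "\<phi> v = \<phi> (\<Sum>b\<in>?S. v b \<star> bv b)" using FM_expand[of ?S v] S by simp
  also have "\<dots> = (\<Sum>b\<in>?S. v b \<star> \<phi> (bv b))"
    using S by (subst glin_sum[OF assms(1)])
      (auto intro!: FM_vscale FM_bv sum.cong glin_vscale[OF assms(1)])
  finally have "ev (\<phi> v) = (\<Sum>b\<in>?S. (\<lambda>c. ev v b * ev (\<phi> (bv b)) c))"
    by (simp add: ev_sum ev_vscale) (simp add: ev_def)
  then show ?thesis using assms(3) by (simp add: fun_eq_iff sum_apply pointwise)
qed

text \<open>On a multiple of a basis vector this is \<open>hcp_mult\<close> for the entries of
  \<open>\<phi> (bv b)\<close>, which are homogeneous because \<open>\<phi>\<close> preserves
  degrees.\<close>

lemma glin_pj: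
  assumes "glin n B \<delta> B' \<delta>' \<phi>" "v \<in> FM n B"
  shows "\<phi> (pj n \<delta> j v) = pj n \<delta>' j (\<phi> v)"
  using assms(2)
proof (induction rule: FM_induct)
  case zero
  show ?case unfolding glin_zero[OF assms(1)] pj_zero ..
next
  case (bv r b)
  have "pj n \<delta> j (r \<star> bv b) = hcp n (j - \<delta> b) r \<star> bv b"
    by (auto simp: pj_def fun_eq_iff bv_def pointwise)
  then have "\<phi> (pj n \<delta> j (r \<star> bv b)) = hcp n (j - \<delta> b) r \<star> \<phi> (bv b)"
    using bv by (simp add: glin_vscale[OF assms(1)] FM_bv hpol_pol[OF hcp_hpol])
  also have "\<dots> = pj n \<delta>' j (r \<star> \<phi> (bv b))"
  proof
    fix c
    have "\<phi> (bv b) c \<in> hpol n (\<delta> b - \<delta>' c)"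
      using glin_FH[OF assms(1) FH_bv[OF bv(2)]] by (rule FH_hpol)
    from hcp_mult[OF this, of "j - \<delta>' c" r]
    show "(hcp n (j - \<delta> b) r \<star> \<phi> (bv b)) c = pj n \<delta>' j (r \<star> \<phi> (bv b)) c"
      by (simp add: pj_def mult.commute pointwise)
  qed
  finally show ?case unfolding glin_vscale[OF assms(1) bv(1) FM_bv[OF bv(2)]] .
next
  case (add u w)
  show ?case
    unfolding pj_add glin_add[OF assms(1) add(1,2)]
      glin_add[OF assms(1) FH_FM[OF pj_FH[OF add(1)]] FH_FM[OF pj_FH[OF add(2)]]] add(3,4) ..
qed

text \<open>The linear extension of values prescribed on the basis: \<open>w\<close> lists the
  columns of a matrix. On \<open>FM\<close> the sum is finite.\<close>

definition ext :: "(nat \<Rightarrow> 'k::field pvec) \<Rightarrow> 'k pvec \<Rightarrow> 'k pvec"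
  where "ext w v = (\<Sum>b | v b \<noteq> 0. v b \<star> w b)"

lemma ext_sum:
  assumes "finite S" "{b. v b \<noteq> 0} \<subseteq> S"
  shows "ext w v = (\<Sum>b\<in>S. v b \<star> w b)"
  unfolding ext_def by (rule sum.mono_neutral_left) (use assms in auto)

lemma ext_bv: "ext w (bv b) = w b"
proof -
  have "ext w (bv b) = (\<Sum>c\<in>{b}. bv b c \<star> w c)"
    by (rule ext_sum) (auto simp: bv_def)
  then show ?thesis by (simp add: bv_def)
qed

lemma glin_ext:
  assumes w: "\<And>b. b \<in> B \<Longrightarrow> w b \<in> FH n B' \<delta>' (\<delta> b)"
  shows "glin n B \<delta> B' \<delta>' (ext w)"
  unfolding glin_def
proof (intro conjI ballI allI)
  show "ext w v \<in> FM n B'" if "v \<in> FM n B" for v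
    unfolding ext_def using that w
    by (intro FM_sum FM_vscale) (auto intro: FH_FM FM_supp FM_pol)
next
  fix u v :: "'a pvec" assume uv: "u \<in> FM n B" "v \<in> FM n B"
  let ?S = "{b. u b \<noteq> 0} \<union> {b. v b \<noteq> 0}"
  have "finite ?S" using uv FM_finite by auto
  then show "ext w (u + v) = ext w u + ext w v"
    by (subst (1 2 3) ext_sum[of ?S]) (auto simp: vscale_add_left sum.distrib pointwise)
next
  fix r :: "'a mpoly" and v :: "'a pvec" assume v: "v \<in> FM n B"
  show "ext w (r \<star> v) = r \<star> ext w v"
    using FM_finite[OF v]
    by (subst (1 2) ext_sum[of "{b. v b \<noteq> 0}"]) (auto simp: vscale_sum vscale_assoc pointwise)
next
  fix j and v :: "'a pvec" assume v: "v \<in> FH n B \<delta> j"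
  have "v b \<star> w b \<in> FH n B' \<delta>' j" if "v b \<noteq> 0" for b
    using FH_vscale[OF FH_hpol[OF v, of b] w[of b]] that FM_supp[OF FH_FM[OF v]] by auto
  then show "ext w v \<in> FH n B' \<delta>' j"
    unfolding ext_def by (auto intro: FH_sum)
qed

lemma glin_eq_ext:
  assumes "glin n B \<delta> B' \<delta>' \<phi>" "v \<in> FM n B"
  shows "\<phi> v = ext (\<lambda>b. \<phi> (bv b)) v"
  by (rule glin_eqI[OF assms(1) glin_ext _ assms(2)])
    (auto simp: ext_bv intro: glin_FH[OF assms(1)] FH_bv)

section \<open>Comparison of graded free resolutions\<close>

text \<open>Homogeneity in the form in which it is used: components of members are members. This is
  what lets preimages be replaced by homogeneous ones when maps are lifted modulo
  \<open>I\<close>.\<close>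

definition hideal :: "nat \<Rightarrow> 'k::field mpoly set \<Rightarrow> bool"
  where "hideal n I \<longleftrightarrow> I \<subseteq> pol n \<and> 0 \<in> I \<and> (\<forall>f\<in>I. \<forall>g\<in>I. f + g \<in> I) \<and>
    (\<forall>r\<in>pol n. \<forall>f\<in>I. r * f \<in> I) \<and> (\<forall>f\<in>I. \<forall>k. hcp n k f \<in> I)"

definition auxJ :: "nat \<Rightarrow> 'k::field mpoly set \<Rightarrow> nat \<Rightarrow> 'k pvec set"
  where "auxJ n I i = (if i = 0 then {v \<in> FM n {0}. v 0 \<in> I} else {0})"

text \<open>A resolution of \<open>R/I\<close> is coded with its indices shifted by one: module \<open>0\<close> is \<open>R\<close> with the single
  basis vector \<open>bv 0\<close>, and \<open>d 0\<close> lifts the augmentation to \<open>R\<close>. Then exactness at every place reads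
  \<open>im (d (i+1)) = (d i)\<^sup>-\<^sup>1 (auxJ i)\<close>, where \<open>auxJ\<close> is \<open>I\<close> at index \<open>0\<close> and zero above.\<close>

definition cres ::
  "nat \<Rightarrow> 'k::field mpoly set \<Rightarrow> (nat \<Rightarrow> nat set) \<Rightarrow> (nat \<Rightarrow> nat \<Rightarrow> int) \<Rightarrow> (nat \<Rightarrow> 'k pvec \<Rightarrow> 'k pvec) \<Rightarrow> bool"
  where "cres n I B \<delta> d \<longleftrightarrow> B 0 = {0} \<and> \<delta> 0 0 = 0 \<and>
    (\<forall>i. glin n (B (Suc i)) (\<delta> (Suc i)) (B i) (\<delta> i) (d i)) \<and>
    (\<forall>v\<in>FM n {0}. \<exists>u\<in>FM n (B 1). v - d 0 u \<in> auxJ n I 0) \<and>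
    (\<forall>i. d (Suc i) ` FM n (B (Suc (Suc i))) = {v \<in> FM n (B (Suc i)). d i v \<in> auxJ n I i})"

lemma cres_glin: "cres n I B \<delta> d \<Longrightarrow> glin n (B (Suc i)) (\<delta> (Suc i)) (B i) (\<delta> i) (d i)"
  and cres_aug: "cres n I B \<delta> d \<Longrightarrow> v \<in> FM n {0} \<Longrightarrow> \<exists>u\<in>FM n (B 1). v - d 0 u \<in> auxJ n I 0"
  and cres_exact: "cres n I B \<delta> d \<Longrightarrow> v \<in> FM n (B (Suc i)) \<Longrightarrow> d i v \<in> auxJ n I i \<Longrightarrow>
    \<exists>u\<in>FM n (B (Suc (Suc i))). v = d (Suc i) u"
  and cres_complex: "cres n I B \<delta> d \<Longrightarrow> u \<in> FM n (B (Suc (Suc i))) \<Longrightarrow> d i (d (Suc i) u) \<in> auxJ n I i"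
  and cres_0: "cres n I B \<delta> d \<Longrightarrow> B 0 = {0}" "cres n I B \<delta> d \<Longrightarrow> \<delta> 0 0 = 0"
proof -
  assume c: "cres n I B \<delta> d"
  then have e: "d (Suc i) ` FM n (B (Suc (Suc i))) = {v \<in> FM n (B (Suc i)). d i v \<in> auxJ n I i}" for i
    unfolding cres_def by blast
  show "glin n (B (Suc i)) (\<delta> (Suc i)) (B i) (\<delta> i) (d i)" "B 0 = {0}" "\<delta> 0 0 = 0"
    using c unfolding cres_def by blast+
  show "v \<in> FM n {0} \<Longrightarrow> \<exists>u\<in>FM n (B 1). v - d 0 u \<in> auxJ n I 0"
    using c unfolding cres_def by blast
  show "v \<in> FM n (B (Suc i)) \<Longrightarrow> d i v \<in> auxJ n I i \<Longrightarrow> \<exists>u\<in>FM n (B (Suc (Suc i))). v = d (Suc i) u"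
    using e[of i] by blast
  show "u \<in> FM n (B (Suc (Suc i))) \<Longrightarrow> d i (d (Suc i) u) \<in> auxJ n I i"
    using e[of i] by blast
qed

lemma auxJ_Suc [simp]: "auxJ n I (Suc i) = {0}"
  by (simp add: auxJ_def)

lemma auxJ_zero: "hideal n I \<Longrightarrow> 0 \<in> auxJ n I i"
  by (auto simp: auxJ_def hideal_def pointwise)

lemma auxJ_add: "hideal n I \<Longrightarrow> u \<in> auxJ n I i \<Longrightarrow> v \<in> auxJ n I i \<Longrightarrow> u + v \<in> auxJ n I i"
  by (auto simp: auxJ_def hideal_def pointwise FM_add split: if_splits)

lemma auxJ_vscale: "hideal n I \<Longrightarrow> r \<in> pol n \<Longrightarrow> v \<in> auxJ n I i \<Longrightarrow> r \<star> v \<in> auxJ n I i"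
  by (auto simp: auxJ_def hideal_def pointwise FM_vscale split: if_splits)

lemma auxJ_uminus: "hideal n I \<Longrightarrow> v \<in> auxJ n I i \<Longrightarrow> - v \<in> auxJ n I i"
  using auxJ_vscale[of n I "- 1" v i] by (simp add: vscale_uminus_one pol_uminus)

lemma auxJ_pj:
  assumes "hideal n I" "v \<in> auxJ n I i"
  shows "pj n \<delta> j v \<in> auxJ n I i"
proof (cases "i = 0")
  case True
  then have "v \<in> FM n {0}" "v 0 \<in> I" using assms(2) by (auto simp: auxJ_def)
  then have "pj n \<delta> j v \<in> FM n {0}" "pj n \<delta> j v 0 \<in> I"
    using assms(1) by (auto simp: pj_def hideal_def FH_FM[OF pj_FH, unfolded pj_def])
  then show ?thesis using True by (simp add: auxJ_def)
next
  case False
  then show ?thesis using assms(2) by (simp add: auxJ_def)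
qed

text \<open>A preimage supplied by exactness need not be homogeneous. Its projection to degree
  \<open>\<alpha> b\<close> is again a preimage, because \<open>d\<close> commutes with projections
  and \<open>auxJ\<close> is stable under them.\<close>

lemma graded_lift:
  assumes I: "hideal n I" and d: "glin n C \<gamma> B \<beta> d"
    and y: "\<And>b. b \<in> A \<Longrightarrow> y b \<in> FH n B \<beta> (\<alpha> b)"
    and ex: "\<And>b. b \<in> A \<Longrightarrow> \<exists>u\<in>FM n C. y b - d u \<in> auxJ n I i"
  obtains w where "\<And>b. b \<in> A \<Longrightarrow> w b \<in> FH n C \<gamma> (\<alpha> b)"
    and "\<And>b. b \<in> A \<Longrightarrow> y b - d (w b) \<in> auxJ n I i"
proof -
  have "\<exists>w. w \<in> FH n C \<gamma> (\<alpha> b) \<and> y b - d w \<in> auxJ n I i" if b: "b \<in> A" for b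
  proof -
    obtain u where u: "u \<in> FM n C" "y b - d u \<in> auxJ n I i" using ex[OF b] by blast
    let ?w = "pj n \<gamma> (\<alpha> b) u"
    have "y b - d ?w = pj n \<beta> (\<alpha> b) (y b) - pj n \<beta> (\<alpha> b) (d u)"
      using pj_of_FH[OF y[OF b]] glin_pj[OF d u(1)] by simp
    also have "\<dots> = pj n \<beta> (\<alpha> b) (y b - d u)"
      by (metis pj_add add_diff_cancel diff_add_cancel)
    finally show ?thesis using auxJ_pj[OF I u(2)] pj_FH[OF u(1)] by metis
  qed
  then have "\<exists>w. \<forall>b\<in>A. w b \<in> FH n C \<gamma> (\<alpha> b) \<and> y b - d (w b) \<in> auxJ n I i"
    by (intro bchoice) blast
  then show ?thesis using that by blast
qed

text \<open>This is the lifting of the identity of R/I. In the shifted coding the lift at index 0 is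
  the identity of R, and the first square commutes only modulo \<open>I\<close>.\<close>

lemma chain_map_exists:
  assumes I: "hideal n I" and P: "cres n I B \<delta> d" and Q: "cres n I B' \<delta>' d'"
  obtains f where "\<And>i. glin n (B i) (\<delta> i) (B' i) (\<delta>' i) (f i)"
    and "\<And>v. f 0 v = v"
    and "\<And>i v. v \<in> FM n (B (Suc i)) \<Longrightarrow> d' i (f (Suc i) v) - f i (d i v) \<in> auxJ n I i"
proof -
  \<comment> \<open>The last conjunct says that the next square can be filled in. With it as part of
    the invariant, each stage depends on the preceding one only.\<close>
  define good where "good i f \<longleftrightarrow> glin n (B i) (\<delta> i) (B' i) (\<delta>' i) f \<and> (i = 0 \<longrightarrow> f = (\<lambda>v. v)) \<and>
      (\<forall>v\<in>FM n (B (Suc i)). \<exists>u\<in>FM n (B' (Suc i)). f (d i v) - d' i u \<in> auxJ n I i)"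
    for i and f :: "'a pvec \<Rightarrow> 'a pvec"
  define step where "step i f g \<longleftrightarrow> (\<forall>v\<in>FM n (B (Suc i)). d' i (g v) - f (d i v) \<in> auxJ n I i)"
    for i and f g :: "'a pvec \<Rightarrow> 'a pvec"
  have "\<exists>f. \<forall>i. good i (f i) \<and> step i (f i) (f (Suc i))"
  proof (rule dependent_nat_choice)
    have "glin n {0} (\<delta> 0) {0} (\<delta>' 0) (\<lambda>v. v)"
      using cres_0(2)[OF P] cres_0(2)[OF Q] by (auto simp: glin_def FH_def)
    moreover have "\<exists>u\<in>FM n (B' (Suc 0)). d 0 v - d' 0 u \<in> auxJ n I 0" if "v \<in> FM n (B (Suc 0))" for v
      using cres_aug[OF Q, of "d 0 v"] glin_FM[OF cres_glin[OF P] that] cres_0(1)[OF P] by simp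
    ultimately show "\<exists>f. good 0 f"
      unfolding good_def using cres_0(1)[OF P] cres_0(1)[OF Q] by auto
  next
    fix f i assume "good i f"
    then have f: "glin n (B i) (\<delta> i) (B' i) (\<delta>' i) f" and f0: "i = 0 \<Longrightarrow> f = (\<lambda>v. v)"
      and ex: "\<And>v. v \<in> FM n (B (Suc i)) \<Longrightarrow> \<exists>u\<in>FM n (B' (Suc i)). f (d i v) - d' i u \<in> auxJ n I i"
      unfolding good_def by auto
    have fd: "glin n (B (Suc i)) (\<delta> (Suc i)) (B' i) (\<delta>' i) (\<lambda>v. f (d i v))"
      by (rule glin_comp[OF cres_glin[OF P] f])
    obtain w where w: "\<And>b. b \<in> B (Suc i) \<Longrightarrow> w b \<in> FH n (B' (Suc i)) (\<delta>' (Suc i)) (\<delta> (Suc i) b)"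
      and wd: "\<And>b. b \<in> B (Suc i) \<Longrightarrow> f (d i (bv b)) - d' i (w b) \<in> auxJ n I i"
      by (rule graded_lift[OF I cres_glin[OF Q], of "B (Suc i)" "\<lambda>b. f (d i (bv b))" i "\<delta> (Suc i)" i])
        (use glin_FH[OF fd FH_bv] ex[OF FM_bv] in auto)
    let ?g = "ext w"
    have g: "glin n (B (Suc i)) (\<delta> (Suc i)) (B' (Suc i)) (\<delta>' (Suc i)) ?g"
      by (rule glin_ext[OF w])
    have dg: "glin n (B (Suc i)) (\<delta> (Suc i)) (B' i) (\<delta>' i) (\<lambda>v. d' i (?g v) - f (d i v))"
      by (rule glin_minus[OF glin_comp[OF g cres_glin[OF Q]] fd])
    have st: "d' i (?g v) - f (d i v) \<in> auxJ n I i" if "v \<in> FM n (B (Suc i))" for v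
      using that
    proof (induction rule: FM_induct)
      case zero
      show ?case using glin_zero[OF dg] auxJ_zero[OF I] by metis
    next
      case (bv r b)
      have "d' i (w b) - f (d i (bv b)) \<in> auxJ n I i"
        using auxJ_uminus[OF I wd[OF bv(2)]] by (simp only: minus_diff_eq)
      then show ?case
        using glin_vscale[OF dg bv(1) FM_bv[OF bv(2)]] auxJ_vscale[OF I bv(1)] by (metis ext_bv)
    next
      case (add u v)
      show ?case
        using glin_add[OF dg add(1,2)] auxJ_add[OF I add(3,4)] by (simp only:)
    qed
    have "\<exists>u\<in>FM n (B' (Suc (Suc i))). ?g (d (Suc i) v) - d' (Suc i) u \<in> auxJ n I (Suc i)"
      if v: "v \<in> FM n (B (Suc (Suc i)))" for v
    proof -
      let ?x = "?g (d (Suc i) v)"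
      have dv: "d (Suc i) v \<in> FM n (B (Suc i))" by (rule glin_FM[OF cres_glin[OF P] v])
      \<comment> \<open>\<open>f\<close> maps \<open>auxJ\<close> into itself: at index 0 it is the
        identity, and at higher indices \<open>auxJ\<close> is zero.\<close>
      have "f (d i (d (Suc i) v)) \<in> auxJ n I i"
      proof (cases "i = 0")
        case True
        then show ?thesis using f0 cres_complex[OF P v] by simp
      next
        case False
        then have "d i (d (Suc i) v) = 0" using cres_complex[OF P v] by (auto simp: auxJ_def)
        then show ?thesis using glin_zero[OF f] auxJ_zero[OF I] by simp
      qed
      then have "d' i ?x \<in> auxJ n I i" using auxJ_add[OF I st[OF dv]] by fastforce
      then obtain u where "u \<in> FM n (B' (Suc (Suc i)))" "?x = d' (Suc i) u"
        using cres_exact[OF Q glin_FM[OF g dv]] by blast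
      then show ?thesis by (auto intro!: bexI[of _ u])
    qed
    then show "\<exists>g. good (Suc i) g \<and> step i f g"
      unfolding good_def step_def using g st by blast
  qed
  then obtain f where f: "\<And>i. good i (f i)" "\<And>i. step i (f i) (f (Suc i))" by blast
  show ?thesis
  proof (rule that)
    show "glin n (B i) (\<delta> i) (B' i) (\<delta>' i) (f i)" for i using f(1)[of i] unfolding good_def by blast
    show "f 0 v = v" for v using f(1)[of 0] unfolding good_def by simp
    show "d' i (f (Suc i) v) - f i (d i v) \<in> auxJ n I i" if "v \<in> FM n (B (Suc i))" for i v
      using f(2)[of i] that unfolding step_def by blast
  qed
qed

text \<open>\<open>h (Suc i)\<close> is a graded lift of \<open>\<phi> (Suc i)\<close> minus
  \<open>h i \<circ> d i\<close> through \<open>d (Suc i)\<close>; the values to be lifted are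
  cycles by the homotopy relation one step lower. The intended \<open>\<phi>\<close> is the identity
  minus a composite of two comparison maps, which is zero on R.\<close>

lemma homotopy_exists:
  assumes I: "hideal n I" and Q: "cres n I B \<delta> d"
    and \<phi>: "\<And>i. glin n (B i) (\<delta> i) (B i) (\<delta> i) (\<phi> i)" and \<phi>0: "\<And>v. \<phi> 0 v = 0"
    and \<phi>d: "\<And>i v. v \<in> FM n (B (Suc i)) \<Longrightarrow> d i (\<phi> (Suc i) v) - \<phi> i (d i v) \<in> auxJ n I i"
  obtains h where "\<And>i. glin n (B i) (\<delta> i) (B (Suc i)) (\<delta> (Suc i)) (h i)"
    and "\<And>v. h 0 v = 0"
    and "\<And>i v. v \<in> FM n (B (Suc i)) \<Longrightarrow> \<phi> (Suc i) v = d (Suc i) (h (Suc i) v) + h i (d i v)"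
proof -
  define good where "good i h \<longleftrightarrow> glin n (B i) (\<delta> i) (B (Suc i)) (\<delta> (Suc i)) h \<and> (i = 0 \<longrightarrow> h = (\<lambda>v. 0)) \<and>
      (\<forall>v\<in>FM n (B (Suc i)). d i (\<phi> (Suc i) v - h (d i v)) \<in> auxJ n I i)"
    for i and h :: "'a pvec \<Rightarrow> 'a pvec"
  define step where "step i h h' \<longleftrightarrow> (\<forall>v\<in>FM n (B (Suc i)). \<phi> (Suc i) v - h (d i v) = d (Suc i) (h' v))"
    for i and h h' :: "'a pvec \<Rightarrow> 'a pvec"
  note dl = cres_glin[OF Q]
  have "\<exists>h. \<forall>i. good i (h i) \<and> step i (h i) (h (Suc i))"
  proof (rule dependent_nat_choice)
    have "d 0 (\<phi> (Suc 0) v - 0) \<in> auxJ n I 0" if "v \<in> FM n (B (Suc 0))" for v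
      using \<phi>d[OF that] \<phi>0 by simp
    then show "\<exists>h. good 0 h"
      unfolding good_def using glin_const_zero by (intro exI[of _ "\<lambda>v. 0"]) auto
  next
    fix h i assume "good i h"
    then have h: "glin n (B i) (\<delta> i) (B (Suc i)) (\<delta> (Suc i)) h" and h0: "i = 0 \<Longrightarrow> h = (\<lambda>v. 0)"
      and hd: "\<And>v. v \<in> FM n (B (Suc i)) \<Longrightarrow> d i (\<phi> (Suc i) v - h (d i v)) \<in> auxJ n I i"
      unfolding good_def by auto
    let ?y = "\<lambda>v. \<phi> (Suc i) v - h (d i v)"
    have y: "glin n (B (Suc i)) (\<delta> (Suc i)) (B (Suc i)) (\<delta> (Suc i)) ?y"
      by (rule glin_minus[OF \<phi> glin_comp[OF dl h]])
    have ex: "\<exists>u\<in>FM n (B (Suc (Suc i))). ?y v - d (Suc i) u \<in> auxJ n I (Suc i)"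
      if "v \<in> FM n (B (Suc i))" for v
      using cres_exact[OF Q glin_FM[OF y that] hd[OF that]] by auto
    obtain w where w: "\<And>b. b \<in> B (Suc i) \<Longrightarrow> w b \<in> FH n (B (Suc (Suc i))) (\<delta> (Suc (Suc i))) (\<delta> (Suc i) b)"
      and wd: "\<And>b. b \<in> B (Suc i) \<Longrightarrow> ?y (bv b) - d (Suc i) (w b) \<in> auxJ n I (Suc i)"
      by (rule graded_lift[OF I dl, of "B (Suc i)" "\<lambda>b. ?y (bv b)" "Suc i" "\<delta> (Suc i)" "Suc i"])
        (use glin_FH[OF y FH_bv] ex[OF FM_bv] in auto)
    let ?g = "ext w"
    have g: "glin n (B (Suc i)) (\<delta> (Suc i)) (B (Suc (Suc i))) (\<delta> (Suc (Suc i))) ?g"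
      by (rule glin_ext[OF w])
    have st: "?y v = d (Suc i) (?g v)" if "v \<in> FM n (B (Suc i))" for v
      by (rule glin_eqI[OF y glin_comp[OF g dl] _ that]) (use wd in \<open>auto simp: ext_bv\<close>)
    have "d (Suc i) (\<phi> (Suc (Suc i)) v - ?g (d (Suc i) v)) \<in> auxJ n I (Suc i)"
      if v: "v \<in> FM n (B (Suc (Suc i)))" for v
    proof -
      have dv: "d (Suc i) v \<in> FM n (B (Suc i))" by (rule glin_FM[OF dl v])
      \<comment> \<open>\<open>h\<close> itself is zero at index 0; at higher indices two
        consecutive differentials compose to zero.\<close>
      have "h (d i (d (Suc i) v)) = 0"
      proof (cases "i = 0")
        case True
        then show ?thesis using h0 by simp
      next
        case False
        then have "d i (d (Suc i) v) = 0" using cres_complex[OF Q v] by (auto simp: auxJ_def)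
        then show ?thesis using glin_zero[OF h] by simp
      qed
      then have "d (Suc i) (?g (d (Suc i) v)) = \<phi> (Suc i) (d (Suc i) v)"
        using st[OF dv] by simp
      moreover have "d (Suc i) (\<phi> (Suc (Suc i)) v - ?g (d (Suc i) v)) =
          d (Suc i) (\<phi> (Suc (Suc i)) v) - d (Suc i) (?g (d (Suc i) v))"
        by (rule glin_diff[OF dl glin_FM[OF \<phi> v] glin_FM[OF g dv]])
      ultimately show ?thesis using \<phi>d[OF v] by simp
    qed
    then show "\<exists>g. good (Suc i) g \<and> step i h g"
      unfolding good_def step_def using g st by blast
  qed
  then obtain h where h: "\<And>i. good i (h i)" "\<And>i. step i (h i) (h (Suc i))" by blast
  show ?thesis
  proof (rule that)
    show "glin n (B i) (\<delta> i) (B (Suc i)) (\<delta> (Suc i)) (h i)" for i using h(1)[of i] unfolding good_def by blast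
    show "h 0 v = 0" for v using h(1)[of 0] unfolding good_def by simp
    show "\<phi> (Suc i) v = d (Suc i) (h (Suc i) v) + h i (d i v)" if "v \<in> FM n (B (Suc i))" for i v
      using h(2)[of i] that unfolding step_def by (metis diff_add_cancel)
  qed
qed

lemma chain_self_homotopy:
  assumes I: "hideal n I" and Q: "cres n I B \<delta> d" and P: "cres n I B' \<delta>' d'"
    and g: "\<And>i. glin n (B i) (\<delta> i) (B' i) (\<delta>' i) (g i)" and g0: "\<And>v. g 0 v = v"
    and gd: "\<And>i v. v \<in> FM n (B (Suc i)) \<Longrightarrow> d' i (g (Suc i) v) - g i (d i v) \<in> auxJ n I i"
    and f: "\<And>i. glin n (B' i) (\<delta>' i) (B i) (\<delta> i) (f i)" and f0: "\<And>v. f 0 v = v"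
    and fd: "\<And>i v. v \<in> FM n (B' (Suc i)) \<Longrightarrow> d i (f (Suc i) v) - f i (d' i v) \<in> auxJ n I i"
  obtains h where "\<And>i. glin n (B i) (\<delta> i) (B (Suc i)) (\<delta> (Suc i)) (h i)"
    and "\<And>v. h 0 v = 0"
    and "\<And>i v. v \<in> FM n (B (Suc i)) \<Longrightarrow>
      v = f (Suc i) (g (Suc i) v) + d (Suc i) (h (Suc i) v) + h i (d i v)"
proof -
  define \<phi> where "\<phi> i v = v - f i (g i v)" for i v
  have \<phi>: "glin n (B i) (\<delta> i) (B i) (\<delta> i) (\<phi> i)" for i
    unfolding \<phi>_def by (rule glin_minus[OF glin_id glin_comp[OF g f]])
  have "d i (\<phi> (Suc i) v) - \<phi> i (d i v) \<in> auxJ n I i" if v: "v \<in> FM n (B (Suc i))" for i v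
  proof -
    note gv = glin_FM[OF g v] and dv = glin_FM[OF cres_glin[OF Q] v]
    \<comment> \<open>At index 0 the square of \<open>g\<close> commutes only modulo
      \<open>I\<close>, but there \<open>f\<close> is the identity; at higher indices it commutes
      exactly.\<close>
    have a: "f i (d' i (g (Suc i) v)) - f i (g i (d i v)) \<in> auxJ n I i"
    proof (cases "i = 0")
      case True
      then show ?thesis using f0 gd[OF v] by simp
    next
      case False
      then have "d' i (g (Suc i) v) = g i (d i v)" using gd[OF v] by (simp add: auxJ_def)
      then show ?thesis using auxJ_zero[OF I] by simp
    qed
    have eq: "d i (\<phi> (Suc i) v) - \<phi> i (d i v) =
        - ((d i (f (Suc i) (g (Suc i) v)) - f i (d' i (g (Suc i) v))) +
           (f i (d' i (g (Suc i) v)) - f i (g i (d i v))))"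
      unfolding \<phi>_def glin_diff[OF cres_glin[OF Q] v glin_FM[OF f gv]] by simp
    show ?thesis unfolding eq by (rule auxJ_uminus[OF I auxJ_add[OF I fd[OF gv] a]])
  qed
  note \<phi>d = this
  have \<phi>0: "\<phi> 0 v = 0" for v using f0 g0 by (simp add: \<phi>_def)
  obtain h where h: "\<And>i. glin n (B i) (\<delta> i) (B (Suc i)) (\<delta> (Suc i)) (h i)" "\<And>v. h 0 v = 0"
      "\<And>i v. v \<in> FM n (B (Suc i)) \<Longrightarrow> \<phi> (Suc i) v = d (Suc i) (h (Suc i) v) + h i (d i v)"
    using homotopy_exists[OF I Q \<phi> \<phi>0 \<phi>d] by blast
  show ?thesis
  proof (rule that[OF h(1,2)])
    fix i and v :: "'a pvec" assume v: "v \<in> FM n (B (Suc i))"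
    have "v = \<phi> (Suc i) v + f (Suc i) (g (Suc i) v)" unfolding \<phi>_def by (rule diff_add_cancel[symmetric])
    also have "\<dots> = f (Suc i) (g (Suc i) v) + d (Suc i) (h (Suc i) v) + h i (d i v)"
      unfolding h(3)[OF v] by (simp only: ac_simps)
    finally show "v = f (Suc i) (g (Suc i) v) + d (Suc i) (h (Suc i) v) + h i (d i v)" .
  qed
qed

text \<open>The condition starts with \<open>d 1\<close>, the first differential of the resolution
  proper: \<open>d 0\<close> lifts the augmentation and usually has 1 in its image.\<close>

definition minimal_cres ::
  "nat \<Rightarrow> (nat \<Rightarrow> nat set) \<Rightarrow> (nat \<Rightarrow> 'k::field pvec \<Rightarrow> 'k pvec) \<Rightarrow> bool"
  where "minimal_cres n B d \<longleftrightarrow> (\<forall>i. \<forall>u\<in>FM n (B (Suc (Suc i))). ev (d (Suc i) u) = 0)"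

text \<open>On constant coefficients the minimal complex has zero differentials, so its homology
  consists of all constant vectors. The homotopies show that \<open>g\<close> induces an isomorphism
  from the homology of the other complex onto it; the conclusions are injectivity, vanishing on
  boundaries, and surjectivity in each degree. The provisos \<open>i \<noteq> 0\<close> express that
  at the end of the complex every element is a cycle.\<close>

lemma minimal_comparison:
  assumes I: "hideal n I" and P: "cres n I B \<delta> d" and Q: "cres n I B' \<delta>' d'"
    and min: "minimal_cres n B d"
  obtains g where "glin n (B' (Suc i)) (\<delta>' (Suc i)) (B (Suc i)) (\<delta> (Suc i)) g"
    and "\<And>z. z \<in> FM n (B' (Suc i)) \<Longrightarrow> (i \<noteq> 0 \<Longrightarrow> ev (d' i z) = 0) \<Longrightarrow> ev (g z) = 0 \<Longrightarrow>
      \<exists>u\<in>FM n (B' (Suc (Suc i))). ev z = ev (d' (Suc i) u)"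
    and "\<And>u. u \<in> FM n (B' (Suc (Suc i))) \<Longrightarrow> ev (g (d' (Suc i) u)) = 0"
    and "\<And>j c. c \<in> FH n (B (Suc i)) (\<delta> (Suc i)) j \<Longrightarrow>
      \<exists>z\<in>FH n (B' (Suc i)) (\<delta>' (Suc i)) j. (i \<noteq> 0 \<longrightarrow> ev (d' i z) = 0) \<and> ev (g z) = ev c"
proof -
  obtain f where f: "\<And>i. glin n (B i) (\<delta> i) (B' i) (\<delta>' i) (f i)" "\<And>v. f 0 v = v"
    and fd: "\<And>i v. v \<in> FM n (B (Suc i)) \<Longrightarrow> d' i (f (Suc i) v) - f i (d i v) \<in> auxJ n I i"
    using chain_map_exists[OF I P Q] by blast
  obtain g where g: "\<And>i. glin n (B' i) (\<delta>' i) (B i) (\<delta> i) (g i)" "\<And>v. g 0 v = v"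
    and gd: "\<And>i v. v \<in> FM n (B' (Suc i)) \<Longrightarrow> d i (g (Suc i) v) - g i (d' i v) \<in> auxJ n I i"
    using chain_map_exists[OF I Q P] by blast
  obtain h where h: "\<And>i. glin n (B' i) (\<delta>' i) (B' (Suc i)) (\<delta>' (Suc i)) (h i)" "\<And>v. h 0 v = 0"
    and hd: "\<And>i v. v \<in> FM n (B' (Suc i)) \<Longrightarrow>
      v = f (Suc i) (g (Suc i) v) + d' (Suc i) (h (Suc i) v) + h i (d' i v)"
    using chain_self_homotopy[OF I Q P g gd f fd] by blast
  obtain k where k: "\<And>i. glin n (B i) (\<delta> i) (B (Suc i)) (\<delta> (Suc i)) (k i)" "\<And>v. k 0 v = 0"
    and kd: "\<And>i v. v \<in> FM n (B (Suc i)) \<Longrightarrow>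
      v = g (Suc i) (f (Suc i) v) + d (Suc i) (k (Suc i) v) + k i (d i v)"
    using chain_self_homotopy[OF I P Q f fd g gd] by blast
  note P' = cres_glin[OF P] and Q' = cres_glin[OF Q]
  have mind: "ev (d i c) = 0" if "i \<noteq> 0" "c \<in> FM n (B (Suc i))" for i c
    using min that unfolding minimal_cres_def by (cases i) auto
  show ?thesis
  proof (rule that)
    show "glin n (B' (Suc i)) (\<delta>' (Suc i)) (B (Suc i)) (\<delta> (Suc i)) (g (Suc i))" by (rule g)
  next
    fix z :: "'a pvec" assume z: "z \<in> FM n (B' (Suc i))" "i \<noteq> 0 \<Longrightarrow> ev (d' i z) = 0" "ev (g (Suc i) z) = 0"
    \<comment> \<open>At index 0 the homotopy vanishes; above, \<open>d' i z\<close> has zero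
      constant coefficients and \<open>h\<close> preserves this.\<close>
    have "ev (h i (d' i z)) = 0"
      using h(2) glin_ev[OF h(1) glin_FM[OF Q' z(1)] z(2)] by (cases "i = 0") auto
    then have "ev z = ev (d' (Suc i) (h (Suc i) z))"
      using arg_cong[OF hd[OF z(1)], of ev] glin_ev[OF f(1) glin_FM[OF g(1) z(1)] z(3)]
      by (simp add: ev_add)
    then show "\<exists>u\<in>FM n (B' (Suc (Suc i))). ev z = ev (d' (Suc i) u)"
      using glin_FM[OF h(1) z(1)] by blast
  next
    fix u :: "'a pvec" assume u: "u \<in> FM n (B' (Suc (Suc i)))"
    have "g (Suc i) (d' (Suc i) u) = d (Suc i) (g (Suc (Suc i)) u)" using gd[OF u] by simp
    then show "ev (g (Suc i) (d' (Suc i) u)) = 0"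
      using mind[of "Suc i"] glin_FM[OF g(1) u] by simp
  next
    fix j and c :: "'a pvec" assume c: "c \<in> FH n (B (Suc i)) (\<delta> (Suc i)) j"
    note cF = FH_FM[OF c]
    have "ev (d' i (f (Suc i) c)) = 0" if "i \<noteq> 0"
    proof -
      have "d' i (f (Suc i) c) = f i (d i c)" using fd[OF cF] that by (simp add: auxJ_def)
      then show ?thesis using glin_ev[OF f(1) glin_FM[OF P' cF] mind[OF that cF]] by simp
    qed
    moreover have "ev (k i (d i c)) = 0"
      using k(2) glin_ev[OF k(1) glin_FM[OF P' cF] mind[OF _ cF]] by (cases "i = 0") auto
    then have "ev (g (Suc i) (f (Suc i) c)) = ev c"
      using arg_cong[OF kd[OF cF], of ev] mind[OF _ glin_FM[OF k(1) cF]] by (simp add: ev_add)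
    ultimately show "\<exists>z\<in>FH n (B' (Suc i)) (\<delta>' (Suc i)) j. (i \<noteq> 0 \<longrightarrow> ev (d' i z) = 0) \<and> ev (g (Suc i) z) = ev c"
      using glin_FH[OF f(1) c] by blast
  qed
qed

section \<open>Minimal graded free resolutions\<close>

text \<open>The finiteness condition of the construction: it bounds the degrees from below, makes
  each graded component finite-dimensional, and passes from a free module to the minimal cover of a
  graded submodule.\<close>

definition locfin :: "nat set \<Rightarrow> (nat \<Rightarrow> int) \<Rightarrow> bool"
  where "locfin B \<delta> \<longleftrightarrow> (\<forall>j. finite {b \<in> B. \<delta> b \<le> j})"

definition gsub :: "nat \<Rightarrow> nat set \<Rightarrow> (nat \<Rightarrow> int) \<Rightarrow> 'k::field pvec set \<Rightarrow> bool"
  where "gsub n B \<delta> Z \<longleftrightarrow> Z \<subseteq> FM n B \<and> 0 \<in> Z \<and> (\<forall>u\<in>Z. \<forall>v\<in>Z. u + v \<in> Z) \<and>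
    (\<forall>r\<in>pol n. \<forall>v\<in>Z. r \<star> v \<in> Z) \<and> (\<forall>v\<in>Z. \<forall>j. pj n \<delta> j v \<in> Z)"

interpretation kv: vector_space "\<lambda>(c::'k::field) (v::'k pvec). mon 0 c \<star> v"
  by unfold_locales
    (auto simp: vscale_add_right vscale_add_left vscale_assoc single_add mult_single)

lemma finite_monomials: "finite {m. supp m \<subseteq> {..<n} \<and> dg n m = d}"
proof (rule finite_imageD)
  let ?S = "{m. supp m \<subseteq> {..<n} \<and> dg n m = d}"
  have "cf m i \<le> nat d" if "m \<in> ?S" "i < n" for m i
    using that member_le_sum[of i "{..<n}" "cf m"] by (auto simp: dg_def simp del: of_nat_sum)
  then have "cf ` ?S \<subseteq> {f. \<forall>i. (i \<in> {..<n} \<longrightarrow> f i \<in> {..nat d}) \<and> (i \<notin> {..<n} \<longrightarrow> f i = 0)}"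
    by (auto simp: in_keys_iff)
  then show "finite (cf ` ?S)"
    by (rule finite_subset) (intro finite_set_of_finite_funs; simp)
  show "inj_on cf ?S" by (rule inj_onI) (rule poly_mapping_eqI, simp)
qed

lemma FH_degree_ge:
  assumes "v \<in> FH n B \<delta> j" "v b \<noteq> 0"
  shows "\<delta> b \<le> j"
  using hpol_negative[OF FH_hpol[OF assms(1)]] assms(2) by (metis diff_ge_0_iff_ge not_less)

text \<open>The component is spanned by monomials times basis vectors of total degree
  \<open>j\<close>. Polynomials of negative degree are zero, so only the finitely many basis vectors
  of degree at most \<open>j\<close> occur.\<close>

lemma FH_finite_span:
  assumes "locfin B \<delta>"
  obtains T :: "'k::field pvec set" where "finite T" "FH n B \<delta> j \<subseteq> kv.span T"
proof
  let ?M = "\<lambda>b. {m. supp m \<subseteq> {..<n} \<and> dg n m = j - \<delta> b}"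
  let ?T = "\<Union>b\<in>{b \<in> B. \<delta> b \<le> j}. (\<lambda>m. mon m 1 \<star> (bv b :: 'k pvec)) ` ?M b"
  show "finite ?T" using assms finite_monomials by (auto simp: locfin_def)
  show "FH n B \<delta> j \<subseteq> kv.span ?T"
  proof
    fix v :: "'k pvec" assume v: "v \<in> FH n B \<delta> j"
    have *: "r \<star> bv b \<in> kv.span ?T"
      if r: "r \<in> hpol n (j - \<delta> b)" and b: "b \<in> B" "\<delta> b \<le> j" for r :: "'k mpoly" and b
    proof (induction r rule: mpoly_add_induct)
      case zero
      show ?case unfolding vscale_zero_left by (rule kv.span_zero)
    next
      case (single m)
      have "m \<in> ?M b" using r single by (auto simp: hpol_iff)
      then have "mon m 1 \<star> bv b \<in> ?T" using b by blast
      from kv.span_scale[OF kv.span_base[OF this], of "cf r m"]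
      show ?case by (simp add: vscale_assoc mult_single)
    next
      case (add g h)
      show ?case unfolding vscale_add_left by (rule kv.span_add[OF add])
    qed
    have "v b \<star> bv b \<in> kv.span ?T" if "v b \<noteq> 0" for b
      by (rule *[OF FH_hpol[OF v] FM_supp[OF FH_FM[OF v] that] FH_degree_ge[OF v that]])
    then have "(\<Sum>b | v b \<noteq> 0. v b \<star> bv b) \<in> kv.span ?T"
      by (intro kv.span_sum) auto
    then show "v \<in> kv.span ?T"
      using FM_expand[of "{b. v b \<noteq> 0}" v] FM_finite[OF FH_FM[OF v]] by simp
  qed
qed

lemma gsub_FM: "gsub n B \<delta> Z \<Longrightarrow> v \<in> Z \<Longrightarrow> v \<in> FM n B"
  and gsub_zero: "gsub n B \<delta> Z \<Longrightarrow> 0 \<in> Z"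
  and gsub_add: "gsub n B \<delta> Z \<Longrightarrow> u \<in> Z \<Longrightarrow> v \<in> Z \<Longrightarrow> u + v \<in> Z"
  and gsub_vscale: "gsub n B \<delta> Z \<Longrightarrow> r \<in> pol n \<Longrightarrow> v \<in> Z \<Longrightarrow> r \<star> v \<in> Z"
  and gsub_pj: "gsub n B \<delta> Z \<Longrightarrow> v \<in> Z \<Longrightarrow> pj n \<delta> j v \<in> Z"
  by (auto simp: gsub_def)

lemma gsub_sum:
  assumes "gsub n B \<delta> Z" "\<And>x. x \<in> A \<Longrightarrow> f x \<in> Z"
  shows "sum f A \<in> Z"
  using assms(2)
proof (induction A rule: infinite_finite_induct)
  case (insert x A)
  then show ?case using gsub_add[OF assms(1)] by (metis insertCI sum.insert)
qed (metis gsub_zero[OF assms(1)] sum.infinite, metis gsub_zero[OF assms(1)] sum.empty)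

text \<open>If \<open>Y\<close> is the component of degree \<open>j - 1\<close> of a graded module,
  then these elements span the decomposable elements of degree \<open>j\<close>, that is, the
  component of degree \<open>j\<close> of the ideal of the variables times the module.\<close>

definition mdec :: "nat \<Rightarrow> 'k::field pvec set \<Rightarrow> 'k pvec set"
  where "mdec n Y = {mon (mon i 1) 1 \<star> z | i z. i < n \<and> z \<in> Y}"

text \<open>A monomial of positive degree is divisible by a variable. Splitting off one variable and
  moving the rest of the monomial into \<open>z\<close> leaves an element of degree
  \<open>j - 1\<close>.\<close>

lemma pos_vscale_mdec:
  assumes Z: "gsub n B \<delta> Z" and r: "r \<in> hpol n d" "0 < d" and z: "z \<in> Z" "z \<in> FH n B \<delta> (j - d)"
  shows "r \<star> z \<in> kv.span (mdec n (Z \<inter> FH n B \<delta> (j - 1)))" (is "_ \<in> ?S")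
proof (induction r rule: mpoly_add_induct)
  case zero
  show ?case unfolding vscale_zero_left by (rule kv.span_zero)
next
  case (single m)
  have m: "supp m \<subseteq> {..<n}" "dg n m = d" using r(1) single by (auto simp: hpol_iff)
  then obtain i where i: "i \<in> supp m" using r(2)
    by (metis dg_zero ex_in_conv keys_eq_empty less_irrefl)
  let ?X = "mon i (1::nat)"
  define m' where "m' = m - ?X"
  have mm: "m = ?X + m'"
    using i by (intro poly_mapping_eqI)
      (auto simp: m'_def lookup_add lookup_minus lookup_single when_def in_keys_iff)
  have m': "supp m' \<subseteq> {..<n}" using m(1) unfolding mm keys_add_nat by simp
  have "dg n ?X = 1" using i m(1) by (auto simp: dg_def lookup_single when_def)
  then have dm': "dg n m' = d - 1" using m(2) unfolding mm dg_add by simp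
  let ?y = "mon m' (cf r m) \<star> z"
  have "?y \<in> Z" by (rule gsub_vscale[OF Z pol_single[OF m'] z(1)])
  moreover have "?y \<in> FH n B \<delta> (j - 1)"
    using FH_vscale[OF hpol_single[OF m' dm'] z(2)] by simp
  ultimately have "mon ?X 1 \<star> ?y \<in> mdec n (Z \<inter> FH n B \<delta> (j - 1))"
    using i m(1) unfolding mdec_def by blast
  moreover have "mon ?X 1 \<star> ?y = mon m (cf r m) \<star> z"
    unfolding vscale_assoc mult_single mm[symmetric] by simp
  ultimately show ?case by (metis kv.span_base)
next
  case (add g h)
  show ?case unfolding vscale_add_left by (rule kv.span_add[OF add])
qed

text \<open>A set of least cardinality that spans \<open>V\<close> together with \<open>D\<close> is
  independent modulo the span of \<open>D\<close>, since a nontrivial relation would allow one of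
  its members to be dropped. Applied with the decomposable elements as \<open>D\<close>, this is the
  graded Nakayama lemma in one degree.\<close>

lemma minimal_generators_mod:
  assumes "V \<subseteq> kv.span T" "finite T"
  obtains G where "finite G" "G \<subseteq> V" "V \<subseteq> kv.span (G \<union> D)"
    and "\<And>c. (\<Sum>g\<in>G. mon 0 (c g) \<star> g) \<in> kv.span D \<Longrightarrow> \<forall>g\<in>G. c g = 0"
proof -
  define good where "good G \<longleftrightarrow> finite G \<and> G \<subseteq> V \<and> V \<subseteq> kv.span (G \<union> D)" for G
  obtain A where A: "A \<subseteq> V" "kv.independent A" "V \<subseteq> kv.span A"
    using kv.maximal_independent_subset by blast
  have "finite A" using kv.independent_span_bound[OF assms(2) A(2)] A(1) assms(1) by blast
  then have "good A" using A kv.span_mono[of A "A \<union> D"] unfolding good_def by blast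
  then obtain G where G: "good G" and least: "\<And>G'. good G' \<Longrightarrow> card G \<le> card G'"
    using ex_has_least_nat[of good A card] by blast
  show ?thesis
  proof (rule that)
    show fG: "finite G" and GV: "G \<subseteq> V" and VG: "V \<subseteq> kv.span (G \<union> D)" using G unfolding good_def by auto
    fix c assume c: "(\<Sum>g\<in>G. mon 0 (c g) \<star> g) \<in> kv.span D"
    show "\<forall>g\<in>G. c g = 0"
    proof (rule ccontr)
      assume "\<not> (\<forall>g\<in>G. c g = 0)"
      then obtain g where g: "g \<in> G" "c g \<noteq> 0" by blast
      let ?S = "kv.span (G - {g} \<union> D)"
      have "(\<Sum>h\<in>G. mon 0 (c h) \<star> h) \<in> ?S"
        using c kv.span_mono[of D "G - {g} \<union> D"] by blast
      moreover have "(\<Sum>h\<in>G - {g}. mon 0 (c h) \<star> h) \<in> ?S"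
        by (intro kv.span_sum kv.span_scale kv.span_base) auto
      ultimately have "mon 0 (c g) \<star> g + (\<Sum>h\<in>G - {g}. mon 0 (c h) \<star> h)
          - (\<Sum>h\<in>G - {g}. mon 0 (c h) \<star> h) \<in> ?S"
        unfolding sum.remove[OF fG g(1)] by (rule kv.span_diff)
      then have "mon 0 (c g) \<star> g \<in> ?S" by (simp only: add_diff_cancel_right')
      then have "mon 0 (1 / c g) \<star> mon 0 (c g) \<star> g \<in> ?S"
        by (rule kv.span_scale)
      then have "g \<in> ?S" using g(2) by (simp add: vscale_assoc mult_single)
      then have "G \<union> D \<subseteq> ?S" using kv.span_superset[of "G - {g} \<union> D"] by blast
      then have "V \<subseteq> ?S" using VG kv.span_minimal[OF _ kv.subspace_span] by blast
      then have "good (G - {g})" using fG GV unfolding good_def by blast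
      then show False using least[of "G - {g}"] card_Diff1_less[OF fG g(1)] by simp
    qed
  qed
qed

lemma locfin_lower_bound:
  assumes "locfin B \<delta>"
  obtains l where "\<And>b. b \<in> B \<Longrightarrow> l \<le> \<delta> b"
proof (cases "B = {}")
  case False
  then obtain b0 where b0: "b0 \<in> B" by blast
  let ?S = "\<delta> ` {b \<in> B. \<delta> b \<le> \<delta> b0}"
  have fin: "finite ?S" using assms by (auto simp: locfin_def)
  have "Min ?S \<le> \<delta> b" if "b \<in> B" for b
  proof (cases "\<delta> b \<le> \<delta> b0")
    case True
    then show ?thesis using fin that by (intro Min_le) auto
  next
    case False
    have "Min ?S \<le> \<delta> b0" using fin b0 by (intro Min_le) auto
    then show ?thesis using False by simp
  qed
  then show ?thesis using that by blast
qed (use that in blast)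

text \<open>In every degree, generators are chosen to be a basis modulo decomposable elements. They
  generate \<open>Z\<close> by induction on the degree. In a relation among them, the generators
  whose coefficient has positive degree contribute decomposable elements, so the constant
  coefficients vanish by independence.\<close>

lemma minimal_cover:
  assumes lf: "locfin B \<delta>" and Z: "gsub n B \<delta> Z"
  obtains C \<gamma> w where "locfin C \<gamma>" "\<And>b. b \<in> C \<Longrightarrow> w b \<in> FH n B \<delta> (\<gamma> b)"
    and "ext w ` FM n C = Z" and "\<And>v. v \<in> FM n C \<Longrightarrow> ext w v = 0 \<Longrightarrow> ev v = 0"
proof -
  define ZH where "ZH j = Z \<inter> FH n B \<delta> j" for j
  define D where "D j = mdec n (ZH (j - 1))" for j
  define good where "good j G \<longleftrightarrow> finite G \<and> G \<subseteq> ZH j \<and> ZH j \<subseteq> kv.span (G \<union> D j) \<and>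
      (\<forall>c. (\<Sum>g\<in>G. mon 0 (c g) \<star> g) \<in> kv.span (D j) \<longrightarrow> (\<forall>g\<in>G. c g = 0))"
    for j and G :: "'a pvec set"
  have "\<exists>G. good j G" for j
  proof -
    obtain T :: "'a pvec set" where T: "finite T" "FH n B \<delta> j \<subseteq> kv.span T"
      using FH_finite_span[OF lf] by blast
    have "ZH j \<subseteq> kv.span T" using T(2) by (auto simp: ZH_def)
    then show ?thesis
    proof (rule minimal_generators_mod[OF _ T(1)])
      fix G :: "'a pvec set"
      assume "finite G" "G \<subseteq> ZH j" "ZH j \<subseteq> kv.span (G \<union> D j)"
        and "\<And>c. (\<Sum>g\<in>G. mon 0 (c g) \<star> g) \<in> kv.span (D j) \<Longrightarrow> \<forall>g\<in>G. c g = 0"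
      then have "good j G" unfolding good_def by (intro conjI allI impI)
      then show ?thesis ..
    qed
  qed
  then obtain G where G: "good j (G j)" for j by metis
  have fG: "\<And>j. finite (G j)" and GZ: "\<And>j. G j \<subseteq> ZH j"
    and ZG: "\<And>j. ZH j \<subseteq> kv.span (G j \<union> D j)"
    and ind: "\<And>j c. (\<Sum>g\<in>G j. mon 0 (c g) \<star> g) \<in> kv.span (D j) \<Longrightarrow> \<forall>g\<in>G j. c g = 0"
    using G unfolding good_def by blast+
  have G0: "0 \<notin> G j" for j
  proof
    assume "0 \<in> G j"
    let ?c = "\<lambda>g :: 'a pvec. if g = 0 then 1 else 0 :: 'a"
    have s: "(\<Sum>g\<in>G j. mon 0 (?c g) \<star> g) = 0"
      by (rule sum.neutral) auto
    have "\<forall>g\<in>G j. ?c g = 0" by (rule ind) (unfold s, rule kv.span_zero)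
    then show False using \<open>0 \<in> G j\<close> by force
  qed
  \<comment> \<open>Nonzero homogeneous vectors have only one degree, so a generator determines the
    degree in which it was chosen; this makes \<open>\<gamma>\<close> meaningful.\<close>
  have Gdeg: "i = j" if "g \<in> G i" "g \<in> G j" for g i j
  proof (rule ccontr)
    assume "i \<noteq> j"
    moreover have "g \<in> FH n B \<delta> i" "g \<in> FH n B \<delta> j" using that GZ by (auto simp: ZH_def)
    ultimately have "g = 0" using pj_of_FH[of g n B \<delta> i j] pj_of_FH[of g n B \<delta> j j] by simp
    then show False using G0 that by blast
  qed
  define GG where "GG = (\<Union>j. G j)"
  \<comment> \<open>Bases of resolutions are sets of natural numbers. Finitely many generators in
    each degree are countably many altogether, so they can be numbered.\<close>
  have cG: "countable GG" unfolding GG_def by (rule countable_UN) (use fG in \<open>auto intro: countable_finite\<close>)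
  define ix where "ix = to_nat_on GG"
  have ix: "inj_on ix GG" unfolding ix_def by (rule inj_on_to_nat_on[OF cG])
  define C where "C = ix ` GG"
  define w where "w = inv_into GG ix"
  have w_ix: "w (ix g) = g" if "g \<in> GG" for g unfolding w_def by (rule inv_into_f_f[OF ix that])
  define \<gamma> where "\<gamma> b = (THE j. w b \<in> G j)" for b
  have \<gamma>_ix: "\<gamma> (ix g) = j" if "g \<in> G j" for g j
  proof -
    have "w (ix g) = g" using that w_ix by (auto simp: GG_def)
    then show ?thesis unfolding \<gamma>_def using that Gdeg by (intro the_equality) auto
  qed
  have Cw: "w b \<in> G (\<gamma> b)" "ix (w b) = b" if b: "b \<in> C" for b
  proof -
    obtain g j where g: "g \<in> G j" "b = ix g" using b by (auto simp: C_def GG_def)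
    then have "w b = g" "\<gamma> b = j" using w_ix \<gamma>_ix by (auto simp: GG_def)
    then show "w b \<in> G (\<gamma> b)" "ix (w b) = b" using g by auto
  qed
  have wZ: "w b \<in> Z" and wF: "w b \<in> FH n B \<delta> (\<gamma> b)" if "b \<in> C" for b
    using subsetD[OF GZ Cw(1)[OF that]] by (auto simp: ZH_def)
  obtain l where l: "\<And>b. b \<in> B \<Longrightarrow> l \<le> \<delta> b" using locfin_lower_bound[OF lf] by blast
  have ZH0: "ZH j \<subseteq> {0}" if "j < l" for j
  proof
    fix v :: "'a pvec" assume "v \<in> ZH j"
    then have v: "v \<in> FH n B \<delta> j" by (simp add: ZH_def)
    have "v b = 0" for b
      using FH_degree_ge[OF v, of b] FM_supp[OF FH_FM[OF v], of b] l[of b] that by force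
    then show "v \<in> {0}" by (auto simp: fun_eq_iff pointwise)
  qed
  have C_deg: "l \<le> \<gamma> b" if "b \<in> C" for b
    using Cw(1)[OF that] G0 GZ[of "\<gamma> b"] ZH0[of "\<gamma> b"] by (metis not_less singletonD subsetD)
  have lfC: "locfin C \<gamma>"
    unfolding locfin_def
  proof
    fix j
    have "{b \<in> C. \<gamma> b \<le> j} \<subseteq> (\<Union>i\<in>{l..j}. ix ` G i)"
    proof
      fix b assume "b \<in> {b \<in> C. \<gamma> b \<le> j}"
      then have "b \<in> C" "\<gamma> b \<in> {l..j}" using C_deg by auto
      then show "b \<in> (\<Union>i\<in>{l..j}. ix ` G i)" using Cw[of b] by (metis UN_I imageI)
    qed
    then show "finite {b \<in> C. \<gamma> b \<le> j}" by (rule finite_subset) (use fG in auto)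
  qed
  have gl: "glin n C \<gamma> B \<delta> (ext w)" by (rule glin_ext[OF wF])
  define R where "R = ext w ` FM n C"
  have R_add: "u + v \<in> R" if uv: "u \<in> R" "v \<in> R" for u v
  proof -
    obtain x y where "x \<in> FM n C" "u = ext w x" "y \<in> FM n C" "v = ext w y"
      using uv unfolding R_def by blast
    then have "u + v = ext w (x + y)" "x + y \<in> FM n C" using glin_add[OF gl] FM_add by auto
    then show ?thesis unfolding R_def by (rule image_eqI)
  qed
  have R_vscale: "r \<star> v \<in> R" if rv: "r \<in> pol n" "v \<in> R" for r v
  proof -
    obtain x where "x \<in> FM n C" "v = ext w x" using rv(2) unfolding R_def by blast
    then have "r \<star> v = ext w (r \<star> x)" "r \<star> x \<in> FM n C"
      using glin_vscale[OF gl rv(1)] FM_vscale[OF rv(1)] by auto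
    then show ?thesis unfolding R_def by (rule image_eqI)
  qed
  have R_zero: "0 \<in> R" using glin_zero[OF gl] FM_zero unfolding R_def by (metis imageI)
  have R_sub: "kv.subspace R"
    unfolding kv.subspace_def using R_zero R_add R_vscale[OF pol_const] by blast
  have R_G: "G j \<subseteq> R" for j
  proof
    fix g assume g: "g \<in> G j"
    then have "g \<in> GG" by (auto simp: GG_def)
    then have "ext w (bv (ix g)) = g" "bv (ix g) \<in> FM n C"
      using w_ix by (auto simp: ext_bv C_def intro: FM_bv)
    then show "g \<in> R" unfolding R_def by (metis imageI)
  qed
  \<comment> \<open>Below the bound \<open>l\<close> there is nothing but zero. In degree
    \<open>j\<close>, elements are combinations of \<open>G j\<close> and of variables times
    elements of degree \<open>j - 1\<close>, which are covered by induction.\<close>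
  have ZHR: "\<forall>j. j < l + int k \<longrightarrow> ZH j \<subseteq> R" for k
  proof (induction k)
    case 0
    then show ?case using ZH0 R_zero by auto
  next
    case (Suc k)
    show ?case
    proof (intro allI impI)
      fix j assume j: "j < l + int (Suc k)"
      then have "ZH (j - 1) \<subseteq> R" using Suc by auto
      then have "D j \<subseteq> R" unfolding D_def mdec_def
        by (auto intro!: R_vscale pol_single)
      then show "ZH j \<subseteq> R"
        using ZG[of j] R_G[of j] kv.span_minimal[OF _ R_sub, of "G j \<union> D j"] by blast
    qed
  qed
  have "Z \<subseteq> R"
  proof
    fix v :: "'a pvec" assume v: "v \<in> Z"
    have "pj n \<delta> j v \<in> R" for j
    proof -
      have "pj n \<delta> j v \<in> ZH j" using gsub_pj[OF Z v] pj_FH[OF gsub_FM[OF Z v]] by (auto simp: ZH_def)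
      moreover have "j < l + int (nat (j - l + 1))" by simp
      ultimately show ?thesis using ZHR by blast
    qed
    then have "(\<Sum>j | pj n \<delta> j v \<noteq> 0. pj n \<delta> j v) \<in> R" by (intro kv.subspace_sum[OF R_sub]) auto
    then show "v \<in> R" using sum_pj[OF pj_finite[OF gsub_FM[OF Z v]] subset_refl] by metis
  qed
  moreover have "R \<subseteq> Z"
  proof
    fix x :: "'a pvec" assume "x \<in> R"
    then obtain v where v: "v \<in> FM n C" "x = ext w v" unfolding R_def by blast
    have "v b \<star> w b \<in> Z" if "v b \<noteq> 0" for b
      by (rule gsub_vscale[OF Z FM_pol[OF v(1)] wZ[OF FM_supp[OF v(1) that]]])
    then show "x \<in> Z" unfolding v(2) ext_def by (intro gsub_sum[OF Z]) simp
  qed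
  ultimately have RZ: "ext w ` FM n C = Z" unfolding R_def by blast
  have ker: "ev v = 0" if v: "v \<in> FM n C" "ext w v = 0" for v
  proof
    fix b0
    show "ev v b0 = 0 b0"
    proof (cases "b0 \<in> C")
      case False
      then have "v b0 = 0" using FM_supp[OF v(1)] by blast
      then show ?thesis by (simp add: ev_def pointwise)
    next
      case True
      define j where "j = \<gamma> b0"
      define u where "u = pj n \<gamma> j v"
      have u: "u \<in> FH n C \<gamma> j" unfolding u_def by (rule pj_FH[OF v(1)])
      have u0: "ext w u = 0" unfolding u_def using glin_pj[OF gl v(1)] v(2) pj_zero by metis
      \<comment> \<open>All indices of \<open>G j\<close> are added to the support, so that the part
        of degree \<open>j\<close> is a sum over the whole of \<open>G j\<close>, as
        \<open>ind\<close> demands. The coefficients there have degree 0 and are constants; all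
        remaining terms have coefficients of positive degree and lie in the span of
        \<open>D j\<close>.\<close>
      define S where "S = {b. u b \<noteq> 0} \<union> ix ` G j"
      have fS: "finite S" unfolding S_def using FM_finite[OF FH_FM[OF u]] fG by simp
      have SC: "S \<subseteq> C" unfolding S_def C_def GG_def using FM_supp[OF FH_FM[OF u]] by (auto simp: C_def GG_def)
      let ?c = "\<lambda>g. cf (u (ix g)) 0"
      have "0 = (\<Sum>b\<in>S. u b \<star> w b)" using u0 ext_sum[OF fS, of u w] by (simp add: S_def)
      also have "\<dots> = (\<Sum>b\<in>S - ix ` G j. u b \<star> w b) + (\<Sum>b\<in>ix ` G j. u b \<star> w b)"
        using fS by (intro sum.subset_diff) (auto simp: S_def)
      also have "(\<Sum>b\<in>ix ` G j. u b \<star> w b) = (\<Sum>g\<in>G j. u (ix g) \<star> w (ix g))"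
        by (subst sum.reindex) (auto intro!: inj_on_subset[OF ix] simp: GG_def)
      also have "\<dots> = (\<Sum>g\<in>G j. mon 0 (?c g) \<star> g)"
      proof (rule sum.cong[OF refl])
        fix g assume g: "g \<in> G j"
        then have "u (ix g) = mon 0 (?c g)"
          using hpol_0_eq_const FH_hpol[OF u, of "ix g"] \<gamma>_ix[OF g] by fastforce
        moreover have "w (ix g) = g" using g w_ix by (auto simp: GG_def)
        ultimately show "u (ix g) \<star> w (ix g) = mon 0 (?c g) \<star> g" by metis
      qed
      finally have "(\<Sum>g\<in>G j. mon 0 (?c g) \<star> g) = - (\<Sum>b\<in>S - ix ` G j. u b \<star> w b)"
        by (simp only: eq_neg_iff_add_eq_0 add.commute)
      moreover have "u b \<star> w b \<in> kv.span (D j)" if b: "b \<in> S - ix ` G j" for b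
      proof -
        have bC: "b \<in> C" using b SC by blast
        have "u b \<noteq> 0" using b by (auto simp: S_def)
        then have "\<gamma> b \<le> j" by (rule FH_degree_ge[OF u])
        moreover have "\<gamma> b \<noteq> j" using b Cw[OF bC] by (metis DiffE imageI)
        ultimately have "0 < j - \<gamma> b" by simp
        then show ?thesis
          unfolding D_def ZH_def
          using pos_vscale_mdec[OF Z FH_hpol[OF u, of b] _ wZ[OF bC], of j] wF[OF bC] by simp
      qed
      then have "- (\<Sum>b\<in>S - ix ` G j. u b \<star> w b) \<in> kv.span (D j)"
        by (intro kv.span_neg kv.span_sum) auto
      ultimately have "\<forall>g\<in>G j. ?c g = 0" using ind[where j = j and c = ?c] by metis
      then have "cf (u b0) 0 = 0" using Cw[OF True] unfolding j_def by metis
      moreover have "cf (u b0) 0 = cf (v b0) 0" by (simp add: u_def j_def pj_def lookup_hcp)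
      ultimately show ?thesis by (simp add: ev_def pointwise)
    qed
  qed
  show ?thesis by (rule that[OF lfC wF RZ ker])
qed

lemma gsub_preimage:
  assumes I: "hideal n I" and d: "glin n C \<gamma> B \<beta> d"
  shows "gsub n C \<gamma> {v \<in> FM n C. d v \<in> auxJ n I i}"
  unfolding gsub_def
proof (intro conjI ballI allI)
  fix u v :: "'a pvec" assume "u \<in> {v \<in> FM n C. d v \<in> auxJ n I i}" "v \<in> {v \<in> FM n C. d v \<in> auxJ n I i}"
  then show "u + v \<in> {v \<in> FM n C. d v \<in> auxJ n I i}"
    using FM_add auxJ_add[OF I] glin_add[OF d] by (auto simp del: auxJ_Suc)
next
  fix r :: "'a mpoly" and v :: "'a pvec" assume "r \<in> pol n" "v \<in> {v \<in> FM n C. d v \<in> auxJ n I i}"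
  then show "r \<star> v \<in> {v \<in> FM n C. d v \<in> auxJ n I i}"
    using FM_vscale auxJ_vscale[OF I] glin_vscale[OF d] by auto
next
  fix j and v :: "'a pvec" assume "v \<in> {v \<in> FM n C. d v \<in> auxJ n I i}"
  then show "pj n \<gamma> j v \<in> {v \<in> FM n C. d v \<in> auxJ n I i}"
    using FH_FM[OF pj_FH] auxJ_pj[OF I] glin_pj[OF d] by auto
qed (use glin_zero[OF d] auxJ_zero[OF I] in auto)

text \<open>The component of degree 0 is the constant coefficient, a unit of R.\<close>

lemma hideal_const:
  assumes I: "hideal n I" and "f \<in> I" "cf f 0 \<noteq> 0"
  shows "1 \<in> I"
proof -
  have "hcp n 0 f \<in> I" "f \<in> pol n" using I assms(2) by (auto simp: hideal_def)
  moreover have "hcp n 0 f = mon 0 (cf f 0)"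
    using hpol_0_eq_const[OF hcp_hpol[OF \<open>f \<in> pol n\<close>]] by (simp add: lookup_hcp)
  ultimately have "mon 0 (1 / cf f 0) * mon 0 (cf f 0) \<in> I"
    using I pol_const unfolding hideal_def by metis
  then show ?thesis using assms(3) by (simp add: mult_single)
qed

text \<open>Each differential is a minimal cover of the kernel before it (of the preimage of
  \<open>I\<close> at the beginning). A minimal cover has its kernel inside the vectors with zero
  constant coefficients, and this is the minimality of the next differential.\<close>

theorem minimal_cres_exists:
  assumes I: "hideal n I"
  obtains B \<delta> d where "cres n I B \<delta> d" "minimal_cres n B d" "\<And>i. locfin (B i) (\<delta> i)"
proof -
  define good where "good i s \<longleftrightarrow> (case s of (B, \<delta>, C, \<gamma>, d) \<Rightarrow>
      glin n C \<gamma> B \<delta> d \<and> locfin B \<delta> \<and> locfin C \<gamma> \<and> (\<forall>v\<in>FM n C. d v \<in> auxJ n I i \<longrightarrow> ev v = 0) \<and>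
      (i = 0 \<longrightarrow> B = {0} \<and> \<delta> = (\<lambda>_. 0) \<and> (\<forall>v\<in>FM n {0}. \<exists>u\<in>FM n C. v - d u \<in> auxJ n I 0)))"
    for i and s :: "nat set \<times> (nat \<Rightarrow> int) \<times> nat set \<times> (nat \<Rightarrow> int) \<times> ('a pvec \<Rightarrow> 'a pvec)"
  define step where "step i s s' \<longleftrightarrow> (case s of (B, \<delta>, C, \<gamma>, d) \<Rightarrow> case s' of (B', \<delta>', C', \<gamma>', d') \<Rightarrow>
      B' = C \<and> \<delta>' = \<gamma> \<and> d' ` FM n C' = {v \<in> FM n C. d v \<in> auxJ n I i})"
    for i :: nat and s s' :: "nat set \<times> (nat \<Rightarrow> int) \<times> nat set \<times> (nat \<Rightarrow> int) \<times> ('a pvec \<Rightarrow> 'a pvec)"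
  have "\<exists>s. \<forall>i. good i (s i) \<and> step i (s i) (s (Suc i))"
  proof (rule dependent_nat_choice)
    have lf0: "locfin {0} (\<lambda>_. 0)" "locfin {} (\<lambda>_. 0)" by (auto simp: locfin_def)
    show "\<exists>s. good 0 s"
    \<comment> \<open>If R/I is zero, covering it by R would violate minimality, so the module at
      index 1 is zero. Otherwise it is R with the identity, and \<open>I\<close> contains no
      polynomial with a nonzero constant coefficient.\<close>
    proof (cases "1 \<in> I")
      case True
      have "v 0 \<in> I" if "v \<in> FM n {0}" for v :: "'a pvec"
        using True I FM_pol[OF that] unfolding hideal_def by (metis mult.right_neutral)
      then have "v - 0 \<in> auxJ n I 0" if "v \<in> FM n {0}" for v :: "'a pvec" using that by (auto simp: auxJ_def)
      moreover have "ev v = 0" if "v \<in> FM n {}" for v :: "'a pvec"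
        using that by (auto simp: FM_def ev_def fun_eq_iff pointwise)
      ultimately have "good 0 ({0}, \<lambda>_. 0, {}, \<lambda>_. 0, \<lambda>_. 0)"
        unfolding good_def using lf0 glin_const_zero by (auto intro: exI[of _ 0])
      then show ?thesis by blast
    next
      case False
      have "ev v = 0" if "v \<in> auxJ n I 0" for v :: "'a pvec"
      proof
        fix b
        have "v 0 \<in> I" "v \<in> FM n {0}" using that by (auto simp: auxJ_def)
        then have "cf (v 0) 0 = 0" "b \<noteq> 0 \<Longrightarrow> v b = 0"
          using hideal_const[OF I] False FM_supp[of v n "{0}" b] by auto
        then show "ev v b = 0 b" by (cases "b = 0") (auto simp: ev_def pointwise)
      qed
      moreover have "\<exists>u\<in>FM n {0}. v - u \<in> auxJ n I 0" if "v \<in> FM n {0}" for v :: "'a pvec"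
        using that auxJ_zero[OF I, of 0] by (intro bexI[of _ v]) auto
      ultimately have "good 0 ({0}, \<lambda>_. 0, {0}, \<lambda>_. 0, \<lambda>v. v)"
        unfolding good_def using lf0 glin_id by auto
      then show ?thesis by blast
    qed
  next
    fix s i assume "good i s"
    obtain B \<delta> C \<gamma> d where s: "s = (B, \<delta>, C, \<gamma>, d)" by (metis prod_cases5)
    have d: "glin n C \<gamma> B \<delta> d" and lf: "locfin C \<gamma>"
      using \<open>good i s\<close> unfolding good_def s by auto
    obtain C' \<gamma>' w where c: "locfin C' \<gamma>'" "\<And>b. b \<in> C' \<Longrightarrow> w b \<in> FH n C \<gamma> (\<gamma>' b)"
      "ext w ` FM n C' = {v \<in> FM n C. d v \<in> auxJ n I i}"
      "\<And>v. v \<in> FM n C' \<Longrightarrow> ext w v = 0 \<Longrightarrow> ev v = 0"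
      using minimal_cover[OF lf gsub_preimage[OF I d, of i]] by blast
    have "good (Suc i) (C, \<gamma>, C', \<gamma>', ext w)"
      unfolding good_def using c(1,4) lf glin_ext[OF c(2)] by auto
    moreover have "step i s (C, \<gamma>, C', \<gamma>', ext w)"
      unfolding step_def s using c(3) by auto
    ultimately show "\<exists>s'. good (Suc i) s' \<and> step i s s'" by blast
  qed
  then obtain s where s: "\<And>i. good i (s i)" "\<And>i. step i (s i) (s (Suc i))" by blast
  define B where "B i = fst (s i)" for i
  define \<delta> where "\<delta> i = fst (snd (s i))" for i
  define d where "d i = snd (snd (snd (snd (s i))))" for i
  have s_eq: "s i = (B i, \<delta> i, B (Suc i), \<delta> (Suc i), d i)" for i
    using s(2)[of i] unfolding step_def B_def \<delta>_def d_def by (auto split: prod.splits)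
  have good: "glin n (B (Suc i)) (\<delta> (Suc i)) (B i) (\<delta> i) (d i)" "locfin (B i) (\<delta> i)"
    "\<And>v. v \<in> FM n (B (Suc i)) \<Longrightarrow> d i v \<in> auxJ n I i \<Longrightarrow> ev v = 0" for i
    using s(1)[of i] unfolding good_def s_eq by auto
  have good0: "B 0 = {0}" "\<delta> 0 = (\<lambda>_. 0)" "\<forall>v\<in>FM n {0}. \<exists>u\<in>FM n (B 1). v - d 0 u \<in> auxJ n I 0"
    using s(1)[of 0] unfolding good_def s_eq by auto
  have step: "d (Suc i) ` FM n (B (Suc (Suc i))) = {v \<in> FM n (B (Suc i)). d i v \<in> auxJ n I i}" for i
    using s(2)[of i] unfolding step_def s_eq by auto
  show ?thesis
  proof (rule that)
    show c: "cres n I B \<delta> d" unfolding cres_def using good(1) good0 step by auto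
    show "minimal_cres n B d"
      unfolding minimal_cres_def using step good(3) by blast
    show "locfin (B i) (\<delta> i)" for i by (rule good(2))
  qed
qed

section \<open>Ideals of the polynomial ring\<close>

lemma poly_ring_cring: "cring (poly_ring n :: ('k::field mpoly, 'k mpoly) gmodule)"
proof (rule cringI)
  show "abelian_group (poly_ring n :: ('k mpoly, 'k mpoly) gmodule)"
    by (rule abelian_groupI) (auto intro: pol_add pol_uminus bexI[of _ "- _"] simp: algebra_simps)
  show "comm_monoid (poly_ring n :: ('k mpoly, 'k mpoly) gmodule)"
    by (rule comm_monoidI) (auto intro: pol_mult simp: algebra_simps)
qed (auto simp: algebra_simps)

lemma poly_ring_minus:
  fixes f :: "'k::field mpoly"
  assumes "f \<in> pol n"
  shows "\<ominus>\<^bsub>poly_ring n\<^esub> f = - f"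
proof -
  interpret cring "poly_ring n :: ('k mpoly, 'k mpoly) gmodule" by (rule poly_ring_cring)
  show ?thesis using minus_equality[of "- f" f, OF _ assms pol_uminus[OF assms]] by simp
qed

lemma poly_ring_pow: "f [^]\<^bsub>poly_ring n\<^esub> (q :: nat) = f ^ q"
  by (induction q) (auto simp: mult.commute)

lemma ideal_poly_ringI:
  assumes "Y \<subseteq> pol n" "0 \<in> Y" "\<And>f g. f \<in> Y \<Longrightarrow> g \<in> Y \<Longrightarrow> f + g \<in> Y"
    and mult: "\<And>r f. r \<in> pol n \<Longrightarrow> f \<in> Y \<Longrightarrow> r * f \<in> Y"
  shows "ideal Y (poly_ring n)"
proof (rule idealI)
  interpret cring "poly_ring n :: ('a mpoly, 'a mpoly) gmodule" by (rule poly_ring_cring)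
  show "ring (poly_ring n :: ('a mpoly, 'a mpoly) gmodule)" by (rule ring_axioms)
  have "\<ominus>\<^bsub>poly_ring n\<^esub> f \<in> Y" if "f \<in> Y" for f :: "'a mpoly"
    using mult[of "- 1" f] that assms(1) poly_ring_minus[of f n] by (auto simp: pol_uminus)
  then show "subgroup Y (add_monoid (poly_ring n))"
    using assms(1-3) by (intro add.subgroupI) (auto simp: a_inv_def)
  show "f \<otimes>\<^bsub>poly_ring n\<^esub> r \<in> Y" if "f \<in> Y" "r \<in> pol n" for f r :: "'a mpoly"
    using mult[OF that(2,1)] by (simp add: mult.commute)
qed (use mult in auto)

lemma ideal_poly_ringD:
  assumes "ideal Y (poly_ring n)"
  shows "Y \<subseteq> pol n" "0 \<in> Y" "\<And>f g. f \<in> Y \<Longrightarrow> g \<in> Y \<Longrightarrow> f + g \<in> Y"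
    and "\<And>r f. r \<in> pol n \<Longrightarrow> f \<in> Y \<Longrightarrow> r * f \<in> Y"
proof -
  interpret ideal Y "poly_ring n" by (rule assms)
  have sub: "additive_subgroup Y (poly_ring n)" by (rule ideal.axioms(1)[OF assms])
  show "Y \<subseteq> pol n" by (rule additive_subgroup.a_subset[OF sub])
  show "0 \<in> Y" using additive_subgroup.zero_closed[OF sub] by simp
  show "\<And>f g. f \<in> Y \<Longrightarrow> g \<in> Y \<Longrightarrow> f + g \<in> Y"
    using additive_subgroup.a_closed[OF sub] by simp
  show "\<And>r f. r \<in> pol n \<Longrightarrow> f \<in> Y \<Longrightarrow> r * f \<in> Y" using I_l_closed by simp
qed

text \<open>The members whose components all belong to the generated ideal form an ideal themselves.
  It contains the generators, hence everything.\<close>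

lemma hideal_genideal:
  assumes S: "S \<subseteq> pol n" and comp: "\<And>s k. s \<in> S \<Longrightarrow> hcp n k s \<in> Idl\<^bsub>poly_ring n\<^esub> S"
  shows "hideal n (Idl\<^bsub>poly_ring n\<^esub> S)"
proof -
  interpret cring "poly_ring n :: ('a mpoly, 'a mpoly) gmodule" by (rule poly_ring_cring)
  let ?J = "Idl\<^bsub>poly_ring n\<^esub> S"
  have J: "ideal ?J (poly_ring n)" by (rule genideal_ideal) (use S in simp)
  note JD = ideal_poly_ringD[OF J]
  have Jsum: "sum f A \<in> ?J" if "\<And>x. x \<in> A \<Longrightarrow> f x \<in> ?J" for f :: "int \<Rightarrow> 'a mpoly" and A
    using that by (induction A rule: infinite_finite_induct) (use JD(2,3) in auto)
  define Y where "Y = {f \<in> ?J. \<forall>k. hcp n k f \<in> ?J}"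
  have "ideal Y (poly_ring n)"
  proof (rule ideal_poly_ringI)
    fix r f :: "'a mpoly" assume r: "r \<in> pol n" and f: "f \<in> Y"
    have "hcp n k (r * f) \<in> ?J" for k
    proof -
      let ?L = "{l. hcp n l r \<noteq> 0}"
      have "r * f = (\<Sum>l\<in>?L. hcp n l r) * f" using sum_hcp[OF hcp_finite subset_refl, of n r] by simp
      then have "hcp n k (r * f) = (\<Sum>l\<in>?L. hcp n k (hcp n l r * f))"
        by (simp add: sum_distrib_right hcp_sum)
      also have "\<dots> = (\<Sum>l\<in>?L. hcp n l r * hcp n (k - l) f)"
        by (rule sum.cong[OF refl]) (rule hcp_mult[OF hcp_hpol[OF r]])
      also have "\<dots> \<in> ?J"
        using f hpol_pol[OF hcp_hpol[OF r]] by (intro Jsum JD(4)) (auto simp: Y_def)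
      finally show ?thesis .
    qed
    then show "r * f \<in> Y" using JD(4)[OF r] f by (auto simp: Y_def)
  qed (use JD(1-3) in \<open>auto simp: Y_def hcp_add\<close>)
  moreover have "S \<subseteq> Y" using comp genideal_self[of S] S by (auto simp: Y_def)
  ultimately have "?J \<subseteq> Y" by (rule genideal_minimal)
  then show ?thesis unfolding hideal_def Y_def using JD by blast
qed

lemma homogeneous_ideal_hideal:
  assumes "homogeneous_ideal (poly_ring n) I"
  shows "hideal n I"
proof -
  interpret cring "poly_ring n :: ('a mpoly, 'a mpoly) gmodule" by (rule poly_ring_cring)
  obtain S where S: "S \<subseteq> (\<Union>j. hpol n j)" "I = Idl\<^bsub>poly_ring n\<^esub> S"
    using assms unfolding homogeneous_ideal_def by blast
  have Sp: "S \<subseteq> pol n" using S(1) hpol_pol by blast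
  have "hcp n k s \<in> Idl\<^bsub>poly_ring n\<^esub> S" if s: "s \<in> S" for s k
  proof -
    obtain j where "s \<in> hpol n j" using S(1) s by blast
    then have "hcp n k s = (if j = k then s else 0)" by (rule hcp_of_hpol)
    moreover have "0 \<in> Idl\<^bsub>poly_ring n\<^esub> S"
      by (rule ideal_poly_ringD(2)[OF genideal_ideal]) (use Sp in simp)
    ultimately show ?thesis using genideal_self[of S] Sp s by auto
  qed
  then show ?thesis unfolding S(2) by (rule hideal_genideal[OF Sp])
qed

section \<open>The Frobenius functor\<close>

lemma CHAR_mpoly: "CHAR('k::field mpoly) = CHAR('k)"
proof (rule CHAR_eqI)
  show "of_nat CHAR('k) = (0 :: 'k mpoly)"
    by (metis of_nat_CHAR single_of_nat single_zero)
next
  fix m assume "of_nat m = (0 :: 'k mpoly)"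
  then have "of_nat m = (0 :: 'k)" by (metis lookup_single_eq lookup_zero single_of_nat)
  then show "CHAR('k) dvd m" by (simp add: of_nat_eq_0_iff_char_dvd)
qed

text \<open>Since \<open>c \<mapsto> c\<^sup>q\<close> is a field homomorphism, \<open>K\<close> is a vector space over itself with scaling
  \<open>c \<cdot> x = c\<^sup>q x\<close>, and \<open>\<rho> \<kappa> x\<close> is the coordinate of \<open>x\<close> at the basis vector \<open>\<kappa>\<close>.\<close>

locale frobenius_coordinates =
  fixes q :: nat and \<rho> :: "'k::field \<Rightarrow> 'k \<Rightarrow> 'k"
  assumes q_pos: "0 < q"
    and pow_add: "\<And>f g :: 'k mpoly. (f + g) ^ q = f ^ q + g ^ q"
    and \<rho>_add: "\<rho> \<kappa> (x + y) = \<rho> \<kappa> x + \<rho> \<kappa> y"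
    and \<rho>_scale: "\<rho> \<kappa> (c ^ q * x) = c * \<rho> \<kappa> x"
    and \<rho>_finite: "finite {\<kappa>. \<rho> \<kappa> x \<noteq> 0}"
    and \<rho>_sum: "(\<Sum>\<kappa> | \<rho> \<kappa> x \<noteq> 0. \<rho> \<kappa> x ^ q * \<kappa>) = x"

lemma frobenius_coordinates_exist:
  assumes "prime CHAR('k::field)" and q: "q = CHAR('k) ^ e"
  obtains \<rho> :: "'k::field \<Rightarrow> 'k \<Rightarrow> 'k" where "frobenius_coordinates q \<rho>"
proof -
  have q0: "0 < q" using assms prime_gt_0_nat by simp
  have add: "(a + b) ^ q = a ^ q + b ^ q" for a b :: 'k
    by (rule freshmans_dream'[OF assms])
  interpret fk: vector_space "\<lambda>(c::'k) x. c ^ q * x"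
    by unfold_locales (auto simp: add algebra_simps)
  define A where "A = fk.extend_basis {}"
  have A: "fk.independent A" and sp: "x \<in> fk.span A" for x
    unfolding A_def using fk.independent_extend_basis[OF fk.independent_empty]
      fk.span_extend_basis[OF fk.independent_empty] by auto
  have "frobenius_coordinates q (\<lambda>\<kappa> x. fk.representation A x \<kappa>)"
  proof
    show "(f + g) ^ q = f ^ q + g ^ q" for f g :: "'k mpoly"
      by (rule freshmans_dream'[of q e]) (use assms in \<open>simp_all add: CHAR_mpoly\<close>)
    show "fk.representation A (x + y) \<kappa> = fk.representation A x \<kappa> + fk.representation A y \<kappa>" for x y \<kappa>
      by (simp add: fk.representation_add[OF A sp sp])
    show "fk.representation A (c ^ q * x) \<kappa> = c * fk.representation A x \<kappa>" for c x \<kappa>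
      by (simp add: fk.representation_scale[OF A sp])
    show "(\<Sum>\<kappa> | fk.representation A x \<kappa> \<noteq> 0. fk.representation A x \<kappa> ^ q * \<kappa>) = x" for x
      by (rule fk.sum_nonzero_representation_eq[OF A sp])
  qed (use q0 fk.finite_representation in auto)
  then show ?thesis by (rule that)
qed

section \<open>Division with remainder on exponent vectors\<close>

definition mmul :: "nat \<Rightarrow> (nat \<Rightarrow>\<^sub>0 nat) \<Rightarrow> (nat \<Rightarrow>\<^sub>0 nat)"
  where "mmul q a = Poly_Mapping.map (\<lambda>x. q * x) a"

definition mdiv :: "nat \<Rightarrow> (nat \<Rightarrow>\<^sub>0 nat) \<Rightarrow> (nat \<Rightarrow>\<^sub>0 nat)"
  where "mdiv q a = Poly_Mapping.map (\<lambda>x. x div q) a"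

definition mmod :: "nat \<Rightarrow> (nat \<Rightarrow>\<^sub>0 nat) \<Rightarrow> (nat \<Rightarrow>\<^sub>0 nat)"
  where "mmod q a = Poly_Mapping.map (\<lambda>x. x mod q) a"

lemma lookup_mmul: "cf (mmul q a) i = q * cf a i"
  and lookup_mdiv: "cf (mdiv q a) i = cf a i div q"
  and lookup_mmod: "cf (mmod q a) i = cf a i mod q"
  by (auto simp: mmul_def mdiv_def mmod_def map.rep_eq when_def)

lemma mdiv_mmul_add: "0 < q \<Longrightarrow> mdiv q (mmul q a + b) = a + mdiv q b"
  and mmod_mmul_add: "mmod q (mmul q a + b) = mmod q b"
  and mmod_add_mmul_mdiv: "mmod q b + mmul q (mdiv q b) = b"
  by (rule poly_mapping_eqI; simp add: lookup_mmul lookup_mdiv lookup_mmod lookup_add)+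

lemma keys_mdiv: "supp (mdiv q b) \<subseteq> supp b"
  by (metis div_0 in_keys_iff lookup_mdiv subsetI)

lemma keys_mmod: "supp (mmod q b) \<subseteq> supp b"
  by (metis mod_0 in_keys_iff lookup_mmod subsetI)

lemma single_power:
  fixes c :: "'k::comm_ring_1"
  shows "mon a c ^ q = mon (mmul q a) (c ^ q)"
proof (induction q)
  case 0
  have "mmul 0 a = 0" by (rule poly_mapping_eqI) (simp add: lookup_mmul)
  then show ?case by simp
next
  case (Suc q)
  have "a + mmul q a = mmul (Suc q) a"
    by (rule poly_mapping_eqI) (simp add: lookup_mmul lookup_add)
  then show ?case using Suc by (simp add: mult_single)
qed

section \<open>Coordinates over the q-th powers and exactness of the Frobenius functor\<close>

context frobenius_coordinates
begin

lemma \<rho>_zero [simp]: "\<rho> \<kappa> 0 = 0"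
  using \<rho>_scale[of \<kappa> 0 0] q_pos by simp

text \<open>The coordinate of \<open>f\<close> at \<kappa> times the monomial with exponent
  \<alpha>. In the language of Frobenius splittings it is a Cartier map: additive, and a factor
  \<open>g ^ q\<close> comes out as \<open>g\<close>.\<close>

definition tr :: "(nat \<Rightarrow>\<^sub>0 nat) \<Rightarrow> 'k \<Rightarrow> 'k mpoly \<Rightarrow> 'k mpoly"
  where "tr \<alpha> \<kappa> f = (\<Sum>b\<in>supp f. mon (mdiv q b) (\<rho> \<kappa> (cf f b)) when mmod q b = \<alpha>)"

lemma tr_eq_sum:
  assumes "finite S" "supp f \<subseteq> S"
  shows "tr \<alpha> \<kappa> f = (\<Sum>b\<in>S. mon (mdiv q b) (\<rho> \<kappa> (cf f b)) when mmod q b = \<alpha>)"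
  unfolding tr_def by (rule sum.mono_neutral_left) (use assms in \<open>auto simp: in_keys_iff\<close>)

lemma tr_zero [simp]: "tr \<alpha> \<kappa> 0 = 0"
  by (simp add: tr_def)

lemma tr_add: "tr \<alpha> \<kappa> (f + g) = tr \<alpha> \<kappa> f + tr \<alpha> \<kappa> g"
proof -
  let ?S = "supp f \<union> supp g"
  have "finite ?S" by simp
  then show ?thesis
    using keys_add[of f g]
    by (subst (1 2 3) tr_eq_sum[of ?S])
      (auto simp: lookup_add \<rho>_add single_add when_add_distrib sum.distrib)
qed

lemma tr_sum: "tr \<alpha> \<kappa> (sum f A) = (\<Sum>x\<in>A. tr \<alpha> \<kappa> (f x))"
  by (induction A rule: infinite_finite_induct) (auto simp: tr_add)

lemma tr_single: "tr \<alpha> \<kappa> (mon b c) = (mon (mdiv q b) (\<rho> \<kappa> c) when mmod q b = \<alpha>)"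
  by (subst tr_eq_sum[of "{b}"]) auto

text \<open>For monomials: adding \<open>q\<close> times an exponent vector keeps the remainder
  modulo \<open>q\<close> and shifts the quotient, while \<open>\<rho>_scale\<close> extracts the
  coefficient.\<close>

lemma tr_semilinear: "tr \<alpha> \<kappa> (g ^ q * f) = g * tr \<alpha> \<kappa> f"
proof (induction g rule: mpoly_add_induct)
  case zero
  then show ?case using q_pos by (simp add: power_0_left)
next
  case (single a)
  show ?case
  proof (induction f rule: mpoly_add_induct)
    case (single b)
    show ?case
      unfolding single_power mult_single tr_single
      by (simp add: mdiv_mmul_add q_pos mmod_mmul_add \<rho>_scale mult_single when_def)
  qed (auto simp: tr_add algebra_simps)
qed (auto simp: pow_add tr_add algebra_simps)

lemma tr_pol: "f \<in> pol n \<Longrightarrow> tr \<alpha> \<kappa> f \<in> pol n"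
  unfolding tr_def
  by (intro pol_sum) (auto simp: when_def pol_iff dest!: subsetD[OF keys_mdiv])

lemma pow_sum: "sum f A ^ q = (\<Sum>x\<in>A. f x ^ q)" for f :: "'b \<Rightarrow> 'k mpoly"
  by (induction A rule: infinite_finite_induct) (use q_pos in \<open>auto simp: pow_add power_0_left\<close>)

lemma pow_diff: "(f - g) ^ q = f ^ q - g ^ q" for f g :: "'k mpoly"
  using pow_add[of "f - g" g] by simp

text \<open>The index sets \<open>A\<close> and \<open>L\<close> are fixed for the whole of
  \<open>f\<close>, which makes the left-hand side additive. For a single term only its own
  remainder \<alpha> survives, and what is left is the expansion of its coefficient in the
  basis.\<close>

lemma tr_expand:
  assumes "finite A" "finite L" "mmod q ` supp f \<subseteq> A"
    and L: "\<And>b. b \<in> supp f \<Longrightarrow> {\<kappa>. \<rho> \<kappa> (cf f b) \<noteq> 0} \<subseteq> L"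
  shows "(\<Sum>\<alpha>\<in>A. \<Sum>\<kappa>\<in>L. mon \<alpha> \<kappa> * tr \<alpha> \<kappa> f ^ q) = f"
proof (induction f rule: mpoly_add_induct)
  case zero
  then show ?case using q_pos by (simp add: power_0_left)
next
  case (single b)
  let ?c = "cf f b"
  have "(\<Sum>\<alpha>\<in>A. \<Sum>\<kappa>\<in>L. mon \<alpha> \<kappa> * tr \<alpha> \<kappa> (mon b ?c) ^ q) =
      (\<Sum>\<alpha>\<in>A. if mmod q b = \<alpha> then \<Sum>\<kappa>\<in>L. mon \<alpha> \<kappa> * mon (mdiv q b) (\<rho> \<kappa> ?c) ^ q else 0)"
    by (rule sum.cong[OF refl]) (use q_pos in \<open>auto simp: tr_single when_def power_0_left\<close>)
  also have "\<dots> = (\<Sum>\<kappa>\<in>L. mon (mmod q b) \<kappa> * mon (mdiv q b) (\<rho> \<kappa> ?c) ^ q)"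
    using assms(1,3) single by (subst sum.delta') auto
  also have "\<dots> = (\<Sum>\<kappa>\<in>L. mon b (\<rho> \<kappa> ?c ^ q * \<kappa>))"
    unfolding single_power mult_single mmod_add_mmul_mdiv by (simp add: mult.commute)
  also have "\<dots> = mon b (\<Sum>\<kappa>\<in>L. \<rho> \<kappa> ?c ^ q * \<kappa>)"
    by (induction L rule: infinite_finite_induct) (auto simp: single_add)
  also have "(\<Sum>\<kappa>\<in>L. \<rho> \<kappa> ?c ^ q * \<kappa>) = (\<Sum>\<kappa> | \<rho> \<kappa> ?c \<noteq> 0. \<rho> \<kappa> ?c ^ q * \<kappa>)"
    by (rule sum.mono_neutral_right) (use assms(2) L[OF single] q_pos in \<open>auto simp: power_0_left\<close>)
  also have "\<dots> = ?c" by (rule \<rho>_sum)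
  finally show ?case .
next
  case (add g h)
  show ?case
    unfolding tr_add pow_add distrib_left sum.distrib add ..
qed

definition fr :: "'k pvec \<Rightarrow> 'k pvec"
  where "fr v = (\<lambda>b. v b ^ q)"

definition tv :: "(nat \<Rightarrow>\<^sub>0 nat) \<Rightarrow> 'k \<Rightarrow> 'k pvec \<Rightarrow> 'k pvec"
  where "tv \<alpha> \<kappa> v = (\<lambda>b. tr \<alpha> \<kappa> (v b))"

lemma fr_FM: "v \<in> FM n B \<Longrightarrow> fr v \<in> FM n B"
  using q_pos by (auto simp: FM_def fr_def pol_power power_0_left)

lemma fr_FH: "v \<in> FH n B \<delta> j \<Longrightarrow> fr v \<in> FH n B (\<lambda>b. int q * \<delta> b) (int q * j)"
  using fr_FM[of v n B] hpol_power[of _ n _ q]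
  by (auto simp: FH_def fr_def simp flip: right_diff_distrib)

lemma fr_diff: "fr (u - v) = fr u - fr v"
  by (rule HOL.ext) (simp add: fr_def pointwise pow_diff)

lemma fr_sum: "fr (\<Sum>x\<in>A. f x) = (\<Sum>x\<in>A. fr (f x))"
  by (rule HOL.ext) (simp add: fr_def sum_apply pow_sum)

lemma fr_vscale: "fr (r \<star> v) = r ^ q \<star> fr v"
  by (rule HOL.ext) (simp add: fr_def pointwise power_mult_distrib)

text \<open>The map \<open>fr\<close> is additive and turns a scalar into its \<open>q\<close>-th
  power, so it carries a linear map to the map whose matrix entries are raised to the power
  \<open>q\<close>.\<close>

lemma fr_ext: "v \<in> FM n B \<Longrightarrow> fr (ext w v) = ext (\<lambda>b. fr (w b)) (fr v)"
proof -
  assume v: "v \<in> FM n B"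
  let ?S = "{b. v b \<noteq> 0}"
  have S: "finite ?S" "{b. fr v b \<noteq> 0} \<subseteq> ?S"
    using FM_finite[OF v] q_pos by (auto simp: fr_def power_0_left)
  show ?thesis
    unfolding ext_sum[OF S(1) subset_refl] ext_sum[OF S] fr_sum fr_vscale by (simp add: fr_def)
qed

lemma tv_FM:
  assumes "v \<in> FM n B"
  shows "tv \<alpha> \<kappa> v \<in> FM n B"
proof -
  have "finite {b. tv \<alpha> \<kappa> v b \<noteq> 0}"
    by (rule finite_subset[OF _ FM_finite[OF assms]]) (auto simp: tv_def)
  then show ?thesis using assms by (auto simp: FM_def tv_def tr_pol)
qed

text \<open>By semilinearity of \<open>tr\<close>, the \<open>q\<close>-th power of a matrix entry
  comes out as the entry itself: coordinates of the image under the twisted matrix are images of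
  coordinates under the original one.\<close>

lemma tv_ext:
  assumes v: "v \<in> FM n B"
  shows "tv \<alpha> \<kappa> (ext (\<lambda>b. fr (w b)) v) = ext w (tv \<alpha> \<kappa> v)"
proof
  fix c
  let ?S = "{b. v b \<noteq> 0}"
  have S: "finite ?S" "{b. tv \<alpha> \<kappa> v b \<noteq> 0} \<subseteq> ?S"
    using FM_finite[OF v] by (auto simp: tv_def)
  have "tr \<alpha> \<kappa> (v b * w b c ^ q) = tr \<alpha> \<kappa> (v b) * w b c" for b
    using tr_semilinear[of \<alpha> \<kappa> "w b c" "v b"] by (simp add: mult.commute)
  then show "tv \<alpha> \<kappa> (ext (\<lambda>b. fr (w b)) v) c = ext w (tv \<alpha> \<kappa> v) c"
    unfolding ext_sum[OF S(1) subset_refl] ext_sum[OF S]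
    by (simp add: tv_def sum_apply tr_sum fr_def pointwise)
qed

text \<open>\<open>v\<close> is a finite R-linear combination of the vectors
  \<open>fr (tv \<alpha> \<kappa> v)\<close>. A linear condition on \<open>v\<close> can thus be
  checked on vectors of \<open>q\<close>-th powers.\<close>

lemma submodule_by_coordinates:
  assumes v: "v \<in> FM n B" and zero: "0 \<in> N" and add: "\<And>x y. x \<in> N \<Longrightarrow> y \<in> N \<Longrightarrow> x + y \<in> N"
    and scale: "\<And>r x. r \<in> pol n \<Longrightarrow> x \<in> N \<Longrightarrow> r \<star> x \<in> N"
    and N: "\<And>\<alpha> \<kappa>. fr (tv \<alpha> \<kappa> v) \<in> N"
  shows "v \<in> N"
proof -
  let ?S = "{b. v b \<noteq> 0}"
  \<comment> \<open>\<open>A\<close> and \<open>L\<close> collect the remainders and basis scalars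
    that occur in any entry of \<open>v\<close>; both are finite, so one expansion works for all
    entries.\<close>
  define A where "A = (\<Union>b\<in>?S. mmod q ` supp (v b))"
  define L where "L = (\<Union>b\<in>?S. \<Union>m\<in>supp (v b). {\<kappa>. \<rho> \<kappa> (cf (v b) m) \<noteq> 0})"
  have fin: "finite A" "finite L"
    unfolding A_def L_def using FM_finite[OF v] \<rho>_finite by auto
  have Apol: "mon \<alpha> \<kappa> \<in> pol n" if \<alpha>: "\<alpha> \<in> A" for \<alpha> and \<kappa> :: 'k
  proof -
    obtain b m where "m \<in> supp (v b)" "\<alpha> = mmod q m" using \<alpha> unfolding A_def by blast
    then show ?thesis using FM_pol[OF v, of b] keys_mmod[of q m] by (intro pol_single) (auto simp: pol_iff)
  qed
  have N_sum: "sum f X \<in> N" if "\<And>x. x \<in> X \<Longrightarrow> f x \<in> N" for f and X :: "'b set"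
    using that
  proof (induction X rule: infinite_finite_induct)
    case (insert x X)
    show ?case unfolding sum.insert[OF insert(1,2)] using insert by (intro add) auto
  qed (metis sum.infinite zero, metis sum.empty zero)
  have "v = (\<Sum>\<alpha>\<in>A. \<Sum>\<kappa>\<in>L. mon \<alpha> \<kappa> \<star> fr (tv \<alpha> \<kappa> v))"
  proof
    fix b
    have "(\<Sum>\<alpha>\<in>A. \<Sum>\<kappa>\<in>L. mon \<alpha> \<kappa> * tr \<alpha> \<kappa> (v b) ^ q) = v b"
    proof (cases "v b = 0")
      case True
      then show ?thesis using q_pos by (simp add: power_0_left)
    next
      case False
      then show ?thesis by (intro tr_expand fin) (auto simp: A_def L_def)
    qed
    then show "v b = (\<Sum>\<alpha>\<in>A. \<Sum>\<kappa>\<in>L. mon \<alpha> \<kappa> \<star> fr (tv \<alpha> \<kappa> v)) b"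
      by (simp add: sum_apply pointwise fr_def tv_def)
  qed
  moreover have "\<dots> \<in> N"
    by (intro N_sum scale Apol N)
  ultimately show ?thesis by simp
qed

text \<open>The last claim carries exactness at the augmentation: the coordinates of a member of the
  Frobenius power lie in \<open>I\<close>, because those of a multiple of \<open>f ^ q\<close> are
  multiples of \<open>f\<close>.\<close>

lemma frobenius_power_hideal:
  assumes "hideal n I"
  shows "hideal n (frobenius_power (poly_ring n) I q)"
    and "f \<in> I \<Longrightarrow> f ^ q \<in> frobenius_power (poly_ring n) I q"
    and "f \<in> frobenius_power (poly_ring n) I q \<Longrightarrow> tr \<alpha> \<kappa> f \<in> I"
proof -
  interpret cring "poly_ring n :: ('k mpoly, 'k mpoly) gmodule" by (rule poly_ring_cring)
  let ?S = "{f ^ q |f. f \<in> I}"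
  have J: "frobenius_power (poly_ring n) I q = Idl\<^bsub>poly_ring n\<^esub> ?S"
    by (simp add: frobenius_power_def poly_ring_pow)
  have S: "?S \<subseteq> pol n" using assms by (auto simp: hideal_def intro: pol_power)
  have self: "f ^ q \<in> Idl\<^bsub>poly_ring n\<^esub> ?S" if "f \<in> I" for f using genideal_self[of ?S] S that by auto
  note JD = ideal_poly_ringD[OF genideal_ideal[of ?S]]
  have "hcp n k s \<in> Idl\<^bsub>poly_ring n\<^esub> ?S" if s: "s \<in> ?S" for s k
  proof -
    obtain f where f: "f \<in> I" "s = f ^ q" using s by blast
    then have fp: "f \<in> pol n" using assms by (auto simp: hideal_def)
    let ?L = "{l. hcp n l f \<noteq> 0}"
    \<comment> \<open>By additivity of the \<open>q\<close>-th power, the components of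
      \<open>f ^ q\<close> are the \<open>q\<close>-th powers of the components of \<open>f\<close>,
      which lie in \<open>I\<close> as well.\<close>
    have "s = (\<Sum>l\<in>?L. hcp n l f ^ q)"
      unfolding f(2) using sum_hcp[OF hcp_finite subset_refl, of n f] pow_sum[of "\<lambda>l. hcp n l f" ?L] by simp
    then have "hcp n k s = (\<Sum>l\<in>?L. hcp n k (hcp n l f ^ q))" by (simp add: hcp_sum)
    moreover have "hcp n k (hcp n l f ^ q) \<in> Idl\<^bsub>poly_ring n\<^esub> ?S" for l
    proof -
      have "hcp n l f \<in> I" using f(1) assms by (auto simp: hideal_def)
      then show ?thesis
        using self JD(2) S hcp_of_hpol[OF hpol_power[OF hcp_hpol[OF fp, of l], of q], of k] by simp
    qed
    then have "(\<Sum>l\<in>X. hcp n k (hcp n l f ^ q)) \<in> Idl\<^bsub>poly_ring n\<^esub> ?S" for X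
      by (induction X rule: infinite_finite_induct) (use JD(2,3) S in auto)
    ultimately show ?thesis by simp
  qed
  then show "hideal n (frobenius_power (poly_ring n) I q)" unfolding J by (rule hideal_genideal[OF S])
  show "f \<in> I \<Longrightarrow> f ^ q \<in> frobenius_power (poly_ring n) I q" unfolding J by (rule self)
  have ID: "0 \<in> I" "\<And>f g. f \<in> I \<Longrightarrow> g \<in> I \<Longrightarrow> f + g \<in> I" "\<And>r f. r \<in> pol n \<Longrightarrow> f \<in> I \<Longrightarrow> r * f \<in> I"
    using assms by (auto simp: hideal_def)
  \<comment> \<open>The multiplier \<open>r\<close> makes this set an ideal: \<open>tr\<close> is
    linear only over \<open>q\<close>-th powers, so the condition on \<open>f\<close> alone would
    not visibly be stable under multiplication.\<close>
  have "ideal {f \<in> pol n. \<forall>r\<in>pol n. \<forall>\<alpha> \<kappa>. tr \<alpha> \<kappa> (r * f) \<in> I} (poly_ring n)" (is "ideal ?Y _")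
  proof (rule ideal_poly_ringI)
    show "r * f \<in> ?Y" if "r \<in> pol n" "f \<in> ?Y" for r f :: "'k mpoly"
      using that pol_mult[of _ n r] by (auto simp: pol_mult mult.assoc[symmetric])
  qed (auto simp: ID pol_add tr_add distrib_left)
  moreover have "?S \<subseteq> ?Y"
  proof
    fix s assume "s \<in> ?S"
    then obtain f where f: "f \<in> I" "s = f ^ q" by blast
    have "tr \<alpha> \<kappa> (r * s) \<in> I" if "r \<in> pol n" for r \<alpha> \<kappa>
      using ID(3)[OF tr_pol[OF that] f(1)] tr_semilinear[of \<alpha> \<kappa> f r] f(2) by (simp add: mult.commute)
    then show "s \<in> ?Y" using S \<open>s \<in> ?S\<close> by blast
  qed
  ultimately have "Idl\<^bsub>poly_ring n\<^esub> ?S \<subseteq> ?Y" by (rule genideal_minimal)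
  then show "tr \<alpha> \<kappa> f \<in> I" if "f \<in> frobenius_power (poly_ring n) I q"
  proof -
    have "f \<in> ?Y" using that \<open>Idl\<^bsub>poly_ring n\<^esub> ?S \<subseteq> ?Y\<close> unfolding J by blast
    then have "tr \<alpha> \<kappa> (1 * f) \<in> I" using pol_one by blast
    then show ?thesis by simp
  qed
qed

text \<open>Flatness of the Frobenius: applying it to the matrices of a resolution preserves exactness, because
  the maps \<open>tv\<close> turn a relation over the twisted matrix into relations over the original one.\<close>

theorem frobenius_cres:
  assumes I: "hideal n I" and P: "cres n I B \<delta> d" and min: "minimal_cres n B d"
  defines "d' \<equiv> \<lambda>i. ext (\<lambda>b. fr (d i (bv b)))"
  shows "cres n (frobenius_power (poly_ring n) I q) B (\<lambda>i b. int q * \<delta> i b) d'"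
    and "minimal_cres n B d'"
proof -
  let ?J = "frobenius_power (poly_ring n) I q"
  note J = frobenius_power_hideal[OF I]
  have dl: "glin n (B (Suc i)) (\<delta> (Suc i)) (B i) (\<delta> i) (d i)" for i by (rule cres_glin[OF P])
  have d'l: "glin n (B (Suc i)) (\<lambda>b. int q * \<delta> (Suc i) b) (B i) (\<lambda>b. int q * \<delta> i b) (d' i)" for i
    unfolding d'_def by (rule glin_ext, rule fr_FH, rule glin_FH[OF dl], rule FH_bv)
  have d'fr: "d' i (fr v) = fr (d i v)" if "v \<in> FM n (B (Suc i))" for i v
    unfolding d'_def glin_eq_ext[OF dl that] by (rule fr_ext[OF that, symmetric])
  have tvd': "tv \<alpha> \<kappa> (d' i v) = d i (tv \<alpha> \<kappa> v)" if "v \<in> FM n (B (Suc i))" for i v \<alpha> \<kappa>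
    unfolding d'_def glin_eq_ext[OF dl tv_FM[OF that]] by (rule tv_ext[OF that])
  have tvJ: "tv \<alpha> \<kappa> v \<in> auxJ n I i" if "v \<in> auxJ n ?J i" for v i \<alpha> \<kappa>
    using that J(3) tv_FM by (auto simp: auxJ_def tv_def fun_eq_iff pointwise split: if_splits)
  have frJ: "fr v \<in> auxJ n ?J i" if "v \<in> auxJ n I i" for v i
    using that J(2) fr_FM q_pos
    by (auto simp: auxJ_def fr_def fun_eq_iff pointwise power_0_left split: if_splits)
  have exact1: "\<exists>u\<in>FM n (B (Suc (Suc i))). v = d' (Suc i) u"
    if v: "v \<in> FM n (B (Suc i))" "d' i v \<in> auxJ n ?J i" for i v
  proof -
    \<comment> \<open>The image of the twisted differential is a submodule, so it suffices to reach
      the vectors of \<open>q\<close>-th powers built from the coordinates of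
      \<open>v\<close>.\<close>
    let ?N = "{x. \<exists>u\<in>FM n (B (Suc (Suc i))). x = d' (Suc i) u}"
    have "v \<in> ?N"
    proof (rule submodule_by_coordinates[OF v(1)])
      have "0 = d' (Suc i) 0" using glin_zero[OF d'l] by simp
      then show "0 \<in> ?N" using FM_zero by blast
    next
      fix x y assume "x \<in> ?N" "y \<in> ?N"
      then obtain u w where u: "u \<in> FM n (B (Suc (Suc i)))" "x = d' (Suc i) u"
        and w: "w \<in> FM n (B (Suc (Suc i)))" "y = d' (Suc i) w" by blast
      have "x + y = d' (Suc i) (u + w)" using glin_add[OF d'l u(1) w(1)] u(2) w(2) by simp
      then show "x + y \<in> ?N" using FM_add[OF u(1) w(1)] by blast
    next
      fix r :: "'k mpoly" and x assume r: "r \<in> pol n" and "x \<in> ?N"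
      then obtain u where u: "u \<in> FM n (B (Suc (Suc i)))" "x = d' (Suc i) u" by blast
      have "r \<star> x = d' (Suc i) (r \<star> u)" using glin_vscale[OF d'l r u(1)] u(2) by simp
      then show "r \<star> x \<in> ?N" using FM_vscale[OF r u(1)] by blast
    next
      fix \<alpha> \<kappa>
      \<comment> \<open>The coordinates of a twisted cycle are cycles of the original complex. A
        preimage \<open>u\<close> there yields the preimage \<open>fr u\<close> of the
        \<open>q\<close>-th power.\<close>
      have "d i (tv \<alpha> \<kappa> v) \<in> auxJ n I i" using tvJ[OF v(2)] tvd'[OF v(1)] by simp
      then obtain u where u: "u \<in> FM n (B (Suc (Suc i)))" "tv \<alpha> \<kappa> v = d (Suc i) u"
        using cres_exact[OF P tv_FM[OF v(1)]] by blast
      then have "fr (tv \<alpha> \<kappa> v) = d' (Suc i) (fr u)" using d'fr by simp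
      then show "fr (tv \<alpha> \<kappa> v) \<in> ?N" using fr_FM[OF u(1)] by blast
    qed
    then show ?thesis by blast
  qed
  have exact2: "d' i (d' (Suc i) u) \<in> auxJ n ?J i" if u: "u \<in> FM n (B (Suc (Suc i)))" for i u
  proof -
    let ?dd = "\<lambda>x. d' i (d' (Suc i) x)"
    have dd: "glin n (B (Suc (Suc i))) (\<lambda>b. int q * \<delta> (Suc (Suc i)) b) (B i) (\<lambda>b. int q * \<delta> i b) ?dd"
      by (rule glin_comp[OF d'l d'l])
    let ?N = "{x \<in> FM n (B (Suc (Suc i))). ?dd x \<in> auxJ n ?J i}"
    have "gsub n (B (Suc (Suc i))) (\<lambda>b. int q * \<delta> (Suc (Suc i)) b) ?N"
      by (rule gsub_preimage[OF J(1) dd])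
    note N = gsub_zero[OF this] gsub_add[OF this] gsub_vscale[OF this]
    have "u \<in> ?N"
    proof (rule submodule_by_coordinates[OF u N])
      fix \<alpha> \<kappa>
      note tu = tv_FM[OF u, of \<alpha> \<kappa>]
      \<comment> \<open>On \<open>q\<close>-th powers both twisted differentials commute with
        \<open>fr\<close>, which reduces the claim to the original complex.\<close>
      have "?dd (fr (tv \<alpha> \<kappa> u)) = fr (d i (d (Suc i) (tv \<alpha> \<kappa> u)))"
        using d'fr[OF tu] d'fr[OF glin_FM[OF dl tu]] by simp
      then show "fr (tv \<alpha> \<kappa> u) \<in> ?N"
        using frJ[OF cres_complex[OF P tu]] fr_FM[OF tu] by simp
    qed
    then show ?thesis by blast
  qed
  have aug: "\<exists>u\<in>FM n (B 1). v - d' 0 u \<in> auxJ n ?J 0" if v: "v \<in> FM n {0}" for v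
  proof -
    let ?N = "{x. \<exists>u\<in>FM n (B 1). x - d' 0 u \<in> auxJ n ?J 0}"
    have d'0: "glin n (B 1) (\<lambda>b. int q * \<delta> 1 b) (B 0) (\<lambda>b. int q * \<delta> 0 b) (d' 0)"
      using d'l[of 0] by simp
    have "v \<in> ?N"
    proof (rule submodule_by_coordinates[OF v])
      have "0 - d' 0 0 \<in> auxJ n ?J 0" using glin_zero[OF d'0] auxJ_zero[OF J(1)] by simp
      then show "0 \<in> ?N" using FM_zero by blast
    next
      fix x y assume "x \<in> ?N" "y \<in> ?N"
      then obtain u w where u: "u \<in> FM n (B 1)" "x - d' 0 u \<in> auxJ n ?J 0"
        and w: "w \<in> FM n (B 1)" "y - d' 0 w \<in> auxJ n ?J 0" by blast
      have eq: "x + y - d' 0 (u + w) = (x - d' 0 u) + (y - d' 0 w)"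
        using glin_add[OF d'0 u(1) w(1)] by simp
      have "x + y - d' 0 (u + w) \<in> auxJ n ?J 0" unfolding eq by (rule auxJ_add[OF J(1) u(2) w(2)])
      then show "x + y \<in> ?N" using FM_add[OF u(1) w(1)] by blast
    next
      fix r :: "'k mpoly" and x assume r: "r \<in> pol n" and "x \<in> ?N"
      then obtain u where u: "u \<in> FM n (B 1)" "x - d' 0 u \<in> auxJ n ?J 0" by blast
      have eq: "r \<star> x - d' 0 (r \<star> u) = r \<star> (x - d' 0 u)"
        using glin_vscale[OF d'0 r u(1)] by (simp add: vscale_diff)
      have "r \<star> x - d' 0 (r \<star> u) \<in> auxJ n ?J 0" unfolding eq by (rule auxJ_vscale[OF J(1) r u(2)])
      then show "r \<star> x \<in> ?N" using FM_vscale[OF r u(1)] by blast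
    next
      fix \<alpha> \<kappa>
      obtain u where u: "u \<in> FM n (B 1)" "tv \<alpha> \<kappa> v - d 0 u \<in> auxJ n I 0"
        using cres_aug[OF P tv_FM[OF v]] by blast
      have eq: "fr (tv \<alpha> \<kappa> v) - d' 0 (fr u) = fr (tv \<alpha> \<kappa> v - d 0 u)"
        using d'fr[of u 0] u(1) by (simp add: fr_diff)
      have "fr (tv \<alpha> \<kappa> v) - d' 0 (fr u) \<in> auxJ n ?J 0" unfolding eq by (rule frJ[OF u(2)])
      then show "fr (tv \<alpha> \<kappa> v) \<in> ?N" using fr_FM[OF u(1)] by blast
    qed
    then show ?thesis by blast
  qed
  show "cres n ?J B (\<lambda>i b. int q * \<delta> i b) d'"
    unfolding cres_def
  proof (intro conjI allI ballI)
    show "d' (Suc i) ` FM n (B (Suc (Suc i))) = {v \<in> FM n (B (Suc i)). d' i v \<in> auxJ n ?J i}" for i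
      using exact1 exact2 glin_FM[OF d'l] by blast
  qed (use cres_0[OF P] d'l aug in auto)
  show "minimal_cres n B d'"
    unfolding minimal_cres_def
  proof (intro allI ballI)
    fix i and u :: "'k pvec" assume u: "u \<in> FM n (B (Suc (Suc i)))"
    \<comment> \<open>Vanishing of constant coefficients is a linear condition, and on vectors of
      \<open>q\<close>-th powers the constant coefficients are \<open>q\<close>-th powers of the
      original ones, which are zero.\<close>
    let ?N = "{x \<in> FM n (B (Suc (Suc i))). ev (d' (Suc i) x) = 0}"
    have "u \<in> ?N"
    proof (rule submodule_by_coordinates[OF u])
      show "0 \<in> ?N" using glin_zero[OF d'l] by simp
      show "x + y \<in> ?N" if "x \<in> ?N" "y \<in> ?N" for x y
        using that by (simp add: FM_add glin_add[OF d'l] ev_add)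
      show "r \<star> x \<in> ?N" if "r \<in> pol n" "x \<in> ?N" for r x
        using that by (simp add: FM_vscale glin_vscale[OF d'l] ev_vscale fun_eq_iff pointwise)
      fix \<alpha> \<kappa>
      note tu = tv_FM[OF u, of \<alpha> \<kappa>]
      have "ev (d (Suc i) (tv \<alpha> \<kappa> u)) = 0" using min tu unfolding minimal_cres_def by blast
      then have "ev (fr (d (Suc i) (tv \<alpha> \<kappa> u))) = 0"
        using q_pos by (simp add: ev_def fr_def fun_eq_iff pointwise coeff_0_power power_0_left)
      then show "fr (tv \<alpha> \<kappa> u) \<in> ?N" using d'fr[OF tu] fr_FM[OF tu] by simp
    qed
    then show "ev (d' (Suc i) u) = 0" by blast
  qed
qed

end

section \<open>Cosets in additive groups given by type classes\<close>

definition addsub :: "'m::ab_group_add set \<Rightarrow> bool"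
  where "addsub N \<longleftrightarrow> 0 \<in> N \<and> (\<forall>x\<in>N. \<forall>y\<in>N. x + y \<in> N) \<and> (\<forall>x\<in>N. - x \<in> N)"

lemma coset_eq_image: "add M = (+) \<Longrightarrow> N +>\<^bsub>M\<^esub> x = (\<lambda>s. s + x) ` N"
  by (auto simp: a_r_coset_def')

lemma coset_eq_iff:
  fixes x y :: "'m::ab_group_add"
  assumes M: "add M = (+)" and N: "addsub N"
  shows "N +>\<^bsub>M\<^esub> x = N +>\<^bsub>M\<^esub> y \<longleftrightarrow> x - y \<in> N"
  unfolding coset_eq_image[OF M]
proof
  assume eq: "(\<lambda>s. s + x) ` N = (\<lambda>s. s + y) ` N"
  have "0 + x \<in> (\<lambda>s. s + x) ` N" using N by (auto simp: addsub_def simp del: add_0)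
  then obtain s where "s \<in> N" "x = s + y" unfolding eq by auto
  then show "x - y \<in> N" by simp
next
  have *: "(\<lambda>s. s + x) ` N \<subseteq> (\<lambda>s. s + y) ` N" if "x - y \<in> N" for x y :: 'm
  proof
    fix z assume "z \<in> (\<lambda>s. s + x) ` N"
    then obtain s where s: "s \<in> N" "z = s + x" by blast
    then have "z = (s + (x - y)) + y" "s + (x - y) \<in> N" using that N by (auto simp: addsub_def)
    then show "z \<in> (\<lambda>s. s + y) ` N" by blast
  qed
  assume xy: "x - y \<in> N"
  then have "- (x - y) \<in> N" using N unfolding addsub_def by blast
  then have "y - x \<in> N" by simp
  then show "(\<lambda>s. s + x) ` N = (\<lambda>s. s + y) ` N" using *[OF xy] *[of y x] by blast
qed

lemma set_add_coset:
  fixes x y :: "'m::ab_group_add"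
  assumes M: "add M = (+)" and N: "addsub N"
  shows "(N +>\<^bsub>M\<^esub> x) <+>\<^bsub>M\<^esub> (N +>\<^bsub>M\<^esub> y) = N +>\<^bsub>M\<^esub> (x + y)"
  unfolding coset_eq_image[OF M] set_add_def' M
proof (intro equalityI subsetI)
  fix z assume "z \<in> (\<Union>h\<in>(\<lambda>s. s + x) ` N. \<Union>k\<in>(\<lambda>s. s + y) ` N. {h + k})"
  then obtain s t where st: "s \<in> N" "t \<in> N" "z = (s + x) + (t + y)" by blast
  then have "z = (s + t) + (x + y)" by (simp add: ac_simps)
  moreover have "s + t \<in> N" using st N by (auto simp: addsub_def)
  ultimately show "z \<in> (\<lambda>s. s + (x + y)) ` N" by blast
next
  fix z assume "z \<in> (\<lambda>s. s + (x + y)) ` N"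
  then obtain s where s: "s \<in> N" "z = s + (x + y)" by blast
  then have "z = (s + x) + (0 + y)" "0 \<in> N" using N by (auto simp: addsub_def ac_simps)
  then show "z \<in> (\<Union>h\<in>(\<lambda>s. s + x) ` N. \<Union>k\<in>(\<lambda>s. s + y) ` N. {h + k})" using s(1) by blast
qed

text \<open>Scalar multiplication on \<open>quot_module\<close> is a union over all representatives.
  The cosets in this union coincide once \<open>sc\<close> maps \<open>N\<close> into itself and is
  additive, so the union is one coset.\<close>

lemma smult_coset:
  fixes x :: "'m::ab_group_add"
  assumes M: "add M = (+)" and N: "addsub N"
    and sc: "\<And>s. s \<in> N \<Longrightarrow> sc s \<in> N" "\<And>s. s \<in> N \<Longrightarrow> sc (s + x) = sc s + sc x"
  shows "(\<Union>y\<in>N +>\<^bsub>M\<^esub> x. N +>\<^bsub>M\<^esub> sc y) = N +>\<^bsub>M\<^esub> sc x"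
proof -
  have "N +>\<^bsub>M\<^esub> sc y = N +>\<^bsub>M\<^esub> sc x" if y: "y \<in> N +>\<^bsub>M\<^esub> x" for y
  proof -
    obtain s where s: "s \<in> N" "y = s + x" using y unfolding coset_eq_image[OF M] by blast
    then show ?thesis unfolding coset_eq_iff[OF M N] using sc by simp
  qed
  moreover have "0 + x \<in> N +>\<^bsub>M\<^esub> x"
    unfolding coset_eq_image[OF M] using N by (intro imageI) (simp add: addsub_def)
  ultimately show ?thesis by blast
qed

section \<open>Tensoring a graded free module with the residue field\<close>

lemma free_module_simps [simp]:
  "carrier (free_module (poly_ring n) X) = FM n X"
  "add (free_module (poly_ring n) X) = (+)"
  "zero (free_module (poly_ring n) X) = 0"
  "smult (free_module (poly_ring n) X) = (\<star>)"
  by (auto simp: free_module_def FM_def fun_eq_iff pointwise)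

lemma basis_vec_poly_ring [simp]: "basis_vec (poly_ring n) b = bv b"
  by (auto simp: basis_vec_def bv_def)

lemma gfree_simps [simp]:
  "carrier (gfree (poly_ring n) B \<delta>) = FM n B"
  "add (gfree (poly_ring n) B \<delta>) = (+)"
  "zero (gfree (poly_ring n) B \<delta>) = 0"
  "smult (gfree (poly_ring n) B \<delta>) = (\<star>)"
  "hcomp (gfree (poly_ring n) B \<delta>) j = FH n B \<delta> j"
proof -
  show "carrier (gfree (poly_ring n) B \<delta>) = FM n B"
    using free_module_simps(1)[of n B] by (simp add: gfree_def module.defs gmodule.defs)
  show "add (gfree (poly_ring n) B \<delta>) = (+)"
    using free_module_simps(2)[of n B] by (simp add: gfree_def module.defs gmodule.defs)
  show "zero (gfree (poly_ring n) B \<delta>) = 0"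
    using free_module_simps(3)[of n B] by (simp add: gfree_def module.defs gmodule.defs)
  show "smult (gfree (poly_ring n) B \<delta>) = (\<star>)"
    using free_module_simps(4)[of n B] by (simp add: gfree_def module.defs gmodule.defs)
  show "hcomp (gfree (poly_ring n) B \<delta>) j = FH n B \<delta> j"
    by (simp add: gfree_def module.defs gmodule.defs FH_def)
qed

lemma residue_field_simps [simp]:
  "carrier residue_field = UNIV" "add residue_field = (+)" "zero residue_field = 0"
  "smult residue_field = (\<lambda>f c. cf f 0 * c)"
  "hcomp residue_field j = (if j = 0 then UNIV else {0})"
  by (simp_all add: residue_field_def)

lemma free_module_module: "module (poly_ring n) (free_module (poly_ring n) X)"
proof (rule moduleI)
  show "abelian_group (free_module (poly_ring n) X)"
    by (rule abelian_groupI) (auto intro: FM_add FM_uminus bexI[of _ "- _"] simp: algebra_simps)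
qed (auto simp: poly_ring_cring FM_vscale vscale_add_left vscale_add_right vscale_assoc)

lemma free_module_minus:
  fixes x y :: "'i \<Rightarrow> 'k::field mpoly"
  assumes "x \<in> FM n X" "y \<in> FM n X"
  shows "x \<ominus>\<^bsub>free_module (poly_ring n) X\<^esub> y = x - y"
proof -
  interpret abelian_group "free_module (poly_ring n) X :: ('k mpoly, 'i \<Rightarrow> 'k mpoly) module"
    using free_module_module by (rule module.axioms)
  have "\<ominus>\<^bsub>free_module (poly_ring n) X\<^esub> y = - y"
    using minus_equality[of "- y" y] assms(2) FM_uminus[OF assms(2)] by simp
  then show ?thesis by (simp add: a_minus_def)
qed

type_synonym 'k tvec = "'k \<times> 'k pvec \<Rightarrow> 'k mpoly"

abbreviation tpairs :: "nat \<Rightarrow> nat set \<Rightarrow> ('k::field \<times> 'k pvec) set"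
  where "tpairs n B \<equiv> UNIV \<times> FM n B"

abbreviation trel :: "nat \<Rightarrow> nat set \<Rightarrow> (nat \<Rightarrow> int) \<Rightarrow> 'k::field tvec set"
  where "trel n B \<delta> \<equiv> tensor_rels (poly_ring n) residue_field (gfree (poly_ring n) B \<delta>)"

abbreviation tspan :: "nat \<Rightarrow> nat set \<Rightarrow> (nat \<Rightarrow> int) \<Rightarrow> 'k::field tvec set"
  where "tspan n B \<delta> \<equiv> tensor_rel_span (poly_ring n) residue_field (gfree (poly_ring n) B \<delta>)"

abbreviation tens :: "nat \<Rightarrow> nat set \<Rightarrow> (nat \<Rightarrow> int) \<Rightarrow> ('k::field mpoly, 'k tvec set) module"
  where "tens n B \<delta> \<equiv> tensor (poly_ring n) residue_field (gfree (poly_ring n) B \<delta>)"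

text \<open>The class of 1 \<otimes> v. Scalars of the residue field are constants of R and can be
  moved to the right factor, so these classes exhaust the tensor product.\<close>

definition tau :: "nat \<Rightarrow> nat set \<Rightarrow> (nat \<Rightarrow> int) \<Rightarrow> 'k::field pvec \<Rightarrow> 'k tvec set"
  where "tau n B \<delta> v = pure_tensor (poly_ring n) residue_field (gfree (poly_ring n) B \<delta>) 1 v"

lemma bv_pair_FM: "v \<in> FM n B \<Longrightarrow> bv (c, v) \<in> FM n (tpairs n B)"
  by (rule FM_bv) simp

lemma trel_cases:
  assumes "x \<in> trel n B \<delta>"
  obtains (add1) c c' v where "v \<in> FM n B" "x = bv (c + c', v) - (bv (c, v) + bv (c', v))"
  | (add2) c v v' where "v \<in> FM n B" "v' \<in> FM n B" "x = bv (c, v + v') - (bv (c, v) + bv (c, v'))"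
  | (smult1) r c v where "r \<in> pol n" "v \<in> FM n B" "x = bv (cf r 0 * c, v) - r \<star> bv (c, v)"
  | (smult2) r c v where "r \<in> pol n" "v \<in> FM n B" "x = bv (c, r \<star> v) - r \<star> bv (c, v)"
  using assms unfolding tensor_rels_def Let_def
  by (auto simp: free_module_minus bv_pair_FM FM_add FM_vscale)

lemma trel_intros:
  assumes "v \<in> FM n B" "v' \<in> FM n B" "r \<in> pol n"
  shows "bv (c + c', v) - (bv (c, v) + bv (c', v)) \<in> trel n B \<delta>"
    and "bv (c, v + v') - (bv (c, v) + bv (c, v')) \<in> trel n B \<delta>"
    and "bv (cf r 0 * c, v) - r \<star> bv (c, v) \<in> trel n B \<delta>"
    and "bv (c, r \<star> v) - r \<star> bv (c, v) \<in> trel n B \<delta>"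
proof -
  let ?F = "free_module (poly_ring n) (tpairs n B)"
  have "bv (c + c', v) \<ominus>\<^bsub>?F\<^esub> (bv (c, v) + bv (c', v)) \<in> trel n B \<delta>"
    "bv (c, v + v') \<ominus>\<^bsub>?F\<^esub> (bv (c, v) + bv (c, v')) \<in> trel n B \<delta>"
    "bv (cf r 0 * c, v) \<ominus>\<^bsub>?F\<^esub> r \<star> bv (c, v) \<in> trel n B \<delta>"
    "bv (c, r \<star> v) \<ominus>\<^bsub>?F\<^esub> r \<star> bv (c, v) \<in> trel n B \<delta>"
    unfolding tensor_rels_def Let_def using assms by (simp_all, blast+)
  then show "bv (c + c', v) - (bv (c, v) + bv (c', v)) \<in> trel n B \<delta>"
    "bv (c, v + v') - (bv (c, v) + bv (c, v')) \<in> trel n B \<delta>"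
    "bv (cf r 0 * c, v) - r \<star> bv (c, v) \<in> trel n B \<delta>"
    "bv (c, r \<star> v) - r \<star> bv (c, v) \<in> trel n B \<delta>"
    using assms by (simp_all add: free_module_minus bv_pair_FM FM_add FM_vscale)
qed

lemma trel_FM: "trel n B \<delta> \<subseteq> FM n (tpairs n B)"
proof
  fix x :: "'a tvec" assume "x \<in> trel n B \<delta>"
  then show "x \<in> FM n (tpairs n B)"
    by (cases rule: trel_cases) (auto intro!: FM_diff FM_add FM_vscale bv_pair_FM)
qed

lemma
  fixes x y :: "'k::field tvec"
  shows tspan_FM: "x \<in> tspan n B \<delta> \<Longrightarrow> x \<in> FM n (tpairs n B)"
    and tspan_zero: "(0 :: 'k tvec) \<in> tspan n B \<delta>"
    and tspan_add: "x \<in> tspan n B \<delta> \<Longrightarrow> y \<in> tspan n B \<delta> \<Longrightarrow> x + y \<in> tspan n B \<delta>"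
    and tspan_vscale: "r \<in> pol n \<Longrightarrow> x \<in> tspan n B \<delta> \<Longrightarrow> r \<star> x \<in> tspan n B \<delta>"
    and tspan_base: "x \<in> trel n B \<delta> \<Longrightarrow> x \<in> tspan n B \<delta>"
proof -
  let ?F = "free_module (poly_ring n) (tpairs n B) :: ('k mpoly, 'k tvec) module"
  interpret F: Module.module "poly_ring n" ?F by (rule free_module_module)
  have sp: "tspan n B \<delta> = F.span (trel n B \<delta>)" by (simp add: tensor_rel_span_def)
  have sub: "submodule (poly_ring n) (F.span (trel n B \<delta>)) ?F"
    by (rule F.span_is_submodule) (simp add: trel_FM)
  show "x \<in> tspan n B \<delta> \<Longrightarrow> x \<in> FM n (tpairs n B)"
    using submodule.subset[OF sub] sp by auto
  show "(0 :: 'k tvec) \<in> tspan n B \<delta>" using submodule.zero_closed[OF sub] sp by simp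
  show "x \<in> tspan n B \<delta> \<Longrightarrow> y \<in> tspan n B \<delta> \<Longrightarrow> x + y \<in> tspan n B \<delta>"
    using submodule.m_closed[OF sub, of x y] sp by simp
  show "r \<in> pol n \<Longrightarrow> x \<in> tspan n B \<delta> \<Longrightarrow> r \<star> x \<in> tspan n B \<delta>"
    using submodule.smult_closed[OF sub, of r x] sp by simp
  show "x \<in> trel n B \<delta> \<Longrightarrow> x \<in> tspan n B \<delta>"
    using F.in_own_span[of "trel n B \<delta>"] trel_FM sp by auto
qed

lemma tspan_uminus: "x \<in> tspan n B \<delta> \<Longrightarrow> - x \<in> tspan n B \<delta>"
  using tspan_vscale[of "- 1" n x B \<delta>] by (simp add: vscale_uminus_one pol_uminus)

lemma tspan_addsub: "addsub (tspan n B \<delta>)"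
  using tspan_zero tspan_add tspan_uminus unfolding addsub_def by blast

lemma tspan_trans: "x - y \<in> tspan n B \<delta> \<Longrightarrow> y - z \<in> tspan n B \<delta> \<Longrightarrow> x - z \<in> tspan n B \<delta>"
  using tspan_add[of "x - y" n B \<delta> "y - z"] by simp

lemma tspan_sym: "x - y \<in> tspan n B \<delta> \<Longrightarrow> y - x \<in> tspan n B \<delta>"
  using tspan_uminus[of "x - y"] by simp

lemma tspan_minimal:
  assumes "Y \<subseteq> FM n (tpairs n B)" "0 \<in> Y" "\<And>x y. x \<in> Y \<Longrightarrow> y \<in> Y \<Longrightarrow> x + y \<in> Y"
    and "\<And>r x. r \<in> pol n \<Longrightarrow> x \<in> Y \<Longrightarrow> r \<star> x \<in> Y" "trel n B \<delta> \<subseteq> Y"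
  shows "tspan n B \<delta> \<subseteq> Y"
proof -
  let ?F = "free_module (poly_ring n) (tpairs n B)"
  interpret F: Module.module "poly_ring n" ?F by (rule free_module_module)
  have "submodule (poly_ring n) Y ?F"
    by (rule submodule.intro) (use assms free_module_module in auto)
  then have "F.span (trel n B \<delta>) \<subseteq> Y" by (rule F.span_is_subset[OF assms(5)])
  then show ?thesis by (simp add: tensor_rel_span_def)
qed

text \<open>The isomorphism \<open>c \<otimes> v \<mapsto> c \<cdot> ev v\<close>, on representatives.\<close>

definition tev :: "'k::field tvec \<Rightarrow> nat \<Rightarrow> 'k"
  where "tev w = (\<Sum>x | w x \<noteq> 0. (\<lambda>b. cf (w x) 0 * (fst x * ev (snd x) b)))"

lemma tev_sum:
  assumes "finite S" "{x. w x \<noteq> 0} \<subseteq> S"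
  shows "tev w = (\<Sum>x\<in>S. (\<lambda>b. cf (w x) 0 * (fst x * ev (snd x) b)))"
  unfolding tev_def by (rule sum.mono_neutral_left) (use assms in \<open>auto simp: fun_eq_iff pointwise\<close>)

lemma tev_add:
  assumes "u \<in> FM n X" "w \<in> FM n X"
  shows "tev (u + w) = tev u + tev w"
proof -
  let ?S = "{x. u x \<noteq> 0} \<union> {x. w x \<noteq> 0}"
  have S: "finite ?S" using assms FM_finite by auto
  have "tev (u + w) = (\<Sum>x\<in>?S. (\<lambda>b. cf ((u + w) x) 0 * (fst x * ev (snd x) b)))"
    by (rule tev_sum[OF S]) (auto simp: pointwise)
  also have "\<dots> = (\<Sum>x\<in>?S. (\<lambda>b. cf (u x) 0 * (fst x * ev (snd x) b)) + (\<lambda>b. cf (w x) 0 * (fst x * ev (snd x) b)))"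
    by (rule sum.cong[OF refl]) (auto simp: fun_eq_iff pointwise lookup_add algebra_simps)
  also have "\<dots> = tev u + tev w"
    unfolding sum.distrib using tev_sum[OF S, of u] tev_sum[OF S, of w] by auto
  finally show ?thesis .
qed

lemma tev_vscale:
  assumes "w \<in> FM n X"
  shows "tev (r \<star> w) = (\<lambda>b. cf r 0 * tev w b)"
proof -
  let ?S = "{x. w x \<noteq> 0}"
  have S: "finite ?S" using assms FM_finite by auto
  have "tev (r \<star> w) = (\<Sum>x\<in>?S. (\<lambda>b. cf ((r \<star> w) x) 0 * (fst x * ev (snd x) b)))"
    by (rule tev_sum[OF S]) (auto simp: pointwise)
  then show ?thesis
    unfolding tev_sum[OF S subset_refl]
    by (simp add: fun_eq_iff sum_apply pointwise coeff_0_mult sum_distrib_left mult.assoc)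
qed

lemma tev_zero [simp]: "tev 0 = 0"
  using tev_vscale[OF FM_zero, of 0] by (simp add: fun_eq_iff pointwise)

lemma tev_diff:
  assumes "u \<in> FM n X" "w \<in> FM n X"
  shows "tev (u - w) = tev u - tev w"
proof -
  have "tev u = tev (u - w) + tev w" using tev_add[OF FM_diff[OF assms] assms(2)] by simp
  then show ?thesis by simp
qed

lemma tev_bv: "tev (bv (c, v)) = (\<lambda>b. c * ev v b)"
  by (subst tev_sum[of "{(c, v)}"]) (auto simp: bv_apply)

text \<open>The assignment of \<open>c\<close> times \<open>ev v\<close> to the pair
  \<open>(c, v)\<close> is bilinear and compatible with both scalar actions, so it kills each kind
  of relation; hence \<open>tev\<close> is well defined on the tensor product.\<close>

lemma tspan_tev:
  assumes "x \<in> tspan n B \<delta>"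
  shows "tev x = 0"
proof -
  let ?Y = "{x \<in> FM n (tpairs n B). tev x = 0} :: 'a tvec set"
  have "tspan n B \<delta> \<subseteq> ?Y"
  proof (rule tspan_minimal)
    show "r \<star> x \<in> ?Y" if "r \<in> pol n" "x \<in> ?Y" for r and x :: "'a tvec"
      using that by (auto simp: FM_vscale tev_vscale fun_eq_iff pointwise)
    show "x + y \<in> ?Y" if "x \<in> ?Y" "y \<in> ?Y" for x y :: "'a tvec"
      using that by (auto simp: FM_add tev_add)
    show "trel n B \<delta> \<subseteq> ?Y"
    proof
      fix x :: "'a tvec" assume x: "x \<in> trel n B \<delta>"
      have ev: "tev x = 0"
        using x
      proof (cases rule: trel_cases)
        case (add1 c c' v)
        note p = bv_pair_FM[OF add1(1)]
        show ?thesis unfolding add1(2) tev_diff[OF p FM_add[OF p p]] tev_add[OF p p] tev_bv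
          by (simp add: fun_eq_iff pointwise algebra_simps)
      next
        case (add2 c v v')
        note p = bv_pair_FM[OF add2(1)] bv_pair_FM[OF add2(2)] bv_pair_FM[OF FM_add[OF add2(1,2)]]
        show ?thesis unfolding add2(3) tev_diff[OF p(3) FM_add[OF p(1,2)]] tev_add[OF p(1,2)] tev_bv ev_add
          by (simp add: fun_eq_iff pointwise algebra_simps)
      next
        case (smult1 r c v)
        note p = bv_pair_FM[OF smult1(2)]
        show ?thesis unfolding smult1(3) tev_diff[OF p FM_vscale[OF smult1(1) p]] tev_vscale[OF p] tev_bv
          by (simp add: fun_eq_iff pointwise algebra_simps)
      next
        case (smult2 r c v)
        note p = bv_pair_FM[OF smult2(2)] bv_pair_FM[OF FM_vscale[OF smult2(1,2)]]
        show ?thesis unfolding smult2(3) tev_diff[OF p(2) FM_vscale[OF smult2(1) p(1)]] tev_vscale[OF p(1)] tev_bv ev_vscale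
          by (simp add: fun_eq_iff pointwise algebra_simps)
      qed
      then show "x \<in> ?Y" using subsetD[OF trel_FM x] by simp
    qed
  qed auto
  then show ?thesis using assms by blast
qed

lemma bv_one_add: "v \<in> FM n B \<Longrightarrow> v' \<in> FM n B \<Longrightarrow> bv (1, v + v') - (bv (1, v) + bv (1, v')) \<in> tspan n B \<delta>"
  by (rule tspan_base, rule trel_intros(2)[OF _ _ pol_zero])

lemma bv_one_vscale: "r \<in> pol n \<Longrightarrow> v \<in> FM n B \<Longrightarrow> bv (c, r \<star> v) - r \<star> bv (c, v) \<in> tspan n B \<delta>"
  by (rule tspan_base, rule trel_intros(4)[OF _ FM_zero])

lemma bv_const_vscale: "r \<in> pol n \<Longrightarrow> v \<in> FM n B \<Longrightarrow> bv (cf r 0 * c, v) - r \<star> bv (c, v) \<in> tspan n B \<delta>"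
  by (rule tspan_base, rule trel_intros(3)[OF _ FM_zero])

lemma bv_zero_left:
  assumes "v \<in> FM n B"
  shows "bv (0, v) \<in> tspan n B \<delta>"
proof -
  have "bv (cf (0 :: 'a mpoly) 0 * 0, v) - 0 \<star> bv (0, v) \<in> tspan n B \<delta>"
    by (rule bv_const_vscale[OF pol_zero assms])
  then show ?thesis by simp
qed

lemma bv_zero_right: "bv (1, 0) \<in> tspan n B \<delta>"
  using bv_one_vscale[OF pol_zero FM_zero, of 1 n B \<delta>] by simp

text \<open>The constant polynomial \<open>c\<close> acts on the residue field as multiplication by
  \<open>c\<close>, hence c \<otimes> v = c(1 \<otimes> v) = 1 \<otimes> cv.\<close>

lemma bv_pair_to_one:
  assumes "v \<in> FM n B"
  shows "bv (c, v) - bv (1, mon 0 c \<star> v) \<in> tspan n B \<delta>"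
  using tspan_trans[OF bv_const_vscale[OF pol_const assms, of c 1] tspan_sym[OF bv_one_vscale[OF pol_const assms, of 1 c]]]
  by simp

lemma tensor_element:
  assumes "w \<in> FM n (tpairs n B)"
  shows "\<exists>v\<in>FM n B. w - bv (1, v) \<in> tspan n B \<delta>"
  using assms
proof (induction rule: FM_induct)
  case zero
  have "0 - bv (1, 0) \<in> tspan n B \<delta>" using tspan_uminus[OF bv_zero_right] by simp
  then show ?case using FM_zero by blast
next
  case (bv r x)
  obtain c v where x: "x = (c, v)" "v \<in> FM n B" using bv(2) by auto
  let ?v = "mon 0 c \<star> v"
  have v: "?v \<in> FM n B" by (rule FM_vscale[OF pol_const x(2)])
  have "r \<star> bv x - r \<star> bv (1, ?v) \<in> tspan n B \<delta>"
    using tspan_vscale[OF bv(1) bv_pair_to_one[OF x(2)]] unfolding x(1) by (simp add: vscale_diff)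
  from tspan_trans[OF this tspan_sym[OF bv_one_vscale[OF bv(1) v]]]
  show ?case using FM_vscale[OF bv(1) v] by blast
next
  case (add u w)
  obtain v v' where v: "v \<in> FM n B" "u - bv (1, v) \<in> tspan n B \<delta>"
    and v': "v' \<in> FM n B" "w - bv (1, v') \<in> tspan n B \<delta>" using add by blast
  have "(u + w) - (bv (1, v) + bv (1, v')) \<in> tspan n B \<delta>"
    using tspan_add[OF v(2) v'(2)] by (simp add: algebra_simps)
  from tspan_trans[OF this tspan_sym[OF bv_one_add[OF v(1) v'(1)]]]
  show ?case using FM_add[OF v(1) v'(1)] by blast
qed

text \<open>A coefficient \<open>r\<close> with zero constant term annihilates the residue field, so
  1 \<otimes> rb = r(1 \<otimes> b) = 0 for a basis vector b. This is the injectivity of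
  \<open>tev\<close>.\<close>

lemma bv_one_ev_zero:
  assumes v: "v \<in> FM n B" and e: "ev v = 0"
  shows "bv (1, v) \<in> tspan n B \<delta>"
proof -
  let ?Y = "{u \<in> FM n B. bv (1, u) \<in> tspan n B \<delta>}"
  have Y_add: "x + y \<in> ?Y" if "x \<in> ?Y" "y \<in> ?Y" for x y :: "'a pvec"
  proof -
    have "bv (1, x) + bv (1, y) \<in> tspan n B \<delta>" using that by (auto intro: tspan_add)
    from tspan_add[OF bv_one_add[of x n B y \<delta>] this] show ?thesis using that by (auto simp: FM_add)
  qed
  have Y_base: "r \<star> bv b \<in> ?Y" if r: "r \<in> pol n" "cf r 0 = 0" and b: "b \<in> B" for r :: "'a mpoly" and b
  proof -
    note bF = FM_bv[OF b, of n]
    have "r \<star> bv (1, bv b) - bv (cf r 0 * 1, bv b) \<in> tspan n B \<delta>"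
      by (rule tspan_sym[OF bv_const_vscale[OF r(1) bF]])
    from tspan_trans[OF bv_one_vscale[OF r(1) bF] this]
    have "bv (1, r \<star> bv b) - bv (0, bv b) \<in> tspan n B \<delta>" using r(2) by simp
    from tspan_add[OF this bv_zero_left[OF bF]] show ?thesis using FM_vscale[OF r(1) bF] by simp
  qed
  have Y_sum: "(\<Sum>b\<in>S. v b \<star> bv b) \<in> ?Y" if "finite S" "S \<subseteq> {b. v b \<noteq> 0}" for S
    using that
  proof (induction S)
    case empty
    show ?case unfolding sum.empty using bv_zero_right FM_zero by blast
  next
    case (insert b S)
    have "v b \<star> bv b \<in> ?Y"
      using insert FM_supp[OF v] e by (intro Y_base FM_pol[OF v]) (auto simp: ev_def fun_eq_iff pointwise)
    then show ?case unfolding sum.insert[OF insert(1,2)] using insert by (intro Y_add) auto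
  qed
  have "v \<in> ?Y" using Y_sum[OF FM_finite[OF v] subset_refl] FM_expand[OF FM_finite[OF v] subset_refl] by simp
  then show ?thesis by blast
qed

lemma tau_eq_coset: "tau n B \<delta> v = tspan n B \<delta> +>\<^bsub>free_module (poly_ring n) (tpairs n B)\<^esub> bv (1, v)"
  by (simp add: tau_def pure_tensor_def)

text \<open>The isomorphism of K \<otimes> F with F modulo the variables, in the form used from here
  on: equality of tensors is equality of constant coefficients.\<close>

lemma tau_eq_iff:
  assumes "u \<in> FM n B" "v \<in> FM n B"
  shows "tau n B \<delta> u = tau n B \<delta> v \<longleftrightarrow> ev u = ev v"
proof -
  have "tau n B \<delta> u = tau n B \<delta> v \<longleftrightarrow> bv (1, u) - bv (1, v) \<in> tspan n B \<delta>"
    unfolding tau_eq_coset by (rule coset_eq_iff) (simp_all add: tspan_addsub)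
  also have "\<dots> \<longleftrightarrow> ev u = ev v"
  proof
    assume "bv (1, u) - bv (1, v) \<in> tspan n B \<delta>"
    then have "tev (bv (1, u) - bv (1, v)) = 0" by (rule tspan_tev)
    then show "ev u = ev v"
      using assms by (simp add: tev_diff[OF bv_pair_FM bv_pair_FM] tev_bv)
  next
    assume "ev u = ev v"
    then have "bv (1, u - v) \<in> tspan n B \<delta>"
      using assms by (intro bv_one_ev_zero) (auto simp: FM_diff ev_diff)
    from tspan_add[OF bv_one_add[OF FM_diff[OF assms] assms(2)] this]
    show "bv (1, u) - bv (1, v) \<in> tspan n B \<delta>" by (simp add: algebra_simps)
  qed
  finally show ?thesis .
qed

lemma tau_of_element:
  assumes "w \<in> FM n (tpairs n B)"
  obtains v where "v \<in> FM n B" "tspan n B \<delta> +>\<^bsub>free_module (poly_ring n) (tpairs n B)\<^esub> w = tau n B \<delta> v"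
proof -
  obtain v where v: "v \<in> FM n B" "w - bv (1, v) \<in> tspan n B \<delta>" using tensor_element[OF assms] by blast
  have "tspan n B \<delta> +>\<^bsub>free_module (poly_ring n) (tpairs n B)\<^esub> w = tau n B \<delta> v"
    unfolding tau_eq_coset by (subst coset_eq_iff) (simp_all add: tspan_addsub v)
  then show ?thesis using that v by blast
qed

lemma tens_carrier: "carrier (tens n B \<delta>) = tau n B \<delta> ` FM n B"
proof -
  let ?F = "free_module (poly_ring n) (tpairs n B)"
  have "carrier (tens n B \<delta>) = (\<Union>w\<in>FM n (tpairs n B). {tspan n B \<delta> +>\<^bsub>?F\<^esub> w})"
    by (simp add: tensor_def quot_module_def A_RCOSETS_def')
  also have "\<dots> = tau n B \<delta> ` FM n B"
  proof (intro equalityI subsetI)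
    fix X assume "X \<in> (\<Union>w\<in>FM n (tpairs n B). {tspan n B \<delta> +>\<^bsub>?F\<^esub> w})"
    then obtain w where "w \<in> FM n (tpairs n B)" "X = tspan n B \<delta> +>\<^bsub>?F\<^esub> w" by blast
    then show "X \<in> tau n B \<delta> ` FM n B" using tau_of_element[of w n B \<delta>] by blast
  qed (auto simp: tau_eq_coset intro: bv_pair_FM)
  finally show ?thesis .
qed

lemma tens_add:
  assumes "u \<in> FM n B" "v \<in> FM n B"
  shows "tau n B \<delta> u \<oplus>\<^bsub>tens n B \<delta>\<^esub> tau n B \<delta> v = tau n B \<delta> (u + v)"
proof -
  let ?F = "free_module (poly_ring n) (tpairs n B)"
  have "tau n B \<delta> u \<oplus>\<^bsub>tens n B \<delta>\<^esub> tau n B \<delta> v = tspan n B \<delta> +>\<^bsub>?F\<^esub> (bv (1, u) + bv (1, v))"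
    unfolding tau_eq_coset tensor_def quot_module_def
    by (simp add: set_add_coset[OF free_module_simps(2) tspan_addsub])
  also have "\<dots> = tau n B \<delta> (u + v)"
    unfolding tau_eq_coset using bv_one_add[OF assms, of \<delta>]
    by (subst coset_eq_iff) (simp_all add: tspan_addsub tspan_sym)
  finally show ?thesis .
qed

lemma tens_smult:
  assumes "r \<in> pol n" "v \<in> FM n B"
  shows "r \<odot>\<^bsub>tens n B \<delta>\<^esub> tau n B \<delta> v = tau n B \<delta> (r \<star> v)"
proof -
  let ?F = "free_module (poly_ring n) (tpairs n B)"
  have "r \<odot>\<^bsub>tens n B \<delta>\<^esub> tau n B \<delta> v = tspan n B \<delta> +>\<^bsub>?F\<^esub> (r \<star> bv (1, v))"
    unfolding tau_eq_coset tensor_def quot_module_def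
    using smult_coset[OF free_module_simps(2) tspan_addsub, of n B \<delta> "\<lambda>x. r \<star> x" "bv (1, v)"]
      tspan_vscale[OF assms(1)] by (simp add: vscale_add_right)
  also have "\<dots> = tau n B \<delta> (r \<star> v)"
    unfolding tau_eq_coset using bv_one_vscale[OF assms, of 1 \<delta>]
    by (subst coset_eq_iff) (simp_all add: tspan_addsub tspan_sym)
  finally show ?thesis .
qed

lemma tens_zero: "\<zero>\<^bsub>tens n B \<delta>\<^esub> = tau n B \<delta> 0"
proof -
  let ?F = "free_module (poly_ring n) (tpairs n B)"
  have "\<zero>\<^bsub>tens n B \<delta>\<^esub> = tspan n B \<delta> +>\<^bsub>?F\<^esub> 0"
    unfolding tensor_def quot_module_def by (simp add: coset_eq_image)
  also have "\<dots> = tau n B \<delta> 0"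
    unfolding tau_eq_coset using tspan_uminus[OF bv_zero_right]
    by (subst coset_eq_iff) (simp_all add: tspan_addsub)
  finally show ?thesis .
qed

lemma pure_tensor_eq_tau:
  assumes "v \<in> FM n B"
  shows "pure_tensor (poly_ring n) residue_field (gfree (poly_ring n) B \<delta>) c v = tau n B \<delta> (mon 0 c \<star> v)"
  unfolding tau_eq_coset pure_tensor_def using bv_pair_to_one[OF assms, of c \<delta>]
  by (simp, subst coset_eq_iff) (simp_all add: tspan_addsub)

lemma gtensor_simps [simp]:
  "carrier (gtensor R M N) = carrier (tensor R M N)"
  "add (gtensor R M N) = add (tensor R M N)"
  "zero (gtensor R M N) = zero (tensor R M N)"
  "smult (gtensor R M N) = smult (tensor R M N)"
  "hcomp (gtensor R M N) j = generate (add_monoid (tensor R M N))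
    {pure_tensor R M N x y | x y a b. x \<in> hcomp M a \<and> y \<in> hcomp N b \<and> a + b = j}"
  by (simp_all add: gtensor_def module.defs gmodule.defs)

text \<open>The residue field is concentrated in degree 0, so pure tensors with a left factor of
  another degree are zero. The classes of homogeneous vectors are closed under sums and inverses, so
  \<open>generate\<close> adds nothing to them.\<close>

lemma tens_hcomp:
  fixes B :: "nat set" and \<delta> :: "nat \<Rightarrow> int"
  shows "hcomp (gtensor (poly_ring n) residue_field (gfree (poly_ring n) B \<delta>)) j =
    (tau n B \<delta> ` FH n B \<delta> j :: 'k::field tvec set set)"
  (is "?H = _")
proof -
  let ?G = "add_monoid (tens n B \<delta> :: ('k mpoly, 'k tvec set) module)"
  define P :: "'k tvec set set" where "P = {pure_tensor (poly_ring n) residue_field (gfree (poly_ring n) B \<delta>) x y | x y a b.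
      x \<in> hcomp residue_field a \<and> y \<in> hcomp (gfree (poly_ring n) B \<delta>) b \<and> a + b = j}"
  have H: "?H = generate ?G P" unfolding P_def by (rule gtensor_simps(5))
  have P: "P = tau n B \<delta> ` FH n B \<delta> j"
  proof (intro equalityI subsetI)
    fix X :: "'k tvec set" assume "X \<in> P"
    then obtain c v a b where *: "c \<in> hcomp residue_field a" "v \<in> FH n B \<delta> b" "a + b = j"
      "X = pure_tensor (poly_ring n) residue_field (gfree (poly_ring n) B \<delta>) c v"
      unfolding P_def by auto
    then have X: "X = tau n B \<delta> (mon 0 c \<star> v)"
      using pure_tensor_eq_tau[OF FH_FM] by blast
    show "X \<in> tau n B \<delta> ` FH n B \<delta> j"
    proof (cases "a = 0")
      case True
      then show ?thesis unfolding X using * by (intro imageI FH_const) simp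
    next
      case False
      then have "c = 0" using *(1) by simp
      then show ?thesis unfolding X using FH_zero by (auto intro!: imageI)
    qed
  next
    fix X :: "'k tvec set" assume "X \<in> tau n B \<delta> ` FH n B \<delta> j"
    then obtain v where "v \<in> FH n B \<delta> j" "X = tau n B \<delta> v" by blast
    moreover have "(1 :: 'k) \<in> hcomp residue_field 0" by simp
    ultimately show "X \<in> P" unfolding P_def tau_def by force
  qed
  have inv_tau: "inv\<^bsub>?G\<^esub> tau n B \<delta> v = tau n B \<delta> (- v)" if v: "v \<in> FM n B" for v :: "'k pvec"
    unfolding m_inv_def
  proof (rule the_equality)
    show "tau n B \<delta> (- v) \<in> carrier ?G \<and> tau n B \<delta> v \<otimes>\<^bsub>?G\<^esub> tau n B \<delta> (- v) = \<one>\<^bsub>?G\<^esub> \<and>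
        tau n B \<delta> (- v) \<otimes>\<^bsub>?G\<^esub> tau n B \<delta> v = \<one>\<^bsub>?G\<^esub>"
      using v by (simp add: tens_carrier tens_add tens_zero FM_uminus)
    fix Y :: "'k tvec set" assume Y: "Y \<in> carrier ?G \<and> tau n B \<delta> v \<otimes>\<^bsub>?G\<^esub> Y = \<one>\<^bsub>?G\<^esub> \<and> Y \<otimes>\<^bsub>?G\<^esub> tau n B \<delta> v = \<one>\<^bsub>?G\<^esub>"
    then obtain u where u: "u \<in> FM n B" "Y = tau n B \<delta> u" by (auto simp: tens_carrier)
    then have "tau n B \<delta> (v + u) = tau n B \<delta> 0" using Y v by (simp add: tens_add tens_zero)
    then have "ev v + ev u = 0" using u v by (simp add: tau_eq_iff FM_add ev_add)
    then have "ev u = ev (- v)" unfolding ev_uminus by (metis add.commute eq_neg_iff_add_eq_0)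
    then show "Y = tau n B \<delta> (- v)" unfolding u(2) using u v by (simp add: tau_eq_iff FM_uminus)
  qed
  have "x \<in> generate ?G P \<Longrightarrow> x \<in> tau n B \<delta> ` FH n B \<delta> j" for x
  proof (induction rule: generate.induct)
    case one
    then show ?case using FH_zero by (auto simp: tens_zero intro!: imageI)
  next
    case (incl h)
    then show ?case using P by simp
  next
    case (inv h)
    then obtain v where v: "v \<in> FH n B \<delta> j" "h = tau n B \<delta> v" using P by auto
    show ?case unfolding v(2) inv_tau[OF FH_FM[OF v(1)]]
      by (intro imageI FH_uminus v)
  next
    case (eng h1 h2)
    then obtain u v where u: "u \<in> FH n B \<delta> j" "h1 = tau n B \<delta> u" and v: "v \<in> FH n B \<delta> j" "h2 = tau n B \<delta> v"
      by auto
    then show ?case using tens_add[OF FH_FM[OF u(1)] FH_FM[OF v(1)]] FH_add[OF u(1) v(1)] by auto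
  qed
  then show ?thesis unfolding H using P generate.incl[of _ P ?G] by blast
qed

text \<open>\<open>tensor_map\<close> is a definite description, so existence and uniqueness are
  both at stake. Uniqueness holds because every element is some 1 \<otimes> v, existence because
  \<open>f\<close> acts on constant coefficients.\<close>

lemma tensor_map_tau:
  fixes f :: "'k::field pvec \<Rightarrow> 'k pvec"
  assumes f: "glin n B \<delta> B' \<delta>' f" and v: "v \<in> FM n B"
  shows "tensor_map (poly_ring n) residue_field (gfree (poly_ring n) B \<delta>) (gfree (poly_ring n) B' \<delta>') f
    (tau n B \<delta> v) = tau n B' \<delta>' (f v)"
proof -
  let ?T = "tens n B \<delta> :: ('k mpoly, 'k tvec set) module"
  let ?T' = "tens n B' \<delta>' :: ('k mpoly, 'k tvec set) module"
  let ?pt = "pure_tensor (poly_ring n) residue_field (gfree (poly_ring n) B \<delta>) :: 'k \<Rightarrow> 'k pvec \<Rightarrow> 'k tvec set"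
  let ?pt' = "pure_tensor (poly_ring n) residue_field (gfree (poly_ring n) B' \<delta>') :: 'k \<Rightarrow> 'k pvec \<Rightarrow> 'k tvec set"
  define Q where "Q h \<longleftrightarrow> h \<in> LinearCombinations.module_hom (poly_ring n) ?T ?T' \<and> h \<in> extensional (carrier ?T) \<and>
      (\<forall>x\<in>carrier residue_field. \<forall>y\<in>carrier (gfree (poly_ring n) B \<delta>). h (?pt x y) = ?pt' x (f y))" for h
  \<comment> \<open>The value is computed from a chosen representative; by \<open>glin_ev\<close>
    another choice gives the same class. The value \<open>undefined\<close> outside the carrier is
    forced by extensionality.\<close>
  define h where "h X = (if X \<in> carrier ?T then tau n B' \<delta>' (f (SOME v. v \<in> FM n B \<and> X = tau n B \<delta> v)) else undefined)" for X
  have h_tau: "h (tau n B \<delta> v) = tau n B' \<delta>' (f v)" if v: "v \<in> FM n B" for v :: "'k pvec"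
  proof -
    let ?u = "SOME u. u \<in> FM n B \<and> tau n B \<delta> v = tau n B \<delta> u"
    have u: "?u \<in> FM n B \<and> tau n B \<delta> v = tau n B \<delta> ?u"
      by (rule someI[of _ v]) (use v in simp)
    then have "ev v = ev ?u" using tau_eq_iff[OF v conjunct1[OF u]] by blast
    then have "ev (v - ?u) = 0" by (simp add: ev_diff)
    then have "ev (f (v - ?u)) = 0" by (rule glin_ev[OF f FM_diff[OF v conjunct1[OF u]]])
    then have "ev (f ?u) = ev (f v)" using glin_diff[OF f v conjunct1[OF u]] by (simp add: ev_diff)
    then have "tau n B' \<delta>' (f ?u) = tau n B' \<delta>' (f v)"
      using tau_eq_iff[OF glin_FM[OF f conjunct1[OF u]] glin_FM[OF f v]] by blast
    then show ?thesis using v by (auto simp: h_def tens_carrier)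
  qed
  have Qh: "Q h"
    unfolding Q_def
  proof (intro conjI ballI)
    show "h \<in> LinearCombinations.module_hom (poly_ring n) ?T ?T'"
      unfolding LinearCombinations.module_hom_def
    proof (intro CollectI conjI allI impI)
      show "h \<in> carrier ?T \<rightarrow> carrier ?T'"
        using h_tau glin_FM[OF f] by (auto simp: tens_carrier)
      show "h (X \<oplus>\<^bsub>?T\<^esub> Y) = h X \<oplus>\<^bsub>?T'\<^esub> h Y" if XY: "X \<in> carrier ?T \<and> Y \<in> carrier ?T" for X Y
      proof -
        obtain u w where "u \<in> FM n B" "X = tau n B \<delta> u" "w \<in> FM n B" "Y = tau n B \<delta> w"
          using XY by (auto simp: tens_carrier)
        then show ?thesis
          using glin_FM[OF f] by (simp add: tens_add h_tau FM_add glin_add[OF f])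
      qed
      show "h (r \<odot>\<^bsub>?T\<^esub> X) = r \<odot>\<^bsub>?T'\<^esub> h X" if rX: "r \<in> pol n \<and> X \<in> carrier ?T" for r X
      proof -
        obtain u where "u \<in> FM n B" "X = tau n B \<delta> u" using rX by (auto simp: tens_carrier)
        then show ?thesis
          using rX glin_FM[OF f] by (simp add: tens_smult h_tau FM_vscale glin_vscale[OF f])
      qed
    qed
    show "h \<in> extensional (carrier ?T)" by (auto simp: extensional_def h_def)
    fix c :: 'k and y :: "'k pvec" assume "y \<in> carrier (gfree (poly_ring n) B \<delta>)"
    then have y: "y \<in> FM n B" by simp
    show "h (?pt c y) = ?pt' c (f y)"
      unfolding pure_tensor_eq_tau[OF y] pure_tensor_eq_tau[OF glin_FM[OF f y]]
        h_tau[OF FM_vscale[OF pol_const y]] glin_vscale[OF f pol_const y] ..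
  qed
  have "g = h" if g: "Q g" for g
  proof (rule extensionalityI[of _ "carrier ?T"])
    show "g \<in> extensional (carrier ?T)" "h \<in> extensional (carrier ?T)" using g Qh by (auto simp: Q_def)
    fix X assume "X \<in> carrier ?T"
    then obtain u where u: "u \<in> FM n B" "X = tau n B \<delta> u" by (auto simp: tens_carrier)
    have "g (?pt 1 u) = ?pt' 1 (f u)" using g u(1) by (simp add: Q_def)
    then show "g X = h X" unfolding u(2) h_tau[OF u(1)] unfolding tau_def .
  qed
  then have "(THE h. Q h) = h" using Qh by blast
  then have "tensor_map (poly_ring n) residue_field (gfree (poly_ring n) B \<delta>) (gfree (poly_ring n) B' \<delta>') f = h"
    unfolding tensor_map_def Q_def .
  then show ?thesis using h_tau[OF v] by simp
qed

section \<open>Resolutions of \<open>R/I\<close>\<close>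

lemma gquot_simps [simp]:
  "carrier (gquot M N) = a_rcosets\<^bsub>M\<^esub> N"
  "add (gquot M N) = set_add M"
  "zero (gquot M N) = N"
  "smult (gquot M N) = (\<lambda>r C. \<Union>x\<in>C. N +>\<^bsub>M\<^esub> (r \<odot>\<^bsub>M\<^esub> x))"
  "hcomp (gquot M N) j = (\<lambda>x. N +>\<^bsub>M\<^esub> x) ` hcomp M j"
  by (simp_all add: gquot_def quot_module_def module.defs gmodule.defs)

abbreviation rcl :: "nat \<Rightarrow> 'k::field mpoly set \<Rightarrow> 'k mpoly \<Rightarrow> 'k mpoly set"
  where "rcl n I f \<equiv> I +>\<^bsub>poly_ring n\<^esub> f"

lemma hideal_addsub:
  assumes "hideal n I"
  shows "addsub I"
proof -
  have "- f \<in> I" if "f \<in> I" for f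
  proof -
    have "(- 1) * f \<in> I" using assms that pol_uminus[OF pol_one] unfolding hideal_def by blast
    then show ?thesis by simp
  qed
  then show ?thesis using assms by (auto simp: addsub_def hideal_def)
qed

lemma rcl_eq_iff: "hideal n I \<Longrightarrow> rcl n I f = rcl n I g \<longleftrightarrow> f - g \<in> I"
  by (rule coset_eq_iff) (simp_all add: hideal_addsub)

lemma rcl_zero: "hideal n I \<Longrightarrow> rcl n I 0 = I"
  by (simp add: coset_eq_image)

lemma gquot_carrier: "carrier (gquot (poly_ring n) I) = rcl n I ` pol n"
  by (auto simp: A_RCOSETS_def')

lemma gquot_add: "hideal n I \<Longrightarrow> rcl n I f \<oplus>\<^bsub>gquot (poly_ring n) I\<^esub> rcl n I g = rcl n I (f + g)"
  by (simp add: set_add_coset hideal_addsub)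

lemma gquot_smult:
  assumes "hideal n I" "r \<in> pol n"
  shows "r \<odot>\<^bsub>gquot (poly_ring n) I\<^esub> rcl n I f = rcl n I (r * f)"
  using smult_coset[of "poly_ring n" I "\<lambda>x. r * x" f] hideal_addsub[OF assms(1)] assms
  by (simp add: distrib_left hideal_def)

text \<open>The shift of indices is undone: the augmentation is the class modulo \<open>I\<close> of
  the only entry of \<open>d 0 v\<close>. For a minimal resolution this provides the witness that
  the choice inside \<open>Tor\<close> requires.\<close>

lemma resolution_of_cres:
  assumes I: "hideal n I" and P: "cres n I B \<delta> d"
  shows "graded_free_resolution (poly_ring n) (gquot (poly_ring n) I)
    \<lparr>gens = (\<lambda>i. B (Suc i)), gen_deg = (\<lambda>i. \<delta> (Suc i)), diff = (\<lambda>i. d (Suc i)),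
     aug = (\<lambda>v. rcl n I (d 0 v 0))\<rparr>"
proof -
  note dl = cres_glin[OF P]
  have d0: "d 0 v \<in> FM n {0}" if "v \<in> FM n (B (Suc 0))" for v
    using glin_FM[OF dl that] cres_0(1)[OF P] by simp
  have hom0: "(\<lambda>v. rcl n I (d 0 v 0)) \<in> LinearCombinations.module_hom (poly_ring n)
      (gfree (poly_ring n) (B (Suc 0)) (\<delta> (Suc 0))) (gquot (poly_ring n) I)"
    unfolding LinearCombinations.module_hom_def gfree_simps gquot_carrier
  proof (intro CollectI conjI allI impI)
    show "(\<lambda>v. rcl n I (d 0 v 0)) \<in> FM n (B (Suc 0)) \<rightarrow> rcl n I ` pol n"
      using FM_pol[OF d0] by blast
    show "rcl n I (d 0 (u + v) 0) = rcl n I (d 0 u 0) \<oplus>\<^bsub>gquot (poly_ring n) I\<^esub> rcl n I (d 0 v 0)"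
      if "u \<in> FM n (B (Suc 0)) \<and> v \<in> FM n (B (Suc 0))" for u v
      unfolding gquot_add[OF I] glin_add[OF dl conjunct1[OF that] conjunct2[OF that]] by (simp only: pointwise)
    show "rcl n I (d 0 (r \<star> v) 0) = r \<odot>\<^bsub>gquot (poly_ring n) I\<^esub> rcl n I (d 0 v 0)"
      if "r \<in> pol n \<and> v \<in> FM n (B (Suc 0))" for r v
      unfolding gquot_smult[OF I conjunct1[OF that]] glin_vscale[OF dl conjunct1[OF that] conjunct2[OF that]]
      by (simp only: pointwise)
  qed
  have gr0: "rcl n I (d 0 v 0) \<in> hcomp (gquot (poly_ring n) I) j"
    if v: "v \<in> FH n (B (Suc 0)) (\<delta> (Suc 0)) j" for v j
  proof -
    have "d 0 v 0 \<in> hpol n (j - \<delta> 0 0)" by (rule FH_hpol[OF glin_FH[OF dl v]])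
    then show ?thesis using cres_0(2)[OF P] by simp
  qed
  have hom: "d (Suc i) \<in> LinearCombinations.module_hom (poly_ring n)
      (gfree (poly_ring n) (B (Suc (Suc i))) (\<delta> (Suc (Suc i)))) (gfree (poly_ring n) (B (Suc i)) (\<delta> (Suc i)))" for i
    unfolding LinearCombinations.module_hom_def gfree_simps
    using glin_FM[OF dl] glin_add[OF dl] glin_vscale[OF dl] by auto
  have gr: "d (Suc i) v \<in> FH n (B (Suc i)) (\<delta> (Suc i)) j"
    if "v \<in> FH n (B (Suc (Suc i))) (\<delta> (Suc (Suc i))) j" for v i j
    by (rule glin_FH[OF dl that])
  have surj: "(\<lambda>v. rcl n I (d 0 v 0)) ` FM n (B (Suc 0)) = rcl n I ` pol n"
  proof (intro equalityI subsetI)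
    fix X assume "X \<in> rcl n I ` pol n"
    then obtain f where f: "f \<in> pol n" "X = rcl n I f" by blast
    have "f \<star> bv 0 \<in> FM n {0}" by (intro FM_vscale FM_bv f) simp
    then obtain u where u: "u \<in> FM n (B 1)" "f \<star> bv 0 - d 0 u \<in> auxJ n I 0"
      using cres_aug[OF P] by blast
    then have "f - d 0 u 0 \<in> I" by (simp add: auxJ_def pointwise bv_apply)
    then have "X = rcl n I (d 0 u 0)" unfolding f(2) using rcl_eq_iff[OF I] by blast
    then show "X \<in> (\<lambda>v. rcl n I (d 0 v 0)) ` FM n (B (Suc 0))" using u(1) by simp
  next
    fix X assume "X \<in> (\<lambda>v. rcl n I (d 0 v 0)) ` FM n (B (Suc 0))"
    then obtain v where v: "v \<in> FM n (B (Suc 0))" "X = rcl n I (d 0 v 0)" by blast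
    show "X \<in> rcl n I ` pol n" unfolding v(2) by (intro imageI FM_pol[OF d0[OF v(1)]])
  qed
  have ex: "d (Suc i) ` FM n (B (Suc (Suc i))) = {v \<in> FM n (B (Suc i)). d i v \<in> auxJ n I i}" for i
    using P unfolding cres_def by blast
  have ker0: "d (Suc 0) ` FM n (B (Suc (Suc 0))) = {v \<in> FM n (B (Suc 0)). rcl n I (d 0 v 0) = I}"
    unfolding ex using d0 rcl_eq_iff[OF I, of _ 0] rcl_zero[OF I] by (auto simp: auxJ_def)
  show ?thesis
    unfolding graded_free_resolution_def Let_def res_module_def graded_hom_def a_kernel_def'
    using hom0 gr0 hom gr surj ker0 ex
    by (auto simp: gquot_carrier simp del: gquot_simps(1) gquot_simps(5))
qed

text \<open>The augmentation of the given resolution has values in R/I. Its values on basis vectors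
  are classes of homogeneous polynomials, and a choice of such representatives defines the lift
  \<open>d0\<close> to R.\<close>

lemma cres_of_resolution:
  fixes I :: "'k::field mpoly set"
  assumes I: "hideal n I"
    and Q: "graded_free_resolution (poly_ring n) (gquot (poly_ring n) I) Q"
  obtains d0 where "cres n I (case_nat {0} (gens Q)) (case_nat (\<lambda>_. 0) (gen_deg Q)) (case_nat d0 (diff Q))"
proof -
  let ?M = "gquot (poly_ring n) I"
  let ?B = "case_nat {0} (gens Q)" and ?\<delta> = "case_nat (\<lambda>_. 0) (gen_deg Q)"
  have aug_hom: "aug Q \<in> graded_hom (poly_ring n) (gfree (poly_ring n) (gens Q 0) (gen_deg Q 0)) ?M"
    and diff_hom: "\<And>i. diff Q i \<in> graded_hom (poly_ring n) (gfree (poly_ring n) (gens Q (Suc i)) (gen_deg Q (Suc i)))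
      (gfree (poly_ring n) (gens Q i) (gen_deg Q i))"
    and aug_surj: "aug Q ` FM n (gens Q 0) = rcl n I ` pol n"
    and ex0: "diff Q 0 ` FM n (gens Q 1) = {v \<in> FM n (gens Q 0). aug Q v = I}"
    and ex: "\<And>i. diff Q (Suc i) ` FM n (gens Q (Suc (Suc i))) = {v \<in> FM n (gens Q (Suc i)). diff Q i v = 0}"
    using Q unfolding graded_free_resolution_def Let_def res_module_def a_kernel_def' gfree_simps gquot_carrier
      gquot_simps(3) by blast+
  have aug_mh: "aug Q \<in> LinearCombinations.module_hom (poly_ring n) (gfree (poly_ring n) (gens Q 0) (gen_deg Q 0)) ?M"
    using aug_hom unfolding graded_hom_def by blast
  have aug_add: "aug Q (u + v) = aug Q u \<oplus>\<^bsub>?M\<^esub> aug Q v"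
    if "u \<in> FM n (gens Q 0)" "v \<in> FM n (gens Q 0)" for u v
    using LinearCombinations.module_hom_add[OF aug_mh] that unfolding gfree_simps by blast
  have aug_smult: "aug Q (r \<star> v) = r \<odot>\<^bsub>?M\<^esub> aug Q v" if "r \<in> pol n" "v \<in> FM n (gens Q 0)" for r v
    using LinearCombinations.module_hom_smult[OF aug_mh] that unfolding gfree_simps by blast
  have aug_deg: "aug Q v \<in> rcl n I ` hpol n j" if v: "v \<in> FH n (gens Q 0) (gen_deg Q 0) j" for v j
  proof -
    have "aug Q ` hcomp (gfree (poly_ring n) (gens Q 0) (gen_deg Q 0)) j \<subseteq> hcomp ?M j"
      using aug_hom unfolding graded_hom_def by blast
    then show ?thesis using v unfolding gfree_simps gquot_simps by blast
  qed
  have dl: "glin n (gens Q (Suc i)) (gen_deg Q (Suc i)) (gens Q i) (gen_deg Q i) (diff Q i)" for i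
  proof -
    have mh: "diff Q i \<in> LinearCombinations.module_hom (poly_ring n)
        (gfree (poly_ring n) (gens Q (Suc i)) (gen_deg Q (Suc i))) (gfree (poly_ring n) (gens Q i) (gen_deg Q i))"
      and gr: "\<And>j. diff Q i ` FH n (gens Q (Suc i)) (gen_deg Q (Suc i)) j \<subseteq> FH n (gens Q i) (gen_deg Q i) j"
      using diff_hom[of i] unfolding graded_hom_def gfree_simps by blast+
    show ?thesis
      using LinearCombinations.module_hom_closed[OF mh] LinearCombinations.module_hom_add[OF mh] LinearCombinations.module_hom_smult[OF mh] gr
      unfolding glin_def gfree_simps by blast
  qed
  have "\<exists>f. f \<in> hpol n (gen_deg Q 0 b) \<and> aug Q (bv b) = rcl n I f" if "b \<in> gens Q 0" for b
    using aug_deg[OF FH_bv[OF that]] by blast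
  then obtain f where f: "f b \<in> hpol n (gen_deg Q 0 b)" "aug Q (bv b) = rcl n I (f b)"
    if "b \<in> gens Q 0" for b by metis
  define w :: "nat \<Rightarrow> 'k pvec" where "w b = f b \<star> bv 0" for b
  let ?d0 = "ext w"
  have w: "w b \<in> FH n {0} (\<lambda>_. 0) (gen_deg Q 0 b)" if "b \<in> gens Q 0" for b
    using FH_vscale[OF f(1)[OF that] FH_bv[of 0 "{0}" n "\<lambda>_. 0"]] unfolding w_def by simp
  have d0: "glin n (gens Q 0) (gen_deg Q 0) {0} (\<lambda>_. 0) ?d0" by (rule glin_ext[OF w])
  have aug: "aug Q v = rcl n I (?d0 v 0)" if "v \<in> FM n (gens Q 0)" for v
    using that
  proof (induction rule: FM_induct)
    case zero
    have "aug Q 0 \<in> rcl n I ` pol n" using aug_surj FM_zero by blast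
    then obtain g where "aug Q 0 = rcl n I g" by blast
    moreover have "aug Q (0 \<star> 0) = 0 \<odot>\<^bsub>?M\<^esub> aug Q 0" by (rule aug_smult[OF pol_zero FM_zero])
    ultimately have aug0: "aug Q 0 = rcl n I 0" using gquot_smult[OF I pol_zero, of g] by simp
    have "(0 :: 'k pvec) 0 = 0" by (rule zero_fun_apply)
    then show ?case unfolding glin_zero[OF d0] aug0 by (rule arg_cong[OF sym])
  next
    case (bv r b)
    have "?d0 (r \<star> bv b) 0 = r * f b"
      using glin_vscale[OF d0 bv(1) FM_bv[OF bv(2)]] by (simp add: ext_bv w_def pointwise bv_apply)
    then show ?case
      using aug_smult[OF bv(1) FM_bv[OF bv(2)]] f(2)[OF bv(2)] gquot_smult[OF I bv(1), of "f b"] by simp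
  next
    case (add u v)
    have "?d0 (u + v) 0 = ?d0 u 0 + ?d0 v 0" using glin_add[OF d0 add(1,2)] by (simp add: pointwise)
    then show ?case using aug_add[OF add(1,2)] gquot_add[OF I] add(3,4) by simp
  qed
  have aug_zero: "aug Q v = I \<longleftrightarrow> ?d0 v \<in> auxJ n I 0" if v: "v \<in> FM n (gens Q 0)" for v
    using aug[OF v] rcl_eq_iff[OF I, of "?d0 v 0" 0] rcl_zero[OF I] glin_FM[OF d0 v] by (simp add: auxJ_def)
  have "cres n I ?B ?\<delta> (case_nat ?d0 (diff Q))"
    unfolding cres_def
  proof (intro conjI allI ballI)
    show "glin n (?B (Suc i)) (?\<delta> (Suc i)) (?B i) (?\<delta> i) (case_nat ?d0 (diff Q) i)" for i
      using d0 dl by (cases i) auto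
    show "case_nat ?d0 (diff Q) (Suc i) ` FM n (?B (Suc (Suc i))) =
        {v \<in> FM n (?B (Suc i)). case_nat ?d0 (diff Q) i v \<in> auxJ n I i}" for i
    proof (cases i)
      case 0
      have "{v \<in> FM n (gens Q 0). aug Q v = I} = {v \<in> FM n (gens Q 0). ?d0 v \<in> auxJ n I 0}"
        using aug_zero by blast
      then show ?thesis unfolding 0 using ex0 by simp
    next
      case (Suc k)
      then show ?thesis using ex[of k] by simp
    qed
    fix v :: "'k pvec" assume v: "v \<in> FM n {0}"
    have "rcl n I (v 0) \<in> aug Q ` FM n (gens Q 0)" unfolding aug_surj using FM_pol[OF v] by blast
    then obtain u where u: "u \<in> FM n (gens Q 0)" "rcl n I (v 0) = rcl n I (?d0 u 0)" using aug by auto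
    then have "v 0 - ?d0 u 0 \<in> I" using rcl_eq_iff[OF I] by blast
    then have "v - ?d0 u \<in> auxJ n I 0" using FM_diff[OF v glin_FM[OF d0 u(1)]] by (simp add: auxJ_def pointwise)
    then show "\<exists>u\<in>FM n (?B 1). v - case_nat ?d0 (diff Q) 0 u \<in> auxJ n I 0" using u(1) by auto
  qed auto
  then show ?thesis by (rule that)
qed

section \<open>Betti numbers from a minimal resolution\<close>

text \<open>\<open>V\<close> comes with bare operations; its vector space axioms are pulled back
  from \<open>W\<close> along the bijection \<open>\<theta>\<close>. For \<open>V\<close> a
  component of \<open>Tor\<close> and \<open>W\<close> a space of coordinate vectors, this proves
  the axioms and the dimension at once.\<close>

lemma vectorspace_dim_iso:
  fixes V :: "('k, 'v, 'x) module_scheme" and W :: "('k, 'w, 'y) module_scheme"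
  assumes W: "vectorspace K W" "vectorspace.fin_dim K W"
    and add: "\<And>x y. x \<in> carrier V \<Longrightarrow> y \<in> carrier V \<Longrightarrow> x \<oplus>\<^bsub>V\<^esub> y \<in> carrier V"
    and smult: "\<And>c x. c \<in> carrier K \<Longrightarrow> x \<in> carrier V \<Longrightarrow> c \<odot>\<^bsub>V\<^esub> x \<in> carrier V"
    and zero: "\<zero>\<^bsub>V\<^esub> \<in> carrier V"
    and bij: "bij_betw \<theta> (carrier V) (carrier W)"
    and \<theta>_add: "\<And>x y. x \<in> carrier V \<Longrightarrow> y \<in> carrier V \<Longrightarrow> \<theta> (x \<oplus>\<^bsub>V\<^esub> y) = \<theta> x \<oplus>\<^bsub>W\<^esub> \<theta> y"
    and \<theta>_smult: "\<And>c x. c \<in> carrier K \<Longrightarrow> x \<in> carrier V \<Longrightarrow> \<theta> (c \<odot>\<^bsub>V\<^esub> x) = c \<odot>\<^bsub>W\<^esub> \<theta> x"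
    and \<theta>_zero: "\<theta> \<zero>\<^bsub>V\<^esub> = \<zero>\<^bsub>W\<^esub>"
  shows "vectorspace.dim K V = vectorspace.dim K W"
proof -
  interpret W: vectorspace K W by (rule W)
  have \<theta>W: "\<theta> x \<in> carrier W" if "x \<in> carrier V" for x using bij that by (auto simp: bij_betw_def)
  have inj: "x = y" if "x \<in> carrier V" "y \<in> carrier V" "\<theta> x = \<theta> y" for x y
    using bij that by (auto simp: bij_betw_def inj_on_def)
  define \<eta> where "\<eta> = inv_into (carrier V) \<theta>"
  have \<eta>V: "\<eta> w \<in> carrier V" and \<theta>\<eta>: "\<theta> (\<eta> w) = w" if "w \<in> carrier W" for w
    using bij that by (auto simp: \<eta>_def bij_betw_def inv_into_into f_inv_into_f)
  have mV: "module K V"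
  proof (rule module_criteria)
    show "cring K" ..
    show "\<forall>v\<in>carrier V. \<exists>w\<in>carrier V. v \<oplus>\<^bsub>V\<^esub> w = \<zero>\<^bsub>V\<^esub>"
    proof
      fix v assume v: "v \<in> carrier V"
      let ?w = "\<eta> (\<ominus>\<^bsub>W\<^esub> \<theta> v)"
      have w: "?w \<in> carrier V" "\<theta> ?w = \<ominus>\<^bsub>W\<^esub> \<theta> v" using \<eta>V \<theta>\<eta> \<theta>W[OF v] by auto
      have "\<theta> (v \<oplus>\<^bsub>V\<^esub> ?w) = \<theta> \<zero>\<^bsub>V\<^esub>"
        unfolding \<theta>_add[OF v w(1)] w(2) \<theta>_zero using \<theta>W[OF v] by (simp add: W.M.r_neg)
      then have "v \<oplus>\<^bsub>V\<^esub> ?w = \<zero>\<^bsub>V\<^esub>" by (intro inj add v w zero)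
      then show "\<exists>w\<in>carrier V. v \<oplus>\<^bsub>V\<^esub> w = \<zero>\<^bsub>V\<^esub>" using w(1) by blast
    qed
    show "\<forall>v w. v \<in> carrier V \<and> w \<in> carrier V \<longrightarrow> v \<oplus>\<^bsub>V\<^esub> w = w \<oplus>\<^bsub>V\<^esub> v"
      by (auto intro!: inj simp: add \<theta>_add \<theta>W W.M.a_comm)
    show "\<forall>v w x. v \<in> carrier V \<and> w \<in> carrier V \<and> x \<in> carrier V \<longrightarrow>
        (v \<oplus>\<^bsub>V\<^esub> w) \<oplus>\<^bsub>V\<^esub> x = v \<oplus>\<^bsub>V\<^esub> (w \<oplus>\<^bsub>V\<^esub> x)"
      by (auto intro!: inj simp: add \<theta>_add \<theta>W W.M.a_assoc)
    show "\<forall>v\<in>carrier V. v \<oplus>\<^bsub>V\<^esub> \<zero>\<^bsub>V\<^esub> = v"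
      by (auto intro!: inj simp: add zero \<theta>_add \<theta>W \<theta>_zero)
    show "\<forall>a b v. a \<in> carrier K \<and> b \<in> carrier K \<and> v \<in> carrier V \<longrightarrow>
        (a \<otimes>\<^bsub>K\<^esub> b) \<odot>\<^bsub>V\<^esub> v = a \<odot>\<^bsub>V\<^esub> (b \<odot>\<^bsub>V\<^esub> v)"
      by (auto intro!: inj simp: smult \<theta>_smult \<theta>W W.smult_assoc1)
    show "\<forall>v\<in>carrier V. \<one>\<^bsub>K\<^esub> \<odot>\<^bsub>V\<^esub> v = v"
      by (auto intro!: inj simp: smult \<theta>_smult \<theta>W)
    show "\<forall>a b v. a \<in> carrier K \<and> b \<in> carrier K \<and> v \<in> carrier V \<longrightarrow>
        (a \<oplus>\<^bsub>K\<^esub> b) \<odot>\<^bsub>V\<^esub> v = (a \<odot>\<^bsub>V\<^esub> v) \<oplus>\<^bsub>V\<^esub> (b \<odot>\<^bsub>V\<^esub> v)"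
      by (auto intro!: inj simp: add smult \<theta>_add \<theta>_smult \<theta>W W.smult_l_distr)
    show "\<forall>a v w. a \<in> carrier K \<and> v \<in> carrier V \<and> w \<in> carrier V \<longrightarrow>
        a \<odot>\<^bsub>V\<^esub> (v \<oplus>\<^bsub>V\<^esub> w) = (a \<odot>\<^bsub>V\<^esub> v) \<oplus>\<^bsub>V\<^esub> (a \<odot>\<^bsub>V\<^esub> w)"
      by (auto intro!: inj simp: add smult \<theta>_add \<theta>_smult \<theta>W W.smult_r_distr)
  qed (use zero add smult in auto)
  interpret V: vectorspace K V using mV W.field_axioms by (simp add: vectorspace_def)
  \<comment> \<open>The inverse of \<open>\<theta>\<close> is taken as the linear map, since finite
    dimension is known for \<open>W\<close> and is demanded of the source.\<close>
  interpret L: linear_map K W V \<eta>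
  proof
    show "\<eta> \<in> LinearCombinations.module_hom K W V"
      unfolding LinearCombinations.module_hom_def
    proof (intro CollectI conjI allI impI)
      show "\<eta> \<in> carrier W \<rightarrow> carrier V" using \<eta>V by auto
      show "\<eta> (x \<oplus>\<^bsub>W\<^esub> y) = \<eta> x \<oplus>\<^bsub>V\<^esub> \<eta> y" if "x \<in> carrier W \<and> y \<in> carrier W" for x y
        using that by (intro inj) (auto simp: \<eta>V \<theta>\<eta> \<theta>_add)
      show "\<eta> (c \<odot>\<^bsub>W\<^esub> x) = c \<odot>\<^bsub>V\<^esub> \<eta> x" if "c \<in> carrier K \<and> x \<in> carrier W" for c x
        using that by (intro inj) (auto simp: \<eta>V \<theta>\<eta> \<theta>_smult)
    qed
  qed
  have "inj_on \<eta> (carrier W)" by (rule inj_on_inverseI[where g = \<theta>]) (rule \<theta>\<eta>)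
  moreover have "\<eta> ` carrier W = carrier V"
  proof (intro equalityI subsetI)
    fix v assume v: "v \<in> carrier V"
    then have "v = \<eta> (\<theta> v)" by (intro inj \<eta>V) (auto simp: \<theta>W \<theta>\<eta>)
    then show "v \<in> \<eta> ` carrier W" using \<theta>W[OF v] by blast
  qed (use \<eta>V in auto)
  ultimately show ?thesis using L.dim_eq[OF W(2)] by simp
qed

text \<open>A class in \<open>Tor\<close>, represented by 1 \<otimes> v, is sent to the constant
  coefficients of \<open>g v\<close>, where \<open>g\<close> compares the chosen resolution with the
  minimal one. By \<open>minimal_comparison\<close> this is a bijection, and in degree
  \<open>j\<close> only basis vectors of degree \<open>j\<close> can have nonzero constant
  coefficients.\<close>

theorem betti_minimal_cres:
  fixes I :: "'k::field mpoly set"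
  assumes I: "hideal n I" and P: "cres n I B \<delta> d" and min: "minimal_cres n B d"
    and fin: "finite {b \<in> B (Suc i). \<delta> (Suc i) b = j}"
  shows "betti n I i j = card {b \<in> B (Suc i). \<delta> (Suc i) b = j}"
proof -
  define Q where "Q = (SOME Q. graded_free_resolution (poly_ring n) (gquot (poly_ring n) I) Q)"
  have "graded_free_resolution (poly_ring n) (gquot (poly_ring n) I) Q"
    unfolding Q_def by (rule someI, rule resolution_of_cres[OF I P])
  then obtain d0 where Qc: "cres n I (case_nat {0} (gens Q)) (case_nat (\<lambda>_. 0) (gen_deg Q)) (case_nat d0 (diff Q))"
    using cres_of_resolution[OF I] by blast
  define A where "A = gens Q i"
  define \<alpha> where "\<alpha> = gen_deg Q i"
  define A' where "A' = gens Q (Suc i)"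
  define \<alpha>' where "\<alpha>' = gen_deg Q (Suc i)"
  define D where "D = diff Q i"
  have dl: "glin n (gens Q (Suc k)) (gen_deg Q (Suc k)) (gens Q k) (gen_deg Q k) (diff Q k)" for k
    using cres_glin[OF Qc, of "Suc k"] by simp
  have D: "glin n A' \<alpha>' A \<alpha> D" unfolding A_def \<alpha>_def A'_def \<alpha>'_def D_def by (rule dl)
  \<comment> \<open>The condition on \<open>v\<close> for 1 \<otimes> v to be a cycle of the
    tensored complex; at the right end everything is a cycle.\<close>
  define cyc where "cyc v \<longleftrightarrow> (case i of 0 \<Rightarrow> True | Suc k \<Rightarrow> ev (diff Q k v) = 0)" for v
  obtain g where g: "glin n A \<alpha> (B (Suc i)) (\<delta> (Suc i)) g"
    and g_inj: "\<And>z. z \<in> FM n A \<Longrightarrow> cyc z \<Longrightarrow> ev (g z) = 0 \<Longrightarrow> \<exists>u\<in>FM n A'. ev z = ev (D u)"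
    and g_bd: "\<And>u. u \<in> FM n A' \<Longrightarrow> ev (g (D u)) = 0"
    and g_surj: "\<And>c. c \<in> FH n (B (Suc i)) (\<delta> (Suc i)) j \<Longrightarrow> \<exists>z\<in>FH n A \<alpha> j. cyc z \<and> ev (g z) = ev c"
  \<comment> \<open>Index \<open>i\<close> of the chosen resolution is index \<open>Suc i\<close> of
    its coded form.\<close>
  proof (rule minimal_comparison[OF I P Qc min, of i])
    fix g :: "'k pvec \<Rightarrow> 'k pvec"
    let ?B' = "case_nat {0} (gens Q)" and ?d' = "case_nat d0 (diff Q)"
    assume a: "glin n (?B' (Suc i)) (case_nat (\<lambda>_. 0) (gen_deg Q) (Suc i)) (B (Suc i)) (\<delta> (Suc i)) g"
      and b: "\<And>z. z \<in> FM n (?B' (Suc i)) \<Longrightarrow> (i \<noteq> 0 \<Longrightarrow> ev (?d' i z) = 0) \<Longrightarrow> ev (g z) = 0 \<Longrightarrow>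
        \<exists>u\<in>FM n (?B' (Suc (Suc i))). ev z = ev (?d' (Suc i) u)"
      and c: "\<And>u. u \<in> FM n (?B' (Suc (Suc i))) \<Longrightarrow> ev (g (?d' (Suc i) u)) = 0"
      and s: "\<And>j c. c \<in> FH n (B (Suc i)) (\<delta> (Suc i)) j \<Longrightarrow>
        \<exists>z\<in>FH n (?B' (Suc i)) (case_nat (\<lambda>_. 0) (gen_deg Q) (Suc i)) j.
          (i \<noteq> 0 \<longrightarrow> ev (?d' i z) = 0) \<and> ev (g z) = ev c"
    have cyc_eq: "cyc z \<longleftrightarrow> (i \<noteq> 0 \<longrightarrow> ev (?d' i z) = 0)" for z
      unfolding cyc_def by (cases i) auto
    show thesis
    proof (rule that[of g])
      show "glin n A \<alpha> (B (Suc i)) (\<delta> (Suc i)) g" using a by (simp add: A_def \<alpha>_def)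
      show "\<exists>u\<in>FM n A'. ev z = ev (D u)" if "z \<in> FM n A" "cyc z" "ev (g z) = 0" for z
        using b[of z] that cyc_eq[of z] by (simp add: A_def A'_def D_def)
      show "ev (g (D u)) = 0" if "u \<in> FM n A'" for u using c[of u] that by (simp add: A'_def D_def)
      show "\<exists>z\<in>FH n A \<alpha> j. cyc z \<and> ev (g z) = ev c" if "c \<in> FH n (B (Suc i)) (\<delta> (Suc i)) j" for c
        using s[OF that] unfolding cyc_eq by (simp add: A_def \<alpha>_def)
    qed
  qed
  \<comment> \<open>Being a cycle depends on the class only. This matters for homogeneous cycles,
    where a class has one representative that is homogeneous and another that is known to be a
    cycle.\<close>
  have cyc_ev: "cyc v \<longleftrightarrow> cyc z" if vz: "v \<in> FM n A" "z \<in> FM n A" "ev v = ev z" for v z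
  proof (cases i)
    case (Suc k)
    have dk: "glin n A \<alpha> (gens Q k) (gen_deg Q k) (diff Q k)"
      using dl[of k] unfolding A_def \<alpha>_def Suc .
    have "ev (diff Q k (v - z)) = 0"
      by (rule glin_ev[OF dk FM_diff[OF vz(1,2)]]) (simp add: ev_diff vz(3))
    then show ?thesis unfolding cyc_def Suc using glin_diff[OF dk vz(1,2)] by (simp add: ev_diff)
  qed (simp add: cyc_def)
  have cyc_add: "cyc (u + v)" if "u \<in> FM n A" "v \<in> FM n A" "cyc u" "cyc v" for u v
  proof (cases i)
    case (Suc k)
    then show ?thesis using that glin_add[OF dl[of k], of u v] unfolding A_def cyc_def by (simp add: ev_add)
  qed (simp add: cyc_def)
  have cyc_vscale: "cyc (r \<star> v)" if "r \<in> pol n" "v \<in> FM n A" "cyc v" for r v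
  proof (cases i)
    case (Suc k)
    have "diff Q k (r \<star> v) = r \<star> diff Q k v"
      by (rule glin_vscale[OF dl that(1)]) (use that(2) in \<open>simp add: A_def Suc\<close>)
    then have "ev (diff Q k (r \<star> v)) = (\<lambda>b. cf r 0 * ev (diff Q k v) b)" by (simp only: ev_vscale)
    also have "\<dots> = 0" using that(3) by (simp add: cyc_def Suc fun_eq_iff pointwise)
    finally show ?thesis by (simp add: cyc_def Suc)
  qed (simp add: cyc_def)
  have cyc_zero: "cyc 0"
  proof (cases i)
    case (Suc k)
    then show ?thesis using glin_zero[OF dl[of k]] unfolding cyc_def by simp
  qed (simp add: cyc_def)

  \<comment> \<open>The homology of the tensored complex\<close>
  let ?T = "gtensor (poly_ring n) residue_field (gfree (poly_ring n) A \<alpha>)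
    :: ('k mpoly, 'k tvec set) gmodule"
  define t where "t = (tau n A \<alpha> :: 'k pvec \<Rightarrow> _)"
  have t_eq: "t u = t v \<longleftrightarrow> ev u = ev v" if "u \<in> FM n A" "v \<in> FM n A" for u v
    unfolding t_def by (rule tau_eq_iff[OF that])
  define Z where "Z = t ` {v \<in> FM n A. cyc v}"
  define N where "N = (\<lambda>u. t (D u)) ` FM n A'"
  define M where "M = ?T\<lparr>carrier := Z, hcomp := \<lambda>j. hcomp ?T j \<inter> Z\<rparr>"
  have Tor: "Tor (poly_ring n) residue_field (gquot (poly_ring n) I) i = gquot M N"
  proof -
    let ?F = "res_module (poly_ring n) Q"
    let ?G = "\<lambda>k. gtensor (poly_ring n) residue_field (?F k)"
    let ?m = "\<lambda>k. tensor_map (poly_ring n) residue_field (?F (Suc k)) (?F k) (diff Q k)"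
    have F: "?F k = gfree (poly_ring n) (gens Q k) (gen_deg Q k)" for k by (simp add: res_module_def)
    have map: "?m k (tau n (gens Q (Suc k)) (gen_deg Q (Suc k)) v)
        = tau n (gens Q k) (gen_deg Q k) (diff Q k v)" if "v \<in> FM n (gens Q (Suc k))" for k v
      unfolding F by (rule tensor_map_tau[OF dl that])
    have im: "?m i `
        carrier (?G (Suc i)) = N"
    proof -
      have "carrier (?G (Suc i)) = tau n A' \<alpha>' ` FM n A'"
        unfolding F gtensor_simps tens_carrier A'_def \<alpha>'_def ..
      moreover have "?m i (tau n A' \<alpha>' v) = t (D v)"
        if "v \<in> FM n A'" for v
        using map[of v i] that unfolding A'_def \<alpha>'_def t_def D_def A_def \<alpha>_def .
      ultimately show ?thesis unfolding N_def by (simp add: image_image)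
    qed
    have ker: "(case i of 0 \<Rightarrow> carrier (?G 0)
        | Suc k \<Rightarrow> a_kernel (?G (Suc k)) (?G k)
            (?m k)) = Z"
    proof (cases i)
      case 0
      then show ?thesis unfolding Z_def t_def A_def \<alpha>_def F by (simp add: tens_carrier cyc_def)
    next
      case (Suc k)
      have "a_kernel (?G (Suc k)) (?G k)
          (?m k) =
          {x \<in> t ` FM n A. ?m k x =
            tau n (gens Q k) (gen_deg Q k) 0}"
        unfolding a_kernel_def' F gtensor_simps tens_carrier tens_zero t_def A_def \<alpha>_def Suc ..
      also have "\<dots> = Z"
      proof -
        have "?m k (t v) = tau n (gens Q k) (gen_deg Q k) 0 \<longleftrightarrow> cyc v"
          if v: "v \<in> FM n A" for v
        proof -
          have v': "v \<in> FM n (gens Q (Suc k))" using v unfolding A_def Suc .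
          show ?thesis
            using map[OF v'] tau_eq_iff[OF glin_FM[OF dl v'] FM_zero, of "gen_deg Q k"]
            unfolding t_def A_def \<alpha>_def cyc_def Suc by simp
        qed
        then show ?thesis unfolding Z_def by blast
      qed
      finally show ?thesis unfolding Suc by simp
    qed
    show ?thesis
      unfolding Tor_def Let_def Q_def[symmetric] ker im M_def
      by (simp add: F A_def \<alpha>_def)
  qed
  have M_add: "t u \<oplus>\<^bsub>M\<^esub> t v = t (u + v)" if "u \<in> FM n A" "v \<in> FM n A" for u v
    unfolding M_def t_def using tens_add[OF that, of \<alpha>] by simp
  have M_smult: "r \<odot>\<^bsub>M\<^esub> t v = t (r \<star> v)" if "r \<in> pol n" "v \<in> FM n A" for r v
    unfolding M_def t_def using tens_smult[OF that, of \<alpha>] by simp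
  have M_hcomp: "hcomp M j = t ` {v \<in> FH n A \<alpha> j. cyc v}"
  proof -
    have "hcomp M j = t ` FH n A \<alpha> j \<inter> Z" unfolding M_def t_def tens_hcomp[symmetric] by simp
    also have "\<dots> = t ` {v \<in> FH n A \<alpha> j. cyc v}"
    proof (intro equalityI subsetI)
      fix x assume "x \<in> t ` FH n A \<alpha> j \<inter> Z"
      then obtain v z where v: "v \<in> FH n A \<alpha> j" "x = t v" and z: "z \<in> FM n A" "cyc z" "x = t z"
        unfolding Z_def by blast
      then have "ev v = ev z" using t_eq[OF FH_FM[OF v(1)] z(1)] by simp
      then have "cyc v" using cyc_ev[OF FH_FM[OF v(1)] z(1)] z(2) by simp
      then show "x \<in> t ` {v \<in> FH n A \<alpha> j. cyc v}" using v by blast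
    qed (auto simp: Z_def intro: FH_FM)
    finally show ?thesis .
  qed
  \<comment> \<open>The homology class of 1 \<otimes> v. Two such classes agree exactly if the
    constant coefficients of their representatives differ by those of some
    \<open>D u\<close>.\<close>
  define C where "C v = N +>\<^bsub>M\<^esub> t v" for v
  have C: "C v = (\<lambda>u. t (D u + v)) ` FM n A'" if v: "v \<in> FM n A" for v
    unfolding C_def a_r_coset_def' N_def using M_add[OF glin_FM[OF D] v] by auto
  have C_eqI: "C v = C v'" if v: "v \<in> FM n A" and v': "v' \<in> FM n A" and u: "u \<in> FM n A'" and e: "ev v = ev (D u + v')" for v v' u
  proof -
    have *: "C v \<subseteq> C v'" if v: "v \<in> FM n A" and v': "v' \<in> FM n A" and u: "u \<in> FM n A'" and e: "ev v = ev (D u + v')" for v v' u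
    proof
      fix x assume "x \<in> C v"
      then obtain y where y: "y \<in> FM n A'" "x = t (D y + v)" unfolding C[OF v] by blast
      have "ev (D y + v) = ev (D (y + u) + v')"
        using e glin_add[OF D y(1) u] by (simp add: ev_add add.assoc)
      then have "x = t (D (y + u) + v')"
        unfolding y(2) using t_eq[OF FM_add[OF glin_FM[OF D y(1)] v] FM_add[OF glin_FM[OF D FM_add[OF y(1) u]] v']] by blast
      then show "x \<in> C v'" unfolding C[OF v'] using FM_add[OF y(1) u] by blast
    qed
    have "ev v' = ev (D (- u) + v)" using e glin_uminus[OF D u] by (simp add: ev_add ev_uminus ev_diff)
    then show ?thesis using *[OF v v' u e] *[OF v' v FM_uminus[OF u]] by blast
  qed
  have C_eqD: "\<exists>u\<in>FM n A'. ev v = ev (D u + v')" if v: "v \<in> FM n A" and v': "v' \<in> FM n A" and e: "C v = C v'" for v v'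
  proof -
    have "t (D 0 + v) \<in> C v" unfolding C[OF v] using FM_zero by blast
    then have "t v \<in> C v'" unfolding e glin_zero[OF D] by simp
    then obtain u where u: "u \<in> FM n A'" "t v = t (D u + v')" unfolding C[OF v'] by blast
    then show ?thesis using t_eq[OF v FM_add[OF glin_FM[OF D u(1)] v']] by blast
  qed
  have C_add: "C u <+>\<^bsub>M\<^esub> C v = C (u + v)" if u: "u \<in> FM n A" and v: "v \<in> FM n A" for u v
  proof (intro equalityI subsetI)
    fix x assume "x \<in> C u <+>\<^bsub>M\<^esub> C v"
    then obtain y z where yz: "y \<in> FM n A'" "z \<in> FM n A'" "x = t (D y + u) \<oplus>\<^bsub>M\<^esub> t (D z + v)"
      unfolding set_add_def' C[OF u] C[OF v] by blast
    have "x = t ((D y + u) + (D z + v))"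
      unfolding yz(3) by (rule M_add[OF FM_add[OF glin_FM[OF D yz(1)] u] FM_add[OF glin_FM[OF D yz(2)] v]])
    also have "(D y + u) + (D z + v) = D (y + z) + (u + v)"
      unfolding glin_add[OF D yz(1,2)] by (simp add: ac_simps)
    finally show "x \<in> C (u + v)" unfolding C[OF FM_add[OF u v]] using FM_add[OF yz(1,2)] by blast
  next
    fix x assume "x \<in> C (u + v)"
    then obtain y where y: "y \<in> FM n A'" "x = t (D y + (u + v))" unfolding C[OF FM_add[OF u v]] by blast
    have "t (D y + u) \<oplus>\<^bsub>M\<^esub> t (D 0 + v) = t ((D y + u) + (D 0 + v))"
      by (rule M_add[OF FM_add[OF glin_FM[OF D y(1)] u] FM_add[OF glin_FM[OF D FM_zero] v]])
    also have "\<dots> = x" unfolding y(2) glin_zero[OF D] by (simp add: add.assoc)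
    finally have "x = t (D y + u) \<oplus>\<^bsub>M\<^esub> t (D 0 + v)" by simp
    moreover have "t (D y + u) \<in> C u" "t (D 0 + v) \<in> C v" unfolding C[OF u] C[OF v] using y(1) FM_zero by blast+
    ultimately show "x \<in> C u <+>\<^bsub>M\<^esub> C v" unfolding set_add_def' by blast
  qed
  have C_smult: "(\<Union>x\<in>C v. N +>\<^bsub>M\<^esub> (r \<odot>\<^bsub>M\<^esub> x)) = C (r \<star> v)" if r: "r \<in> pol n" and v: "v \<in> FM n A" for r v
  proof -
    have "N +>\<^bsub>M\<^esub> (r \<odot>\<^bsub>M\<^esub> x) = C (r \<star> v)" if x: "x \<in> C v" for x
    proof -
      obtain u where u: "u \<in> FM n A'" "x = t (D u + v)" using x unfolding C[OF v] by blast
      have F: "D u + v \<in> FM n A" by (rule FM_add[OF glin_FM[OF D u(1)] v])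
      have "N +>\<^bsub>M\<^esub> (r \<odot>\<^bsub>M\<^esub> x) = C (r \<star> (D u + v))" unfolding C_def u(2) M_smult[OF r F] ..
      also have "\<dots> = C (r \<star> v)"
        by (rule C_eqI[OF FM_vscale[OF r F] FM_vscale[OF r v] FM_vscale[OF r u(1)]])
          (simp only: glin_vscale[OF D r u(1)] vscale_add_right)
      finally show ?thesis .
    qed
    moreover have "t (D 0 + v) \<in> C v" unfolding C[OF v] using FM_zero by blast
    ultimately show ?thesis by blast
  qed
  have C_zero: "N = C 0" unfolding C[OF FM_zero] N_def by simp

  \<comment> \<open>The component of degree j of Tor\<close>
  let ?V = "comp_space (Tor (poly_ring n) residue_field (gquot (poly_ring n) I) i) j"
  define Cy where "Cy = {v \<in> FH n A \<alpha> j. cyc v}"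
  have CyF: "v \<in> FM n A" if "v \<in> Cy" for v using that FH_FM unfolding Cy_def by blast
  have Cy_add: "u + v \<in> Cy" if "u \<in> Cy" "v \<in> Cy" for u v
    using that FH_add cyc_add FH_FM unfolding Cy_def by blast
  have Cy_scale: "mon 0 c \<star> v \<in> Cy" if "v \<in> Cy" for c v
    using that FH_const cyc_vscale[OF pol_const] FH_FM unfolding Cy_def by blast
  have Cy_zero: "0 \<in> Cy" using cyc_zero FH_zero unfolding Cy_def by blast
  have V1: "carrier ?V = C ` Cy"
    unfolding comp_space_def Tor by (simp add: M_hcomp image_image C_def Cy_def)
  have V2: "\<zero>\<^bsub>?V\<^esub> = C 0" unfolding C_zero[symmetric] comp_space_def Tor by simp
  have V3: "X \<oplus>\<^bsub>?V\<^esub> Y = X <+>\<^bsub>M\<^esub> Y" for X Y unfolding comp_space_def Tor by simp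
  have V4: "c \<odot>\<^bsub>?V\<^esub> X = (\<Union>x\<in>X. N +>\<^bsub>M\<^esub> (mon 0 c \<odot>\<^bsub>M\<^esub> x))" for c X
    unfolding comp_space_def Tor by simp
  note V = V1 V2 V3 V4

  \<comment> \<open>Coordinates on this component\<close>
  define S where "S = {b \<in> B (Suc i). \<delta> (Suc i) b = j}"
  define m where "m = card S"
  obtain h where h: "bij_betw h {0..<m} S"
    using ex_bij_betw_nat_finite[of S] fin unfolding S_def m_def by blast
  \<comment> \<open>\<open>g v\<close> is homogeneous of degree \<open>j\<close>, so at a basis
    vector of another degree its entry has nonzero degree and thus no constant coefficient.\<close>
  have ev_off: "ev (g v) b = 0" if v: "v \<in> Cy" and b: "b \<notin> S" for v b
  proof -
    have gv: "g v \<in> FH n (B (Suc i)) (\<delta> (Suc i)) j" using v glin_FH[OF g] unfolding Cy_def by blast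
    show ?thesis
    proof (cases "b \<in> B (Suc i)")
      case True
      then show ?thesis using b hpol_coeff_0[OF FH_hpol[OF gv, of b]] by (auto simp: S_def ev_def)
    next
      case False
      then have "g v b = 0" using FM_supp[OF FH_FM[OF gv]] by blast
      then show ?thesis by (simp add: ev_def)
    qed
  qed
  have ev_gC: "ev (g v) = ev (g v')" if v: "v \<in> Cy" and v': "v' \<in> Cy" and e: "C v = C v'" for v v'
  proof -
    obtain u where u: "u \<in> FM n A'" "ev v = ev (D u + v')" using C_eqD[OF CyF[OF v] CyF[OF v'] e] by blast
    have F: "D u + v' \<in> FM n A" by (rule FM_add[OF glin_FM[OF D u(1)] CyF[OF v']])
    have "ev (g (v - (D u + v'))) = 0"
      by (rule glin_ev[OF g FM_diff[OF CyF[OF v] F]]) (simp add: ev_diff u(2))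
    then show ?thesis
      unfolding glin_diff[OF g CyF[OF v] F] glin_add[OF g glin_FM[OF D u(1)] CyF[OF v']] ev_diff ev_add g_bd[OF u(1)]
      by simp
  qed
  \<comment> \<open>Well defined on classes by \<open>ev_gC\<close>: \<open>g\<close> kills
    boundaries on the level of constant coefficients.\<close>
  define \<theta> where "\<theta> X = vec m (\<lambda>l. ev (g (SOME v. v \<in> Cy \<and> X = C v)) (h l))" for X
  have \<theta>: "\<theta> (C v) = vec m (\<lambda>l. ev (g v) (h l))" if v: "v \<in> Cy" for v
  proof -
    let ?u = "SOME u. u \<in> Cy \<and> C v = C u"
    have u: "?u \<in> Cy \<and> C v = C ?u" by (rule someI[of _ v]) (use v in simp)
    have "ev (g ?u) = ev (g v)" by (rule ev_gC[OF v conjunct1[OF u] conjunct2[OF u], symmetric])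
    then show ?thesis unfolding \<theta>_def by simp
  qed
  have \<theta>_inj: "C v = C v'" if v: "v \<in> Cy" and v': "v' \<in> Cy" and e: "\<theta> (C v) = \<theta> (C v')" for v v'
  proof -
    have eq: "ev (g v) (h l) = ev (g v') (h l)" if "l < m" for l
      using arg_cong[OF e, of "\<lambda>x. x $ l"] that unfolding \<theta>[OF v] \<theta>[OF v'] by simp
    have "ev (g v) b = ev (g v') b" for b
    proof (cases "b \<in> S")
      case True
      then obtain l where "l < m" "b = h l" using h by (auto simp: bij_betw_def)
      then show ?thesis using eq by simp
    next
      case False
      then show ?thesis using ev_off[OF v] ev_off[OF v'] by simp
    qed
    then have ee: "ev (g v) = ev (g v')" by blast
    let ?w = "v + mon 0 (- 1) \<star> v'"
    have w: "?w \<in> Cy" by (rule Cy_add[OF v Cy_scale[OF v']])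
    have "ev (g ?w) = 0"
      unfolding glin_add[OF g CyF[OF v] CyF[OF Cy_scale[OF v']]] glin_vscale[OF g pol_const CyF[OF v']] ev_add ev_vscale
      by (simp add: ee fun_eq_iff pointwise)
    then obtain u where u: "u \<in> FM n A'" "ev ?w = ev (D u)" using g_inj[OF CyF[OF w]] w unfolding Cy_def by blast
    have "ev v = ev ?w + ev v'" unfolding ev_add ev_vscale by (simp add: fun_eq_iff pointwise)
    then have "ev v = ev (D u + v')" by (simp only: ev_add[of "D u" v'] u(2))
    then show ?thesis by (rule C_eqI[OF CyF[OF v] CyF[OF v'] u(1)])
  qed
  have \<theta>_surj: "\<exists>v\<in>Cy. \<theta> (C v) = x" if x: "x \<in> carrier_vec m" for x
  proof -
    \<comment> \<open>A vector of constants supported on basis vectors of degree \<open>j\<close> is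
      homogeneous of degree \<open>j\<close>, so \<open>g_surj\<close> applies to it.\<close>
    define c :: "'k pvec" where "c b = (if b \<in> S then mon 0 (x $ inv_into {0..<m} h b) else 0)" for b
    have "finite {b. c b \<noteq> 0}"
      by (rule finite_subset[of _ S]) (use fin in \<open>auto simp: c_def S_def\<close>)
    then have "c \<in> FH n (B (Suc i)) (\<delta> (Suc i)) j"
      by (auto simp: FH_def FM_def c_def S_def)
    then obtain z where z: "z \<in> Cy" "ev (g z) = ev c" using g_surj unfolding Cy_def by blast
    have "\<theta> (C z) = x"
    proof
      show "dim_vec (\<theta> (C z)) = dim_vec x" using x by (simp add: \<theta>[OF z(1)])
      fix l assume "l < dim_vec x"
      then have l: "l < m" using x by simp
      then have "h l \<in> S" "inv_into {0..<m} h (h l) = l"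
        using h by (auto simp: bij_betw_def inv_into_f_f)
      then show "\<theta> (C z) $ l = x $ l" using l unfolding \<theta>[OF z(1)] z(2) by (simp add: ev_def c_def)
    qed
    then show ?thesis using z(1) by blast
  qed
  interpret vs: vec_space "TYPE('k)" m .
  have "vectorspace.dim class_ring ?V = vs.dim"
  proof (rule vectorspace_dim_iso[where \<theta> = \<theta>])
    show "vectorspace class_ring (module_vec TYPE('k) m)" by (rule vs.vectorspace_axioms)
    show "vs.fin_dim" by (rule vs.fin_dim)
    show "X \<oplus>\<^bsub>?V\<^esub> Y \<in> carrier ?V" if "X \<in> carrier ?V" "Y \<in> carrier ?V" for X Y
      using that unfolding V by (auto simp: C_add CyF intro!: imageI Cy_add)
    show "c \<odot>\<^bsub>?V\<^esub> X \<in> carrier ?V" if "X \<in> carrier ?V" for c X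
      using that unfolding V by (auto simp: C_smult CyF intro!: imageI Cy_scale)
    show "\<zero>\<^bsub>?V\<^esub> \<in> carrier ?V" unfolding V using Cy_zero by blast
    show "bij_betw \<theta> (carrier ?V) (carrier (module_vec TYPE('k) m))"
      unfolding bij_betw_def V
    proof
      show "inj_on \<theta> (C ` Cy)" using \<theta>_inj by (auto intro!: inj_onI)
      show "\<theta> ` C ` Cy = carrier (module_vec TYPE('k) m)"
      proof (intro equalityI subsetI)
        show "x \<in> carrier (module_vec TYPE('k) m)" if "x \<in> \<theta> ` C ` Cy" for x
          using that \<theta> by (auto simp: module_vec_def)
        show "x \<in> \<theta> ` C ` Cy" if "x \<in> carrier (module_vec TYPE('k) m)" for x
          using that \<theta>_surj[of x] by (auto simp: module_vec_def)
      qed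
    qed
    show "\<theta> (X \<oplus>\<^bsub>?V\<^esub> Y) = \<theta> X \<oplus>\<^bsub>module_vec TYPE('k) m\<^esub> \<theta> Y" if XY: "X \<in> carrier ?V" "Y \<in> carrier ?V" for X Y
    proof -
      obtain u v where uv: "u \<in> Cy" "X = C u" "v \<in> Cy" "Y = C v" using XY unfolding V by blast
      show ?thesis
        unfolding V uv(2,4) C_add[OF CyF[OF uv(1)] CyF[OF uv(3)]] \<theta>[OF uv(1)] \<theta>[OF uv(3)] \<theta>[OF Cy_add[OF uv(1,3)]]
          glin_add[OF g CyF[OF uv(1)] CyF[OF uv(3)]] ev_add
        by (auto simp: module_vec_def pointwise)
    qed
    show "\<theta> (c \<odot>\<^bsub>?V\<^esub> X) = c \<odot>\<^bsub>module_vec TYPE('k) m\<^esub> \<theta> X" if X: "X \<in> carrier ?V" for c X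
    proof -
      obtain v where v: "v \<in> Cy" "X = C v" using X unfolding V by blast
      show ?thesis
        unfolding V v(2) C_smult[OF pol_const CyF[OF v(1)]] \<theta>[OF v(1)] \<theta>[OF Cy_scale[OF v(1)]]
          glin_vscale[OF g pol_const CyF[OF v(1)]] ev_vscale
        by (auto simp: module_vec_def)
    qed
    show "\<theta> \<zero>\<^bsub>?V\<^esub> = \<zero>\<^bsub>module_vec TYPE('k) m\<^esub>"
      unfolding V \<theta>[OF Cy_zero] glin_zero[OF g] by (auto simp: module_vec_def pointwise)
  qed
  also have "vs.dim = m" by (rule vs.dim_is_n)
  finally show ?thesis unfolding betti_def m_def S_def .
qed

theorem theorem2p10:
  fixes p n e :: nat and I :: "'k::field mpoly set"
  assumes "CHAR('k) = p" and "p > 0"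
    and "homogeneous_ideal (poly_ring n) I"
    and "e \<ge> 1"
  shows "(\<forall>i j. betti n (frobenius_power (poly_ring n) I (p ^ e)) i j \<noteq> 0 \<longrightarrow>
            (\<exists>k. j = int (p ^ e) * k \<and> betti n I i k \<noteq> 0))
       \<and> (\<forall>i k. betti n (frobenius_power (poly_ring n) I (p ^ e)) i (int (p ^ e) * k) = betti n I i k)"
proof -
  let ?q = "p ^ e" and ?J = "frobenius_power (poly_ring n) I (p ^ e)"
  have I: "hideal n I" by (rule homogeneous_ideal_hideal[OF assms(3)])
  obtain B \<delta> d where P: "cres n I B \<delta> d" "minimal_cres n B d" and lf: "\<And>i. locfin (B i) (\<delta> i)"
    using minimal_cres_exists[OF I] by blast
  have "prime CHAR('k)" using assms(1,2) by (intro prime_CHAR_semidom) simp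
  then obtain \<rho> :: "'k \<Rightarrow> 'k \<Rightarrow> 'k" where "frobenius_coordinates ?q \<rho>"
    using frobenius_coordinates_exist[of ?q e] assms(1) by blast
  then interpret frobenius_coordinates ?q \<rho> .
  note J = frobenius_power_hideal(1)[OF I]
  have fin: "finite {b \<in> B (Suc i). \<delta> (Suc i) b = k}" for i k
    by (rule finite_subset[of _ "{b \<in> B (Suc i). \<delta> (Suc i) b \<le> k}"]) (use lf in \<open>auto simp: locfin_def\<close>)
  have bI: "betti n I i k = card {b \<in> B (Suc i). \<delta> (Suc i) b = k}" for i k
    by (rule betti_minimal_cres[OF I P fin])
  have q: "int ?q * a = int ?q * k \<longleftrightarrow> a = k" for a k using assms(2) by simp
  \<comment> \<open>Degrees that are not multiples of \<open>q\<close> carry no basis vector of the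
    twisted resolution; in the others \<open>q\<close> cancels.\<close>
  have finJ: "finite {b \<in> B (Suc i). int ?q * \<delta> (Suc i) b = j}" for i j
  proof (cases "\<exists>k. j = int ?q * k")
    case True
    then obtain k where j: "j = int ?q * k" by blast
    show ?thesis unfolding j q by (rule fin)
  next
    case False
    then have "{b \<in> B (Suc i). int ?q * \<delta> (Suc i) b = j} = {}" by blast
    then show ?thesis by (simp only: finite.emptyI)
  qed
  \<comment> \<open>Both counts run over the same set \<open>B (Suc i)\<close>, where
    \<open>Suc\<close> accounts for the coding with R at index 0; only the degrees have been
    multiplied by \<open>q\<close>.\<close>
  have bJ: "betti n ?J i j = card {b \<in> B (Suc i). int ?q * \<delta> (Suc i) b = j}" for i j
    by (rule betti_minimal_cres[OF J frobenius_cres[OF I P] finJ])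
  have eq: "betti n ?J i (int ?q * k) = betti n I i k" for i k
    unfolding bI bJ q ..
  have "\<exists>k. j = int ?q * k \<and> betti n I i k \<noteq> 0" if nz: "betti n ?J i j \<noteq> 0" for i j
  proof -
    have "{b \<in> B (Suc i). int ?q * \<delta> (Suc i) b = j} \<noteq> {}" using nz unfolding bJ by (metis card.empty)
    then obtain k where "j = int ?q * k" by blast
    then show ?thesis using nz eq by metis
  qed
  then show ?thesis using eq by blast
qed

end
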